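(* Let $E$ be a finite graph with vertex set $\{v_1,\dots,v_h\}$ ($h$ distinct vertices), numbered so that the regular vertices are exactly $v_1,\dots,v_z$. Let $A_E$ be the incidence matrix of $E$ with respect to this numbering, let $$J_E=\begin{pmatrix} I_z & 0\\ 0 & 0\end{pmatrix}\in M_h(\mathbb{N}),\qquad b=[1\ \cdots\ 1]^t\in M_{h\times 1}(\mathbb{N}),$$ and let $[A_E^t-J_E\ \ b]$ be the $h\times(h+1)$ matrix obtained from $A_E^t-J_E$ by adjoining the column $b$. Let $K$ be an arbitrary field. Then the Leavitt path algebra $L_K(E)$ has Invariant Basis Number if and only if $$\mathrm{rank}(A_E^t-J_E)<\mathrm{rank}([A_E^t-J_E\ \ b]),$$ where ranks of integer matrices are taken over $\mathbb{Q}$.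
   Context: A (directed) graph $E=(E^0,E^1,s,r)$ consists of two disjoint sets $E^0$ (vertices) and $E^1$ (edges) and maps $s,r:E^1\to E^0$ (source and range). It is finite if $E^0$ and $E^1$ are finite; $E^0$ is assumed nonempty. A vertex $v$ is a sink if $s^{-1}(v)=\emptyset$ and regular if $0<|s^{-1}(v)|<\infty$. If $E^0=\{v_1,\dots,v_h\}$, the incidence matrix $A_E=(a_{ij})$ is the $h\times h$ matrix in which $a_{ij}$ is the number of edges $e$ with $s(e)=v_i$ and $r(e)=v_j$ (so the row of a sink is zero). $A_E^t$ denotes its transpose and $I_z$ the $z\times z$ identity matrix. For a field $K$, the Leavitt path algebra $L_K(E)$ is the $K$-algebra generated by $\{v,e,e^*\mid v\in E^0,e\in E^1\}$ subject to, for all $v,w\in E^0$, $e,f\in E^1$: (1) $vw=\delta_{v,w}w$; (2) $s(e)e=e=e\,r(e)$ and $r(e)e^*=e^*=e^*s(e)$; (3) $e^*f=\delta_{e,f}r(e)$; (4) $v=\sum_{e\in s^{-1}(v)}ee^*$ for every regular vertex $v$. For finite $E$ it is unital with identity $\sum_{v\in E^0}v$. A unital ring $R$ has Invariant Basis Number if for all positive integers $m,n$, $R^m\cong R^n$ as right $R$-modules implies $m=n$. *)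

theory Defs
  imports
    "HOL-Library.FuncSet"
    "HOL-Library.Poly_Mapping"
    "HOL-Algebra.QuotRing"
    "Graph_Theory.Digraph"
    "Jordan_Normal_Form.DL_Rank"
begin

section \<open>Free associative algebras\<close>

text \<open>
  Words over \<open>'g\<close> form a monoid under concatenation, written additively because the convolution
  product on \<^typ>\<open>'a \<Rightarrow>\<^sub>0 'b\<close> is set up for additive monoids of exponents.  With it,
  \<open>'g fword \<Rightarrow>\<^sub>0 'k\<close> is the free unital associative \<open>'k\<close>-algebra on \<open>'g\<close>.
\<close>

datatype 'g fword = FWord (letters: "'g list")

instantiation fword :: (type) monoid_add
begin

definition zero_fword :: "'a fword" where
  "0 = FWord []"

definition plus_fword :: "'a fword \<Rightarrow> 'a fword \<Rightarrow> 'a fword" where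
  "u + w = FWord (letters u @ letters w)"

instance
  by standard (simp_all add: zero_fword_def plus_fword_def)

end

definition gen :: "'g \<Rightarrow> ('g fword \<Rightarrow>\<^sub>0 'k::field)" where
  "gen g = Poly_Mapping.single (FWord [g]) 1"

text \<open>
  The free algebra on \<open>X\<close> without identity: the linear combinations of nonempty words.
\<close>

definition free_algebra :: "'g set \<Rightarrow> ('g fword \<Rightarrow>\<^sub>0 'k::field) set" where
  "free_algebra X = {p. \<forall>w \<in> Poly_Mapping.keys p. letters w \<noteq> [] \<and> set (letters w) \<subseteq> X}"

text \<open>
  The two-sided algebra ideal of \<open>A\<close> generated by \<open>S\<close>.  Since \<open>A\<close> need not contain an identity,
  closure under scalars (embedded as multiples of the empty word) is not automatic.
\<close>

inductive_set algebra_ideal ::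
  "('g fword \<Rightarrow>\<^sub>0 'k::field) set \<Rightarrow> ('g fword \<Rightarrow>\<^sub>0 'k) set \<Rightarrow> ('g fword \<Rightarrow>\<^sub>0 'k) set"
  for A S where
  zero: "0 \<in> algebra_ideal A S"
| base: "p \<in> S \<Longrightarrow> p \<in> algebra_ideal A S"
| add: "p \<in> algebra_ideal A S \<Longrightarrow> q \<in> algebra_ideal A S \<Longrightarrow> p + q \<in> algebra_ideal A S"
| scale: "p \<in> algebra_ideal A S \<Longrightarrow> Poly_Mapping.single 0 c * p \<in> algebra_ideal A S"
| left: "p \<in> algebra_ideal A S \<Longrightarrow> a \<in> A \<Longrightarrow> a * p \<in> algebra_ideal A S"
| right: "p \<in> algebra_ideal A S \<Longrightarrow> a \<in> A \<Longrightarrow> p * a \<in> algebra_ideal A S"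


section \<open>Leavitt path algebras\<close>

definition regular_verts :: "('v, 'e) pre_digraph \<Rightarrow> 'v set" where
  "regular_verts E = {v \<in> verts E. out_arcs E v \<noteq> {} \<and> finite (out_arcs E v)}"

datatype ('v, 'e) lpa_gen = Vertex 'v | Edge 'e | Ghost 'e

definition lpa_gens :: "('v, 'e) pre_digraph \<Rightarrow> ('v, 'e) lpa_gen set" where
  "lpa_gens E = Vertex ` verts E \<union> Edge ` arcs E \<union> Ghost ` arcs E"

text \<open>A relation \<open>p = q\<close> is recorded as the element \<open>p - q\<close>.\<close>

definition lpa_rels :: "('v, 'e) pre_digraph \<Rightarrow> (('v, 'e) lpa_gen fword \<Rightarrow>\<^sub>0 'k::field) set" where
  "lpa_rels E =
     {gen (Vertex v) * gen (Vertex w) - (if v = w then gen (Vertex w) else 0) | v w.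
        v \<in> verts E \<and> w \<in> verts E}
   \<union> {gen (Vertex (tail E e)) * gen (Edge e) - gen (Edge e) | e. e \<in> arcs E}
   \<union> {gen (Edge e) * gen (Vertex (head E e)) - gen (Edge e) | e. e \<in> arcs E}
   \<union> {gen (Vertex (head E e)) * gen (Ghost e) - gen (Ghost e) | e. e \<in> arcs E}
   \<union> {gen (Ghost e) * gen (Vertex (tail E e)) - gen (Ghost e) | e. e \<in> arcs E}
   \<union> {gen (Ghost e) * gen (Edge f) - (if e = f then gen (Vertex (head E e)) else 0) | e f.
        e \<in> arcs E \<and> f \<in> arcs E}
   \<union> {gen (Vertex v) - (\<Sum>e\<in>out_arcs E v. gen (Edge e) * gen (Ghost e)) | v.
        v \<in> regular_verts E}"

text \<open>
  The algebra has no identity before the relations are imposed: the field \<^const>\<open>one\<close> below is only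
  a designated element, whose class is the identity of the quotient when the graph is finite.
\<close>

definition lpa_free ::
  "'k::field itself \<Rightarrow> ('v, 'e) pre_digraph \<Rightarrow> (('v, 'e) lpa_gen fword \<Rightarrow>\<^sub>0 'k) ring" where
  "lpa_free K E =
     \<lparr>carrier = free_algebra (lpa_gens E), mult = (*), one = (\<Sum>v\<in>verts E. gen (Vertex v)),
      zero = 0, add = (+)\<rparr>"

definition leavitt_path_algebra ::
  "'k::field itself \<Rightarrow> ('v, 'e) pre_digraph \<Rightarrow> (('v, 'e) lpa_gen fword \<Rightarrow>\<^sub>0 'k) set ring" where
  "leavitt_path_algebra K E =
     lpa_free K E Quot algebra_ideal (free_algebra (lpa_gens E)) (lpa_rels E)"


section \<open>Invariant Basis Number\<close>

definition free_rmodule :: "('a, 'm) ring_scheme \<Rightarrow> nat \<Rightarrow> (nat \<Rightarrow> 'a) set" where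
  "free_rmodule R n = {..<n} \<rightarrow>\<^sub>E carrier R"

definition free_rmodule_iso :: "('a, 'm) ring_scheme \<Rightarrow> nat \<Rightarrow> nat \<Rightarrow> bool" where
  "free_rmodule_iso R m n \<longleftrightarrow>
     (\<exists>\<phi>. bij_betw \<phi> (free_rmodule R m) (free_rmodule R n)
       \<and> (\<forall>x \<in> free_rmodule R m. \<forall>y \<in> free_rmodule R m.
            \<phi> (\<lambda>i\<in>{..<m}. x i \<oplus>\<^bsub>R\<^esub> y i) = (\<lambda>i\<in>{..<n}. \<phi> x i \<oplus>\<^bsub>R\<^esub> \<phi> y i))
       \<and> (\<forall>x \<in> free_rmodule R m. \<forall>a \<in> carrier R.
            \<phi> (\<lambda>i\<in>{..<m}. x i \<otimes>\<^bsub>R\<^esub> a) = (\<lambda>i\<in>{..<n}. \<phi> x i \<otimes>\<^bsub>R\<^esub> a)))"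

definition invariant_basis_number :: "('a, 'm) ring_scheme \<Rightarrow> bool" where
  "invariant_basis_number R \<longleftrightarrow>
     (\<forall>m n. 0 < m \<longrightarrow> 0 < n \<longrightarrow> free_rmodule_iso R m n \<longrightarrow> m = n)"


section \<open>Matrices\<close>

text \<open>Vertices are numbered \<open>v 0, \<dots>, v (h - 1)\<close>, following the index convention for matrices.\<close>

definition incidence_mat :: "('v, 'e) pre_digraph \<Rightarrow> (nat \<Rightarrow> 'v) \<Rightarrow> nat \<Rightarrow> int mat" where
  "incidence_mat E v h =
     mat h h (\<lambda>(i, j). int (card {e \<in> arcs E. tail E e = v i \<and> head E e = v j}))"

definition J_mat :: "nat \<Rightarrow> nat \<Rightarrow> int mat" where
  "J_mat h z = four_block_mat (1\<^sub>m z) (0\<^sub>m z (h - z)) (0\<^sub>m (h - z) z) (0\<^sub>m (h - z) (h - z))"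

definition adjoin_col :: "'a mat \<Rightarrow> 'a vec \<Rightarrow> 'a mat" where
  "adjoin_col M b = mat_of_cols (dim_row M) (cols M @ [b])"

definition rank_over_rat :: "int mat \<Rightarrow> nat" where
  "rank_over_rat M = vec_space.rank (dim_row M) (map_mat rat_of_int M)"

end

theory Submission
  imports Defs "HOL-Library.Function_Algebras"
begin

text \<open>
  Write \<open>[w]\<close> for the right ideal generated by a vertex \<open>w\<close>.  The algebra is the direct sum of all
  \<open>[w]\<close>, and the last relation makes \<open>[w]\<close> isomorphic to the direct sum of the \<open>[head e]\<close> over the
  edges \<open>e\<close> leaving a regular \<open>w\<close>.  If the all-ones vector is a rational combination of the columns
  of the matrix, clearing denominators and separating signs gives \<open>N > 0\<close> and \<open>k\<close> with isomorphic
  free modules of ranks \<open>k + N\<close> and \<open>k\<close>.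

  Otherwise some integer function \<open>\<phi>\<close> on the vertices has non-zero total and satisfies
  \<open>\<phi> w = (\<Sum>e. \<phi> (head e))\<close>, over the edges \<open>e\<close> leaving \<open>w\<close>, at every regular \<open>w\<close>.  Writing
  \<open>\<phi> = a - b\<close>, the algebra acts by partial injections on functions on two sets of points, one with
  levels from \<open>a w\<close> and one with levels from \<open>b w\<close> upwards over each \<open>w\<close>, and the two actions of
  every element differ at finitely many points only.  An isomorphism of free modules of ranks \<open>m\<close>
  and \<open>n\<close> acts invertibly on both sides, and comparing relative dimensions gives
  \<open>m * (\<Sum>w. \<phi> w) = n * (\<Sum>w. \<phi> w)\<close>.
\<close>

section \<open>Matrices over the quotient by an ideal\<close>

text \<open>One half of the criterion only has to exhibit an isomorphism. The other half must show
  that the relations do not identify too much, which takes a numerical invariant of invertible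
  matrices over the algebra. If \<phi> were non-negative, spaces of dimension \<phi> w over the
  vertices w would carry a finite-dimensional representation: the equation at a regular w is exactly
  the dimension count that lets the space over w be the direct sum of the spaces over the heads of
  its edges. A negative value leaves no such space. So \<phi> w is realised as a difference in size
  between two infinite sets of levels, and the two infinite-dimensional representations are tied
  together by using the same bijections above a common level M. The function \<phi> itself is the
  certificate that a linear system is unsolvable: it annihilates every column of the matrix, but not
  the all-ones vector.\<close>

locale ideal_quotient =
  fixes A I :: "'r::ring_1 set" and u :: 'r
  assumes A_zero: "0 \<in> A"
    and A_add: "a \<in> A \<Longrightarrow> b \<in> A \<Longrightarrow> a + b \<in> A"
    and A_uminus: "a \<in> A \<Longrightarrow> - a \<in> A"
    and A_mult: "a \<in> A \<Longrightarrow> b \<in> A \<Longrightarrow> a * b \<in> A"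
    and I_sub: "I \<subseteq> A"
    and I_zero: "0 \<in> I"
    and I_add: "a \<in> I \<Longrightarrow> b \<in> I \<Longrightarrow> a + b \<in> I"
    and I_uminus: "a \<in> I \<Longrightarrow> - a \<in> I"
    and I_left: "a \<in> A \<Longrightarrow> b \<in> I \<Longrightarrow> a * b \<in> I"
    and I_right: "a \<in> A \<Longrightarrow> b \<in> I \<Longrightarrow> b * a \<in> I"
    and u_in: "u \<in> A"
    and u_left: "a \<in> A \<Longrightarrow> u * a - a \<in> I"
    and u_right: "a \<in> A \<Longrightarrow> a * u - a \<in> I"
begin

text \<open>Calculations stay with representatives in the ambient ring, where sums and
  distributivity are available to the simplifier; cosets enter only when a statement about the
  factor ring is translated. Membership in \<open>A\<close> is a separate matter, transported by
  \<open>eqv_in_A\<close>.\<close>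

definition eqv :: "'r \<Rightarrow> 'r \<Rightarrow> bool" (infix \<open>\<doteq>\<close> 50) where
  "a \<doteq> b \<longleftrightarrow> a - b \<in> I"

lemma A_sum: "(\<And>x. x \<in> S \<Longrightarrow> f x \<in> A) \<Longrightarrow> sum f S \<in> A"
  by (induction S rule: infinite_finite_induct) (auto simp: A_zero A_add)

lemma eqv_refl [simp]: "a \<doteq> a"
  by (simp add: eqv_def I_zero)

lemma eqv_sym: "a \<doteq> b \<Longrightarrow> b \<doteq> a"
  unfolding eqv_def using I_uminus[of "a - b"] by simp

lemma eqv_trans [trans]: "a \<doteq> b \<Longrightarrow> b \<doteq> c \<Longrightarrow> a \<doteq> c"
  unfolding eqv_def using I_add[of "a - b" "b - c"] by simp

lemma eqv_add: "a \<doteq> b \<Longrightarrow> c \<doteq> d \<Longrightarrow> a + c \<doteq> b + d"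
  unfolding eqv_def using I_add[of "a - b" "c - d"] by (simp add: algebra_simps)

lemma eqv_mult_left: "c \<in> A \<Longrightarrow> a \<doteq> b \<Longrightarrow> c * a \<doteq> c * b"
  unfolding eqv_def using I_left[of c "a - b"] by (simp add: algebra_simps)

lemma eqv_mult_right: "c \<in> A \<Longrightarrow> a \<doteq> b \<Longrightarrow> a * c \<doteq> b * c"
  unfolding eqv_def using I_right[of c "a - b"] by (simp add: algebra_simps)

lemma eqv_mult: "a \<in> A \<Longrightarrow> d \<in> A \<Longrightarrow> a \<doteq> b \<Longrightarrow> c \<doteq> d \<Longrightarrow> a * c \<doteq> b * d"
  by (meson eqv_mult_left eqv_mult_right eqv_trans)

lemma eqv_sum: "(\<And>x. x \<in> S \<Longrightarrow> f x \<doteq> g x) \<Longrightarrow> sum f S \<doteq> sum g S"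
  by (induction S rule: infinite_finite_induct) (auto simp: eqv_add)

lemma eqv_in_A: "a \<doteq> b \<Longrightarrow> b \<in> A \<Longrightarrow> a \<in> A"
  unfolding eqv_def using A_add[of "a - b" b] I_sub by auto

lemma eqv_u_left: "a \<in> A \<Longrightarrow> u * a \<doteq> a"
  by (simp add: eqv_def u_left)

lemma eqv_u_right: "a \<in> A \<Longrightarrow> a * u \<doteq> a"
  by (simp add: eqv_def u_right)

definition residue_class :: "'r \<Rightarrow> 'r set" where
  "residue_class a = {b. b \<doteq> a}"

text \<open>Lets a matrix over \<open>A\<close> act on a vector of cosets: its entries multiply the
  chosen representatives, and another choice changes the result only by an element of
  \<open>I\<close>.\<close>

definition rep :: "'r set \<Rightarrow> 'r" where
  "rep X = (SOME a. a \<in> A \<and> residue_class a = X)"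

definition base_ring :: "'r ring" where
  "base_ring = \<lparr>carrier = A, mult = (*), one = u, zero = 0, add = (+)\<rparr>"

abbreviation quot :: "'r set ring" where
  "quot \<equiv> base_ring Quot I"

lemma residue_class_eq_iff: "residue_class a = residue_class b \<longleftrightarrow> a \<doteq> b"
proof
  show "a \<doteq> b" if "residue_class a = residue_class b"
  proof -
    have "a \<in> residue_class a"
      by (simp add: residue_class_def)
    then have "a \<in> residue_class b"
      by (simp only: that)
    then show ?thesis
      by (simp add: residue_class_def)
  qed
  show "residue_class a = residue_class b" if "a \<doteq> b"
    unfolding residue_class_def
    by (intro Collect_cong iffI) (erule eqv_trans[OF _ that], erule eqv_trans[OF _ eqv_sym[OF that]])
qed

lemma a_r_coset_base_ring: "I +>\<^bsub>base_ring\<^esub> a = residue_class a"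
proof -
  have "b \<in> residue_class a \<longleftrightarrow> (\<exists>i\<in>I. b = i + a)" for b
    unfolding residue_class_def eqv_def by (metis add_diff_cancel_right' diff_add_cancel mem_Collect_eq)
  then show ?thesis
    by (auto simp: a_r_coset_def' base_ring_def)
qed

lemma carrier_quot: "carrier quot = residue_class ` A"
  by (auto simp: FactRing_def A_RCOSETS_def' a_r_coset_base_ring) (auto simp: base_ring_def)

lemma residue_class_in_quot: "a \<in> A \<Longrightarrow> residue_class a \<in> carrier quot"
  by (simp add: carrier_quot)

lemma rep_in: "X \<in> carrier quot \<Longrightarrow> rep X \<in> A"
  and residue_class_rep: "X \<in> carrier quot \<Longrightarrow> residue_class (rep X) = X"
proof -
  assume "X \<in> carrier quot"
  then have "\<exists>a. a \<in> A \<and> residue_class a = X"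
    by (auto simp: carrier_quot)
  from someI_ex[OF this] show "rep X \<in> A" "residue_class (rep X) = X"
    by (auto simp: rep_def)
qed

lemma rep_residue_class: "a \<in> A \<Longrightarrow> rep (residue_class a) \<doteq> a"
  by (metis residue_class_eq_iff residue_class_in_quot residue_class_rep)

text \<open>The library multiplies cosets by uniting the cosets of all products of representatives.
  As \<open>I\<close> absorbs multiplication by \<open>A\<close>, this is a union of one and the
  same coset over a nonempty index set.\<close>

lemma mult_quot:
  assumes "a \<in> A" "b \<in> A"
  shows "residue_class a \<otimes>\<^bsub>quot\<^esub> residue_class b = residue_class (a * b)"
proof -
  have eq: "residue_class (x * y) = residue_class (a * b)" if "x \<in> residue_class a" "y \<in> residue_class b" for x y
    using that assms unfolding residue_class_eq_iff
    by (intro eqv_mult) (auto simp: residue_class_def intro: eqv_in_A)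
  have "residue_class a \<otimes>\<^bsub>quot\<^esub> residue_class b
      = (\<Union>x\<in>residue_class a. \<Union>y\<in>residue_class b. residue_class (x * y))"
    by (simp add: FactRing_def rcoset_mult_def a_r_coset_base_ring) (simp add: base_ring_def)
  also have "\<dots> = (\<Union>x\<in>residue_class a. \<Union>y\<in>residue_class b. residue_class (a * b))"
    by (intro SUP_cong refl eq)
  also have "a \<in> residue_class a" "b \<in> residue_class b"
    by (simp_all add: residue_class_def)
  then have "(\<Union>x\<in>residue_class a. \<Union>y\<in>residue_class b. residue_class (a * b)) = residue_class (a * b)"
    by auto
  finally show ?thesis .
qed

lemma add_quot:
  shows "residue_class a \<oplus>\<^bsub>quot\<^esub> residue_class b = residue_class (a + b)"
proof -
  have "\<exists>p q. p \<doteq> a \<and> q \<doteq> b \<and> c = p + q" if "c \<doteq> a + b" for c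
  proof (intro exI conjI)
    show "c - b \<doteq> a"
      using that by (simp add: eqv_def algebra_simps)
  qed auto
  then show ?thesis
    by (auto simp: FactRing_def set_add_def' residue_class_def base_ring_def intro: eqv_add)
qed

section \<open>Matrices over the quotient and isomorphisms of free modules\<close>

definition inverse_matrices ::
  "'i set \<Rightarrow> ('i \<Rightarrow> 'r) \<Rightarrow> 'j set \<Rightarrow> ('j \<Rightarrow> 'r) \<Rightarrow> ('i \<Rightarrow> 'j \<Rightarrow> 'r) \<Rightarrow> ('j \<Rightarrow> 'i \<Rightarrow> 'r) \<Rightarrow> bool" where
  "inverse_matrices S e T f P Q \<longleftrightarrow>
     (\<forall>i\<in>S. \<forall>j\<in>T. P i j \<in> A \<and> Q j i \<in> A)
   \<and> (\<forall>i\<in>S. \<forall>i'\<in>S. (\<Sum>j\<in>T. P i j * Q j i') \<doteq> (if i = i' then e i else 0))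
   \<and> (\<forall>j\<in>T. \<forall>j'\<in>T. (\<Sum>i\<in>S. Q j i * P i j') \<doteq> (if j = j' then f j else 0))"

lemma matrix_mult_unit:
  fixes a :: "nat \<Rightarrow> 'r"
  assumes P: "\<And>i j. i < n \<Longrightarrow> j < m \<Longrightarrow> P i j \<in> A" "\<And>i j. j < m \<Longrightarrow> i < n \<Longrightarrow> Q j i \<in> A"
    and QP: "\<And>j j'. j < m \<Longrightarrow> j' < m \<Longrightarrow> (\<Sum>i<n. Q j i * P i j') \<doteq> (if j = j' then u else 0)"
    and a: "\<And>j. j < m \<Longrightarrow> a j \<in> A" and j: "j < m"
  shows "(\<Sum>i<n. Q j i * (\<Sum>j'<m. P i j' * a j')) \<doteq> a j"
proof -
  have "(\<Sum>i<n. Q j i * (\<Sum>j'<m. P i j' * a j')) = (\<Sum>j'<m. (\<Sum>i<n. Q j i * P i j') * a j')"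
    by (simp add: sum_distrib_left sum_distrib_right mult.assoc) (rule sum.swap)
  also have "\<dots> \<doteq> (\<Sum>j'<m. (if j = j' then u else 0) * a j')"
    using QP j a by (intro eqv_sum eqv_mult_right) auto
  also have "\<dots> = u * a j"
    using j by (simp add: if_distrib[of "\<lambda>x. x * _"] cong: if_cong)
  also have "\<dots> \<doteq> a j"
    using a j by (intro eqv_u_left) auto
  finally show ?thesis .
qed

lemma free_rmodule_quotE:
  assumes "x \<in> free_rmodule quot n"
  shows "i < n \<Longrightarrow> x i \<in> carrier quot" "\<not> i < n \<Longrightarrow> x i = undefined"
  using assms by (auto simp: free_rmodule_def PiE_iff extensional_def)

lemma free_rmodule_quotI: "(\<And>i. i < n \<Longrightarrow> a i \<in> A) \<Longrightarrow> (\<lambda>i\<in>{..<n}. residue_class (a i)) \<in> free_rmodule quot n"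
  by (auto simp: free_rmodule_def residue_class_in_quot)

text \<open>Matrices multiply column vectors from the left, so the induced maps commute with scalars
  on the right. An \<open>n\<close> by \<open>m\<close> matrix maps rank \<open>m\<close> to rank
  \<open>n\<close>, hence the order of the ranks in the conclusion.\<close>

lemma free_rmodule_iso_quotI:
  assumes "inverse_matrices {..<n} (\<lambda>_. u) {..<m} (\<lambda>_. u) P Q"
  shows "free_rmodule_iso quot m n"
proof -
  have P: "\<And>i j. i < n \<Longrightarrow> j < m \<Longrightarrow> P i j \<in> A" "\<And>i j. j < m \<Longrightarrow> i < n \<Longrightarrow> Q j i \<in> A"
    and PQ: "\<And>i i'. i < n \<Longrightarrow> i' < n \<Longrightarrow> (\<Sum>j<m. P i j * Q j i') \<doteq> (if i = i' then u else 0)"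
    and QP: "\<And>j j'. j < m \<Longrightarrow> j' < m \<Longrightarrow> (\<Sum>i<n. Q j i * P i j') \<doteq> (if j = j' then u else 0)"
    using assms by (auto simp: inverse_matrices_def)
  define \<Phi> where "\<Phi> = (\<lambda>x. \<lambda>i\<in>{..<n}. residue_class (\<Sum>j<m. P i j * rep (x j)))"
  define \<Psi> where "\<Psi> = (\<lambda>y. \<lambda>j\<in>{..<m}. residue_class (\<Sum>i<n. Q j i * rep (y i)))"
  have \<Phi>_in: "\<Phi> x \<in> free_rmodule quot n" if "x \<in> free_rmodule quot m" for x
    unfolding \<Phi>_def using free_rmodule_quotE[OF that]
    by (intro free_rmodule_quotI A_sum A_mult P rep_in) auto
  have \<Psi>_in: "\<Psi> y \<in> free_rmodule quot m" if "y \<in> free_rmodule quot n" for y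
    unfolding \<Psi>_def using free_rmodule_quotE[OF that]
    by (intro free_rmodule_quotI A_sum A_mult P rep_in) auto
  have \<Psi>\<Phi>: "\<Psi> (\<Phi> x) = x" if x: "x \<in> free_rmodule quot m" for x
  proof
    fix j
    show "\<Psi> (\<Phi> x) j = x j"
    proof (cases "j < m")
      case True
      have "(\<Sum>i<n. Q j i * rep (\<Phi> x i)) \<doteq> (\<Sum>i<n. Q j i * (\<Sum>j<m. P i j * rep (x j)))"
        unfolding \<Phi>_def using free_rmodule_quotE[OF x] True
        by (auto intro!: eqv_sum eqv_mult_left P rep_residue_class A_sum A_mult rep_in)
      also have "\<dots> \<doteq> rep (x j)"
        using free_rmodule_quotE[OF x] True by (intro matrix_mult_unit P QP) (auto intro: rep_in)
      finally show ?thesis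
        using True free_rmodule_quotE[OF x] residue_class_rep[of "x j"] by (simp add: \<Psi>_def residue_class_eq_iff[symmetric])
    qed (simp add: \<Psi>_def free_rmodule_quotE[OF x])
  qed
  have \<Phi>\<Psi>: "\<Phi> (\<Psi> y) = y" if y: "y \<in> free_rmodule quot n" for y
  proof
    fix i
    show "\<Phi> (\<Psi> y) i = y i"
    proof (cases "i < n")
      case True
      have "(\<Sum>j<m. P i j * rep (\<Psi> y j)) \<doteq> (\<Sum>j<m. P i j * (\<Sum>i<n. Q j i * rep (y i)))"
        unfolding \<Psi>_def using free_rmodule_quotE[OF y] True
        by (auto intro!: eqv_sum eqv_mult_left P rep_residue_class A_sum A_mult rep_in)
      also have "\<dots> \<doteq> rep (y i)"
        using free_rmodule_quotE[OF y] True by (intro matrix_mult_unit P PQ) (auto intro: rep_in)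
      finally show ?thesis
        using True free_rmodule_quotE[OF y] residue_class_rep[of "y i"] by (simp add: \<Phi>_def residue_class_eq_iff[symmetric])
    qed (simp add: \<Phi>_def free_rmodule_quotE[OF y])
  qed
  have bij: "bij_betw \<Phi> (free_rmodule quot m) (free_rmodule quot n)"
    using \<Phi>_in \<Psi>_in \<Phi>\<Psi> \<Psi>\<Phi> by (intro bij_betw_byWitness[where f' = \<Psi>]) auto
  have add: "\<Phi> (\<lambda>i\<in>{..<m}. x i \<oplus>\<^bsub>quot\<^esub> y i) = (\<lambda>i\<in>{..<n}. \<Phi> x i \<oplus>\<^bsub>quot\<^esub> \<Phi> y i)"
    if x: "x \<in> free_rmodule quot m" and y: "y \<in> free_rmodule quot m" for x y
  proof
    fix i
    show "\<Phi> (\<lambda>i\<in>{..<m}. x i \<oplus>\<^bsub>quot\<^esub> y i) i = (\<lambda>i\<in>{..<n}. \<Phi> x i \<oplus>\<^bsub>quot\<^esub> \<Phi> y i) i"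
    proof (cases "i < n")
      case True
      have "rep (x j \<oplus>\<^bsub>quot\<^esub> y j) \<doteq> rep (x j) + rep (y j)" if "j < m" for j
      proof -
        have "x j \<oplus>\<^bsub>quot\<^esub> y j = residue_class (rep (x j) + rep (y j))"
          using that free_rmodule_quotE[OF x] free_rmodule_quotE[OF y]
          by (simp add: add_quot[symmetric] residue_class_rep)
        then show ?thesis
          using that free_rmodule_quotE[OF x] free_rmodule_quotE[OF y]
          by (simp add: rep_residue_class A_add rep_in)
      qed
      then have "(\<Sum>j<m. P i j * rep (x j \<oplus>\<^bsub>quot\<^esub> y j)) \<doteq> (\<Sum>j<m. P i j * (rep (x j) + rep (y j)))"
        using True by (auto intro!: eqv_sum eqv_mult_left P)
      then show ?thesis
        using True by (simp add: \<Phi>_def add_quot residue_class_eq_iff distrib_left sum.distrib)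
    qed (simp add: \<Phi>_def)
  qed
  have smult: "\<Phi> (\<lambda>i\<in>{..<m}. x i \<otimes>\<^bsub>quot\<^esub> a) = (\<lambda>i\<in>{..<n}. \<Phi> x i \<otimes>\<^bsub>quot\<^esub> a)"
    if x: "x \<in> free_rmodule quot m" and a: "a \<in> carrier quot" for x a
  proof
    fix i
    obtain b where b: "b \<in> A" "a = residue_class b"
      using a by (auto simp: carrier_quot)
    show "\<Phi> (\<lambda>i\<in>{..<m}. x i \<otimes>\<^bsub>quot\<^esub> a) i = (\<lambda>i\<in>{..<n}. \<Phi> x i \<otimes>\<^bsub>quot\<^esub> a) i"
    proof (cases "i < n")
      case True
      have "rep (x j \<otimes>\<^bsub>quot\<^esub> a) \<doteq> rep (x j) * b" if "j < m" for j
      proof -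
        have "x j \<otimes>\<^bsub>quot\<^esub> a = residue_class (rep (x j) * b)"
          using that free_rmodule_quotE[OF x] b
          by (simp add: mult_quot[symmetric] residue_class_rep rep_in)
        then show ?thesis
          using that free_rmodule_quotE[OF x] b
          by (simp add: rep_residue_class A_mult rep_in)
      qed
      then have "(\<Sum>j<m. P i j * rep (x j \<otimes>\<^bsub>quot\<^esub> a)) \<doteq> (\<Sum>j<m. P i j * (rep (x j) * b))"
        using True by (auto intro!: eqv_sum eqv_mult_left P)
      moreover have "(\<Sum>j<m. P i j * rep (x j)) \<in> A"
        using True free_rmodule_quotE[OF x] by (auto intro!: A_sum A_mult P rep_in)
      ultimately show ?thesis
        using True b by (simp add: \<Phi>_def mult_quot residue_class_eq_iff sum_distrib_right mult.assoc)
    qed (simp add: \<Phi>_def)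
  qed
  show ?thesis
    unfolding free_rmodule_iso_def
    by (intro exI[of _ \<Phi>] conjI ballI) (rule bij, erule (1) add, erule (1) smult)
qed

text \<open>The columns of the matrix are the images of the standard basis vectors
  \<open>b j\<close>. As additivity is given for two summands, a vector is rebuilt from its
  coordinates one at a time.\<close>

lemma rmodule_hom_quot_matrix:
  assumes \<phi>: "\<And>x. x \<in> free_rmodule quot m \<Longrightarrow> \<phi> x \<in> free_rmodule quot n"
    and add: "\<And>x y. x \<in> free_rmodule quot m \<Longrightarrow> y \<in> free_rmodule quot m \<Longrightarrow>
      \<phi> (\<lambda>i\<in>{..<m}. x i \<oplus>\<^bsub>quot\<^esub> y i) = (\<lambda>i\<in>{..<n}. \<phi> x i \<oplus>\<^bsub>quot\<^esub> \<phi> y i)"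
    and smult: "\<And>x a. x \<in> free_rmodule quot m \<Longrightarrow> a \<in> carrier quot \<Longrightarrow>
      \<phi> (\<lambda>i\<in>{..<m}. x i \<otimes>\<^bsub>quot\<^esub> a) = (\<lambda>i\<in>{..<n}. \<phi> x i \<otimes>\<^bsub>quot\<^esub> a)"
  shows "\<exists>P. (\<forall>i j. i < n \<longrightarrow> j < m \<longrightarrow> P i j \<in> A) \<and>
    (\<forall>a. (\<forall>j. j < m \<longrightarrow> a j \<in> A) \<longrightarrow>
      \<phi> (\<lambda>j\<in>{..<m}. residue_class (a j)) = (\<lambda>i\<in>{..<n}. residue_class (\<Sum>j<m. P i j * a j)))"
proof -
  define b where "b = (\<lambda>j. \<lambda>k\<in>{..<m}. residue_class (if k = j then u else 0))"
  have b_in: "b j \<in> free_rmodule quot m" for j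
    unfolding b_def by (intro free_rmodule_quotI) (auto simp: u_in A_zero)
  define P where "P = (\<lambda>i j. rep (\<phi> (b j) i))"
  have P: "P i j \<in> A" if "i < n" "j < m" for i j
    unfolding P_def using \<phi>[OF b_in] that by (auto intro!: rep_in free_rmodule_quotE)
  have main: "\<phi> (\<lambda>j\<in>{..<m}. residue_class (a j)) = (\<lambda>i\<in>{..<n}. residue_class (\<Sum>j<m. P i j * a j))"
    if a: "\<And>j. j < m \<Longrightarrow> a j \<in> A" for a
  proof -
    \<comment> \<open>The truncation of the vector to its first \<open>k\<close> coordinates;
      \<open>y k\<close> below is the single coordinate that takes \<open>x k\<close> to
      \<open>x (Suc k)\<close>.\<close>
    define x where "x = (\<lambda>k. \<lambda>j\<in>{..<m}. residue_class (if j < k then a j else 0))"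
    have x_in: "x k \<in> free_rmodule quot m" for k
      unfolding x_def using a by (intro free_rmodule_quotI) (auto simp: A_zero)
    define y where "y = (\<lambda>k. \<lambda>j\<in>{..<m}. b k j \<otimes>\<^bsub>quot\<^esub> residue_class (a k))"
    have y_eq: "y k = (\<lambda>j\<in>{..<m}. residue_class (if j = k then a k else 0))" if "k < m" for k
      unfolding y_def b_def using a[OF that]
      by (intro restrict_ext) (auto simp: mult_quot u_in A_zero residue_class_eq_iff eqv_u_left)
    have y_in: "y k \<in> free_rmodule quot m" if "k < m" for k
      unfolding y_eq[OF that] using a[OF that] by (intro free_rmodule_quotI) (auto simp: A_zero)
    have "k \<le> m \<longrightarrow> \<phi> (x k) = (\<lambda>i\<in>{..<n}. residue_class (\<Sum>j<k. P i j * a j))" for k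
    proof (induction k)
      case 0
      \<comment> \<open>That zero goes to zero follows from compatibility with the scalar zero, the
        zero vector being its own multiple by it.\<close>
      have "\<phi> (\<lambda>i\<in>{..<m}. x 0 i \<otimes>\<^bsub>quot\<^esub> residue_class 0) = (\<lambda>i\<in>{..<n}. \<phi> (x 0) i \<otimes>\<^bsub>quot\<^esub> residue_class 0)"
        using x_in A_zero by (intro smult) (auto simp: residue_class_in_quot)
      also have "(\<lambda>i\<in>{..<m}. x 0 i \<otimes>\<^bsub>quot\<^esub> residue_class 0) = x 0"
        unfolding x_def by (intro restrict_ext) (auto simp: mult_quot A_zero)
      also have "(\<lambda>i\<in>{..<n}. \<phi> (x 0) i \<otimes>\<^bsub>quot\<^esub> residue_class 0) = (\<lambda>i\<in>{..<n}. residue_class 0)"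
      proof (intro restrict_ext)
        fix i assume "i \<in> {..<n}"
        then obtain c where "c \<in> A" "\<phi> (x 0) i = residue_class c"
          using free_rmodule_quotE(1)[OF \<phi>[OF x_in[of 0]], of i] by (auto simp: carrier_quot)
        then show "\<phi> (x 0) i \<otimes>\<^bsub>quot\<^esub> residue_class 0 = residue_class 0"
          by (simp add: mult_quot A_zero)
      qed
      finally show ?case
        by simp
    next
      case (Suc k)
      show ?case
      proof
        assume k: "Suc k \<le> m"
        have "x (Suc k) = (\<lambda>j\<in>{..<m}. x k j \<oplus>\<^bsub>quot\<^esub> y k j)"
          using k unfolding x_def y_eq[OF Suc_le_lessD[OF k]]
          by (intro restrict_ext) (auto simp: add_quot less_Suc_eq)
        then have "\<phi> (x (Suc k)) = (\<lambda>i\<in>{..<n}. \<phi> (x k) i \<oplus>\<^bsub>quot\<^esub> \<phi> (y k) i)"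
          using add[OF x_in y_in] k by simp
        also have "\<dots> = (\<lambda>i\<in>{..<n}. residue_class (\<Sum>j<Suc k. P i j * a j))"
        proof (intro restrict_ext)
          fix i assume i: "i \<in> {..<n}"
          have "\<phi> (y k) i = \<phi> (b k) i \<otimes>\<^bsub>quot\<^esub> residue_class (a k)"
            unfolding y_def using i k a by (subst smult) (auto simp: b_in residue_class_in_quot)
          also have "\<dots> = residue_class (P i k) \<otimes>\<^bsub>quot\<^esub> residue_class (a k)"
            using i free_rmodule_quotE(1)[OF \<phi>[OF b_in]] by (simp add: P_def residue_class_rep)
          also have "\<dots> = residue_class (P i k * a k)"
            using P a i k by (intro mult_quot) auto
          finally show "\<phi> (x k) i \<oplus>\<^bsub>quot\<^esub> \<phi> (y k) i = residue_class (\<Sum>j<Suc k. P i j * a j)"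
            using Suc k i by (simp add: add_quot)
        qed
        finally show "\<phi> (x (Suc k)) = \<dots>" .
      qed
    qed
    from this[of m] show ?thesis
      by (simp add: x_def cong: restrict_cong)
  qed
  show ?thesis
    using P main by (intro exI[of _ P] conjI) simp_all
qed

text \<open>The inverse of a bijective homomorphism is again a homomorphism, so both directions have
  matrices; composing the maps on basis vectors gives the two product identities.\<close>

lemma free_rmodule_iso_quotE:
  assumes "free_rmodule_iso quot m n"
  obtains P Q where "inverse_matrices {..<n} (\<lambda>_. u) {..<m} (\<lambda>_. u) P Q"
proof -
  obtain \<phi> where bij: "bij_betw \<phi> (free_rmodule quot m) (free_rmodule quot n)"
    and add_all: "\<forall>x \<in> free_rmodule quot m. \<forall>y \<in> free_rmodule quot m.
      \<phi> (\<lambda>i\<in>{..<m}. x i \<oplus>\<^bsub>quot\<^esub> y i) = (\<lambda>i\<in>{..<n}. \<phi> x i \<oplus>\<^bsub>quot\<^esub> \<phi> y i)"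
    and smult_all: "\<forall>x \<in> free_rmodule quot m. \<forall>a \<in> carrier quot.
      \<phi> (\<lambda>i\<in>{..<m}. x i \<otimes>\<^bsub>quot\<^esub> a) = (\<lambda>i\<in>{..<n}. \<phi> x i \<otimes>\<^bsub>quot\<^esub> a)"
    using assms unfolding free_rmodule_iso_def by (elim exE conjE)
  note add = add_all[THEN bspec, THEN bspec] and smult = smult_all[THEN bspec, THEN bspec]
  define \<psi> where "\<psi> = inv_into (free_rmodule quot m) \<phi>"
  have \<phi>_in: "\<phi> x \<in> free_rmodule quot n" if "x \<in> free_rmodule quot m" for x
    using bij that by (auto simp: bij_betw_def)
  have \<psi>_in: "\<psi> y \<in> free_rmodule quot m" if "y \<in> free_rmodule quot n" for y
    using bij that unfolding \<psi>_def bij_betw_def by (simp add: inv_into_into)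
  have \<phi>\<psi>: "\<phi> (\<psi> y) = y" if "y \<in> free_rmodule quot n" for y
    using bij that unfolding \<psi>_def by (simp add: bij_betw_inv_into_right)
  have \<psi>\<phi>: "\<psi> (\<phi> x) = x" if "x \<in> free_rmodule quot m" for x
    using bij that unfolding \<psi>_def by (simp add: bij_betw_inv_into_left)
  have add_in: "(\<lambda>i\<in>{..<k}. x i \<oplus>\<^bsub>quot\<^esub> y i) \<in> free_rmodule quot k"
    if "x \<in> free_rmodule quot k" "y \<in> free_rmodule quot k" for x y k
    using free_rmodule_quotE(1)[OF that(1)] free_rmodule_quotE(1)[OF that(2)]
    by (fastforce simp: free_rmodule_def carrier_quot add_quot intro: A_add)
  have smult_in: "(\<lambda>i\<in>{..<k}. x i \<otimes>\<^bsub>quot\<^esub> a) \<in> free_rmodule quot k"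
    if "x \<in> free_rmodule quot k" "a \<in> carrier quot" for x a k
    using free_rmodule_quotE(1)[OF that(1)] that(2)
    by (fastforce simp: free_rmodule_def carrier_quot mult_quot intro: A_mult)
  have add': "\<psi> (\<lambda>i\<in>{..<n}. x i \<oplus>\<^bsub>quot\<^esub> y i) = (\<lambda>i\<in>{..<m}. \<psi> x i \<oplus>\<^bsub>quot\<^esub> \<psi> y i)"
    if "x \<in> free_rmodule quot n" "y \<in> free_rmodule quot n" for x y
    using add[OF \<psi>_in \<psi>_in, OF that] \<psi>\<phi>[OF add_in[OF \<psi>_in \<psi>_in, OF that]] that by (simp add: \<phi>\<psi> cong: restrict_cong)
  have smult': "\<psi> (\<lambda>i\<in>{..<n}. x i \<otimes>\<^bsub>quot\<^esub> a) = (\<lambda>i\<in>{..<m}. \<psi> x i \<otimes>\<^bsub>quot\<^esub> a)"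
    if "x \<in> free_rmodule quot n" "a \<in> carrier quot" for x a
    using smult[OF \<psi>_in, OF that] \<psi>\<phi>[OF smult_in[OF \<psi>_in, OF that]] that by (simp add: \<phi>\<psi> cong: restrict_cong)
  have "\<exists>P. (\<forall>i j. i < n \<longrightarrow> j < m \<longrightarrow> P i j \<in> A) \<and>
    (\<forall>a. (\<forall>j. j < m \<longrightarrow> a j \<in> A) \<longrightarrow>
      \<phi> (\<lambda>j\<in>{..<m}. residue_class (a j)) = (\<lambda>i\<in>{..<n}. residue_class (\<Sum>j<m. P i j * a j)))"
    by (rule rmodule_hom_quot_matrix[OF \<phi>_in add smult])
  then obtain P where P_all: "\<forall>i j. i < n \<longrightarrow> j < m \<longrightarrow> P i j \<in> A"
    "\<forall>a. (\<forall>j. j < m \<longrightarrow> a j \<in> A) \<longrightarrow>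
      \<phi> (\<lambda>j\<in>{..<m}. residue_class (a j)) = (\<lambda>i\<in>{..<n}. residue_class (\<Sum>j<m. P i j * a j))"
    by (elim exE conjE)
  note P = P_all[rule_format]
  have "\<exists>P. (\<forall>i j. i < m \<longrightarrow> j < n \<longrightarrow> P i j \<in> A) \<and>
    (\<forall>a. (\<forall>j. j < n \<longrightarrow> a j \<in> A) \<longrightarrow>
      \<psi> (\<lambda>j\<in>{..<n}. residue_class (a j)) = (\<lambda>i\<in>{..<m}. residue_class (\<Sum>j<n. P i j * a j)))"
    by (rule rmodule_hom_quot_matrix[OF \<psi>_in add' smult'])
  then obtain Q where Q_all: "\<forall>i j. i < m \<longrightarrow> j < n \<longrightarrow> Q i j \<in> A"
    "\<forall>a. (\<forall>j. j < n \<longrightarrow> a j \<in> A) \<longrightarrow>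
      \<psi> (\<lambda>j\<in>{..<n}. residue_class (a j)) = (\<lambda>i\<in>{..<m}. residue_class (\<Sum>j<n. Q i j * a j))"
    by (elim exE conjE)
  note Q = Q_all[rule_format]
  have unit: "(\<Sum>j<k. X i j * Y j i') \<doteq> (if i = i' then u else 0)"
    if X: "\<And>i j. i < l \<Longrightarrow> j < k \<Longrightarrow> X i j \<in> A" and Y: "\<And>i j. i < k \<Longrightarrow> j < l \<Longrightarrow> Y i j \<in> A"
      and X': "\<And>a. (\<And>j. j < k \<Longrightarrow> a j \<in> A) \<Longrightarrow>
        f (\<lambda>j\<in>{..<k}. residue_class (a j)) = (\<lambda>i\<in>{..<l}. residue_class (\<Sum>j<k. X i j * a j))"
      and Y': "\<And>a. (\<And>j. j < l \<Longrightarrow> a j \<in> A) \<Longrightarrow>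
        g (\<lambda>j\<in>{..<l}. residue_class (a j)) = (\<lambda>i\<in>{..<k}. residue_class (\<Sum>j<l. Y i j * a j))"
      and fg: "\<And>x. x \<in> free_rmodule quot l \<Longrightarrow> f (g x) = x" and i: "i < l" "i' < l"
    for X Y f g k l i i'
  proof -
    \<comment> \<open>The \<open>i'\<close>-th standard basis vector. Applying \<open>Y\<close> to
      it yields column \<open>i'\<close> of \<open>Y\<close> times \<open>u\<close>, and the
      trailing \<open>u\<close> is removed modulo \<open>I\<close> at the end.\<close>
    define a where "a = (\<lambda>j. if j = i' then u else 0)"
    have a: "a j \<in> A" for j
      by (simp add: a_def u_in A_zero)
    have sum_a: "(\<Sum>j<l. Y j' j * a j) = Y j' i' * u" for j'
      using i by (simp add: a_def if_distrib cong: if_cong)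
    have fg_a: "f (g (\<lambda>j\<in>{..<l}. residue_class (a j))) = (\<lambda>j\<in>{..<l}. residue_class (a j))"
      using a by (intro fg free_rmodule_quotI)
    have fg_X: "f (g (\<lambda>j\<in>{..<l}. residue_class (a j))) = (\<lambda>i\<in>{..<l}. residue_class (\<Sum>j<k. X i j * (Y j i' * u)))"
    proof -
      have "g (\<lambda>j\<in>{..<l}. residue_class (a j)) = (\<lambda>j\<in>{..<k}. residue_class (\<Sum>i<l. Y j i * a i))"
        by (rule Y') (rule a)
      moreover have "f (\<lambda>j\<in>{..<k}. residue_class (Y j i' * u))
          = (\<lambda>i\<in>{..<l}. residue_class (\<Sum>j<k. X i j * (Y j i' * u)))"
        by (rule X') (simp add: A_mult u_in Y i)
      ultimately show ?thesis
        by (simp only: sum_a)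
    qed
    have "residue_class (\<Sum>j<k. X i j * (Y j i' * u)) = residue_class (a i)"
      using fun_cong[OF trans[OF fg_X[symmetric] fg_a], of i] i by simp
    then have Xu: "(\<Sum>j<k. X i j * (Y j i' * u)) \<doteq> a i"
      by (simp add: residue_class_eq_iff)
    have "(\<Sum>j<k. X i j * Y j i') \<doteq> (\<Sum>j<k. X i j * (Y j i' * u))"
      using i X Y by (auto intro!: eqv_sum eqv_mult_left eqv_sym[OF eqv_u_right])
    from eqv_trans[OF this Xu] show ?thesis
      by (simp add: a_def)
  qed
  have "inverse_matrices {..<n} (\<lambda>_. u) {..<m} (\<lambda>_. u) P Q"
    unfolding inverse_matrices_def
    by (intro conjI ballI P(1) Q(1) unit[OF P(1) Q(1) P(2) Q(2) \<phi>\<psi>] unit[OF Q(1) P(1) Q(2) P(2) \<psi>\<phi>])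
      (simp_all only: lessThan_iff)
  then show ?thesis
    using that by blast
qed

end

section \<open>Equivalence of families of idempotents\<close>

context ideal_quotient
begin

text \<open>For idempotents modulo \<open>I\<close> this expresses that the direct sums of the right
  ideals generated by the \<open>e i\<close> and by the \<open>f j\<close> are isomorphic; these
  modules are never built. The entries range over all of \<open>A\<close> instead of the corners
  between \<open>e i\<close> and \<open>f j\<close>, and \<open>inverse_matrices_idem_inside\<close>
  makes up for that when equivalences are composed.\<close>

definition fam_equiv :: "'i set \<Rightarrow> ('i \<Rightarrow> 'r) \<Rightarrow> 'j set \<Rightarrow> ('j \<Rightarrow> 'r) \<Rightarrow> bool" where
  "fam_equiv S e T f \<longleftrightarrow> (\<exists>P Q. inverse_matrices S e T f P Q)"

definition idem_on :: "'i set \<Rightarrow> ('i \<Rightarrow> 'r) \<Rightarrow> bool" where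
  "idem_on S e \<longleftrightarrow> finite S \<and> (\<forall>i\<in>S. e i \<in> A \<and> e i * e i \<doteq> e i)"

lemma inverse_matricesD:
  assumes "inverse_matrices S e T f P Q"
  shows "i \<in> S \<Longrightarrow> j \<in> T \<Longrightarrow> P i j \<in> A" "j \<in> T \<Longrightarrow> i \<in> S \<Longrightarrow> Q j i \<in> A"
    "i \<in> S \<Longrightarrow> i' \<in> S \<Longrightarrow> (\<Sum>j\<in>T. P i j * Q j i') \<doteq> (if i = i' then e i else 0)"
    "j \<in> T \<Longrightarrow> j' \<in> T \<Longrightarrow> (\<Sum>i\<in>S. Q j i * P i j') \<doteq> (if j = j' then f j else 0)"
  using assms unfolding inverse_matrices_def by blast+

lemma inverse_matrices_sym: "inverse_matrices S e T f P Q \<Longrightarrow> inverse_matrices T f S e Q P"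
  unfolding inverse_matrices_def by blast

lemma fam_equiv_sym: "fam_equiv S e T f \<Longrightarrow> fam_equiv T f S e"
  unfolding fam_equiv_def using inverse_matrices_sym by blast

lemma idem_onD:
  assumes "idem_on S e"
  shows "finite S" "i \<in> S \<Longrightarrow> e i \<in> A" "i \<in> S \<Longrightarrow> e i * e i \<doteq> e i"
  using assms by (auto simp: idem_on_def)

text \<open>A permutation matrix along \<open>h\<close>, with \<open>e i\<close> in place of the
  entry one, serves in both directions because \<open>e i\<close> squares to itself.\<close>

lemma fam_equiv_reindex:
  assumes h: "bij_betw h S T" and e: "\<And>i. i \<in> S \<Longrightarrow> f (h i) = e i" and idem: "idem_on S e"
  shows "fam_equiv S e T f"
proof -
  have hT: "h ` S = T" and inj: "inj_on h S"
    using h by (auto simp: bij_betw_def)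
  have fin: "finite S" "finite T"
    using idem_onD(1)[OF idem] hT by auto
  have "inverse_matrices S e T f (\<lambda>i j. if h i = j then e i else 0) (\<lambda>j i. if h i = j then e i else 0)"
    unfolding inverse_matrices_def
  proof (intro conjI ballI)
    fix i i' assume i: "i \<in> S" "i' \<in> S"
    have "(\<Sum>j\<in>T. (if h i = j then e i else 0) * (if h i' = j then e i' else 0))
        = (if i = i' then e i * e i else 0)"
      using i fin hT inj by (auto simp: if_distrib[of "\<lambda>x. x * _"] inj_on_eq_iff cong: if_cong)
    then show "(\<Sum>j\<in>T. (if h i = j then e i else 0) * (if h i' = j then e i' else 0))
        \<doteq> (if i = i' then e i else 0)"
      using idem_onD(3)[OF idem] i by simp
  next
    fix j j' assume j: "j \<in> T" "j' \<in> T"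
    then obtain k where k: "k \<in> S" "j = h k"
      using hT by auto
    have "(\<Sum>i\<in>S. (if h i = j then e i else 0) * (if h i = j' then e i else 0))
        = (\<Sum>i\<in>S. if i = k then (if j = j' then e k * e k else 0) else 0)"
      using k inj by (intro sum.cong) (auto simp: inj_on_eq_iff)
    also have "\<dots> = (if j = j' then e k * e k else 0)"
      using fin k by simp
    finally show "(\<Sum>i\<in>S. (if h i = j then e i else 0) * (if h i = j' then e i else 0))
        \<doteq> (if j = j' then f j else 0)"
      using idem_onD(3)[OF idem k(1)] k e[OF k(1)] by auto
  qed (use idem_onD(2)[OF idem] in \<open>auto simp: A_zero\<close>)
  then show ?thesis
    unfolding fam_equiv_def by blast
qed

text \<open>Associativity of a fourfold matrix product, grouped so that the inner product can then
  be replaced by a diagonal matrix.\<close>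

lemma sum_sandwich:
  fixes P :: "'i \<Rightarrow> 'j \<Rightarrow> 'r"
  shows "(\<Sum>k\<in>W. (\<Sum>j\<in>T. P i j * P' j k) * (\<Sum>j\<in>T'. Q' k j * Q j i'))
    = (\<Sum>j\<in>T. \<Sum>j'\<in>T'. P i j * (\<Sum>k\<in>W. P' j k * Q' k j') * Q j' i')"
proof -
  have "(\<Sum>k\<in>W. (\<Sum>j\<in>T. P i j * P' j k) * (\<Sum>j\<in>T'. Q' k j * Q j i'))
      = (\<Sum>k\<in>W. \<Sum>j\<in>T. \<Sum>j'\<in>T'. P i j * P' j k * (Q' k j' * Q j' i'))"
    by (simp add: sum_product)
  also have "\<dots> = (\<Sum>j\<in>T. \<Sum>k\<in>W. \<Sum>j'\<in>T'. P i j * P' j k * (Q' k j' * Q j' i'))"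
    by (rule sum.swap)
  also have "\<dots> = (\<Sum>j\<in>T. \<Sum>j'\<in>T'. \<Sum>k\<in>W. P i j * P' j k * (Q' k j' * Q j' i'))"
    by (intro sum.cong refl sum.swap)
  finally show ?thesis
    by (simp add: sum_distrib_left sum_distrib_right mult.assoc)
qed

lemma sum_sandwich_delta:
  assumes "finite T"
    and P: "\<And>j. j \<in> T \<Longrightarrow> P i j \<in> A" and Q: "\<And>j. j \<in> T \<Longrightarrow> Q j i' \<in> A"
    and M: "\<And>j j'. j \<in> T \<Longrightarrow> j' \<in> T \<Longrightarrow> M j j' \<doteq> (if j = j' then f j else 0)"
  shows "(\<Sum>j\<in>T. \<Sum>j'\<in>T. P i j * M j j' * Q j' i') \<doteq> (\<Sum>j\<in>T. P i j * f j * Q j i')"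
proof -
  have "(\<Sum>j\<in>T. \<Sum>j'\<in>T. P i j * M j j' * Q j' i')
      \<doteq> (\<Sum>j\<in>T. \<Sum>j'\<in>T. P i j * (if j = j' then f j else 0) * Q j' i')"
    by (intro eqv_sum eqv_mult_right eqv_mult_left P Q M)
  also have "\<dots> = (\<Sum>j\<in>T. P i j * f j * Q j i')"
    using assms(1) by (simp add: if_distrib[of "\<lambda>x. x * _"] if_distrib[of "\<lambda>x. _ * x"] cong: if_cong)
  finally show ?thesis .
qed

text \<open>With \<open>D\<close> for the diagonal matrix of \<open>f\<close>:
  \<open>P D Q = P (Q P) Q = (P Q) (P Q)\<close> modulo \<open>I\<close>, the square of the diagonal
  matrix of \<open>e\<close>, which is that matrix again. Hence the middle family of a composition
  disappears.\<close>

lemma inverse_matrices_idem_inside: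
  assumes inv: "inverse_matrices S e T f P Q" and e: "idem_on S e" and T: "finite T"
    and i: "i \<in> S" "i' \<in> S"
  shows "(\<Sum>j\<in>T. P i j * f j * Q j i') \<doteq> (if i = i' then e i else 0)"
proof -
  note D = inverse_matricesD[OF inv]
  have "(\<Sum>j\<in>T. P i j * f j * Q j i') \<doteq> (\<Sum>j\<in>T. \<Sum>j'\<in>T. P i j * (\<Sum>k\<in>S. Q j k * P k j') * Q j' i')"
    using T i by (intro eqv_sym[OF sum_sandwich_delta] D)
  also have "\<dots> = (\<Sum>k\<in>S. (\<Sum>j\<in>T. P i j * Q j k) * (\<Sum>j\<in>T. P k j * Q j i'))"
    by (rule sum_sandwich[symmetric])
  also have "\<dots> \<doteq> (\<Sum>k\<in>S. (if i = k then e i else 0) * (if k = i' then e k else 0))"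
    using i idem_onD[OF e] by (intro eqv_sum eqv_mult D) (auto intro!: A_sum A_mult D simp: A_zero)
  also have "\<dots> = (if i = i' then e i * e i else 0)"
    using i idem_onD(1)[OF e] by (simp add: if_distrib[of "\<lambda>x. x * _"] cong: if_cong)
  also have "\<dots> \<doteq> (if i = i' then e i else 0)"
    using i idem_onD(3)[OF e] by simp
  finally show ?thesis .
qed

lemma fam_equiv_trans:
  assumes "fam_equiv S e T f" "fam_equiv T f W g" "idem_on S e" "finite T" "idem_on W g"
  shows "fam_equiv S e W g"
proof -
  obtain P Q P' Q' where inv: "inverse_matrices S e T f P Q" and inv': "inverse_matrices T f W g P' Q'"
    using assms unfolding fam_equiv_def by blast
  note D = inverse_matricesD[OF inv] and D' = inverse_matricesD[OF inv']
  have "inverse_matrices S e W g (\<lambda>i k. \<Sum>j\<in>T. P i j * P' j k) (\<lambda>k i. \<Sum>j\<in>T. Q' k j * Q j i)"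
    unfolding inverse_matrices_def
  proof (intro conjI ballI)
    fix i i' assume i: "i \<in> S" "i' \<in> S"
    have "(\<Sum>k\<in>W. (\<Sum>j\<in>T. P i j * P' j k) * (\<Sum>j\<in>T. Q' k j * Q j i'))
        = (\<Sum>j\<in>T. \<Sum>j'\<in>T. P i j * (\<Sum>k\<in>W. P' j k * Q' k j') * Q j' i')"
      by (rule sum_sandwich)
    also have "\<dots> \<doteq> (\<Sum>j\<in>T. P i j * f j * Q j i')"
      using assms i by (intro sum_sandwich_delta D D')
    also have "\<dots> \<doteq> (if i = i' then e i else 0)"
      using assms i by (intro inverse_matrices_idem_inside[OF inv])
    finally show "(\<Sum>k\<in>W. (\<Sum>j\<in>T. P i j * P' j k) * (\<Sum>j\<in>T. Q' k j * Q j i'))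
        \<doteq> (if i = i' then e i else 0)" .
  next
    fix k k' assume k: "k \<in> W" "k' \<in> W"
    have "(\<Sum>i\<in>S. (\<Sum>j\<in>T. Q' k j * Q j i) * (\<Sum>j\<in>T. P i j * P' j k'))
        = (\<Sum>j\<in>T. \<Sum>j'\<in>T. Q' k j * (\<Sum>i\<in>S. Q j i * P i j') * P' j' k')"
      by (rule sum_sandwich)
    also have "\<dots> \<doteq> (\<Sum>j\<in>T. Q' k j * f j * P' j k')"
      using assms k by (intro sum_sandwich_delta D D')
    also have "\<dots> \<doteq> (if k = k' then g k else 0)"
      using assms k by (intro inverse_matrices_idem_inside[OF inverse_matrices_sym[OF inv']])
    finally show "(\<Sum>i\<in>S. (\<Sum>j\<in>T. Q' k j * Q j i) * (\<Sum>j\<in>T. P i j * P' j k'))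
        \<doteq> (if k = k' then g k else 0)" .
  qed (auto intro!: A_sum A_mult D D')
  then show ?thesis
    unfolding fam_equiv_def by blast
qed

text \<open>Block-diagonal matrices; disjointness of the index sets decides which block an index
  belongs to.\<close>

lemma fam_equiv_union:
  assumes "fam_equiv S e T f" "fam_equiv S' e T' f" "S \<inter> S' = {}" "T \<inter> T' = {}"
    "finite S" "finite S'" "finite T" "finite T'"
  shows "fam_equiv (S \<union> S') e (T \<union> T') f"
proof -
  obtain P Q P' Q' where inv: "inverse_matrices S e T f P Q" and inv': "inverse_matrices S' e T' f P' Q'"
    using assms unfolding fam_equiv_def by blast
  note D = inverse_matricesD[OF inv] and D' = inverse_matricesD[OF inv']
  define R where "R = (\<lambda>i j. if i \<in> S \<and> j \<in> T then P i j else if i \<in> S' \<and> j \<in> T' then P' i j else 0)"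
  define R' where "R' = (\<lambda>j i. if i \<in> S \<and> j \<in> T then Q j i else if i \<in> S' \<and> j \<in> T' then Q' j i else 0)"
  have R: "R i j = P i j" "R' j i = Q j i" if "i \<in> S" "j \<in> T" for i j
    using that by (auto simp: R_def R'_def)
  have R2: "R i j = P' i j" "R' j i = Q' j i" if "i \<in> S'" "j \<in> T'" for i j
    using that assms by (auto simp: R_def R'_def)
  have R0: "R i j = 0" "R' j i = 0" if "i \<in> S" "j \<in> T'" for i j
    using that assms by (auto simp: R_def R'_def)
  have R02: "R i j = 0" "R' j i = 0" if "i \<in> S'" "j \<in> T" for i j
    using that assms by (auto simp: R_def R'_def)
  have "inverse_matrices (S \<union> S') e (T \<union> T') f R R'"
    unfolding inverse_matrices_def
  proof (intro conjI ballI)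
    fix i i' assume i: "i \<in> S \<union> S'" "i' \<in> S \<union> S'"
    have "(\<Sum>j\<in>T \<union> T'. R i j * R' j i') = (\<Sum>j\<in>T. R i j * R' j i') + (\<Sum>j\<in>T'. R i j * R' j i')"
      using assms by (intro sum.union_disjoint)
    also have "\<dots> \<doteq> (if i = i' then e i else 0)"
      using i D(3)[of i i'] D'(3)[of i i'] assms(3) by (auto simp: R R2 R0 R02 cong: sum.cong)
    finally show "(\<Sum>j\<in>T \<union> T'. R i j * R' j i') \<doteq> (if i = i' then e i else 0)" .
  next
    fix j j' assume j: "j \<in> T \<union> T'" "j' \<in> T \<union> T'"
    have "(\<Sum>i\<in>S \<union> S'. R' j i * R i j') = (\<Sum>i\<in>S. R' j i * R i j') + (\<Sum>i\<in>S'. R' j i * R i j')"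
      using assms by (intro sum.union_disjoint)
    also have "\<dots> \<doteq> (if j = j' then f j else 0)"
      using j D(4)[of j j'] D'(4)[of j j'] assms(4) by (auto simp: R R2 R0 R02 cong: sum.cong)
    finally show "(\<Sum>i\<in>S \<union> S'. R' j i * R i j') \<doteq> (if j = j' then f j else 0)" .
  qed (auto simp: R_def R'_def A_zero intro: D D')
  then show ?thesis
    unfolding fam_equiv_def by blast
qed

end

section \<open>Direct sums of vertex modules, recorded by multiplicities\<close>

locale orthogonal_quotient = ideal_quotient A I u
  for A I :: "'r::ring_1 set" and u +
  fixes V :: "'v set" and vtx :: "'v \<Rightarrow> 'r"
  assumes fin_V: "finite V"
    and vtx_in: "w \<in> V \<Longrightarrow> vtx w \<in> A"
    and vtx_mult: "w \<in> V \<Longrightarrow> w' \<in> V \<Longrightarrow> vtx w * vtx w' \<doteq> (if w = w' then vtx w else 0)"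
    and u_eq: "u = (\<Sum>w\<in>V. vtx w)"
begin

text \<open>Index set of the module with \<open>c w\<close> copies of the right ideal of the vertex
  \<open>w\<close>; \<open>c\<close> plays the role of an element of the free commutative monoid on
  the vertices.\<close>

definition copies :: "('v \<Rightarrow> nat) \<Rightarrow> ('v \<times> nat) set" where
  "copies c = Sigma V (\<lambda>w. {..<c w})"

abbreviation vfam :: "'v \<times> nat \<Rightarrow> 'r" where
  "vfam x \<equiv> vtx (fst x)"

text \<open>Isomorphism of two such direct sums, a congruence on multiplicity functions. Once it is
  known to be an equivalence compatible with addition, module isomorphisms become a calculus with
  natural numbers.\<close>

definition mult_equiv :: "('v \<Rightarrow> nat) \<Rightarrow> ('v \<Rightarrow> nat) \<Rightarrow> bool" where
  "mult_equiv c d \<longleftrightarrow> fam_equiv (copies c) vfam (copies d) vfam"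

lemma finite_copies: "finite (copies c)"
  by (simp add: copies_def fin_V)

lemma idem_vtx: "w \<in> V \<Longrightarrow> vtx w * vtx w \<doteq> vtx w"
  using vtx_mult[of w w] by simp

lemma idem_on_copies: "idem_on (copies c) vfam"
  using fin_V by (auto simp: idem_on_def copies_def vtx_in idem_vtx)

lemma mult_equiv_cong: "(\<And>w. w \<in> V \<Longrightarrow> c w = d w) \<Longrightarrow> mult_equiv c d"
proof -
  assume "\<And>w. w \<in> V \<Longrightarrow> c w = d w"
  then have "copies c = copies d"
    by (auto simp: copies_def)
  then show ?thesis
    unfolding mult_equiv_def by (intro fam_equiv_reindex[of id] idem_on_copies) auto
qed

lemma mult_equiv_sym: "mult_equiv c d \<Longrightarrow> mult_equiv d c"
  unfolding mult_equiv_def by (rule fam_equiv_sym)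

lemma mult_equiv_trans [trans]: "mult_equiv c d \<Longrightarrow> mult_equiv d b \<Longrightarrow> mult_equiv c b"
  unfolding mult_equiv_def by (rule fam_equiv_trans) (auto intro: idem_on_copies finite_copies)

text \<open>Renumbers copies so that those for \<open>c'\<close> start where those for
  \<open>c\<close> end; a sum of multiplicities thereby becomes a disjoint union of index
  sets.\<close>

definition shift :: "('v \<Rightarrow> nat) \<Rightarrow> 'v \<times> nat \<Rightarrow> 'v \<times> nat" where
  "shift c = (\<lambda>(w, i). (w, c w + i))"

lemma copies_add: "copies (\<lambda>w. c w + c' w) = copies c \<union> shift c ` copies c'"
proof -
  have "(w, i) \<in> shift c ` copies c'" if "w \<in> V" "\<not> i < c w" "i < c w + c' w" for w i
  proof (rule image_eqI[of _ _ "(w, i - c w)"])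
    show "(w, i) = shift c (w, i - c w)"
      using that by (simp add: shift_def)
    show "(w, i - c w) \<in> copies c'"
      using that by (auto simp: copies_def)
  qed
  then show ?thesis
    by (auto simp: copies_def shift_def)
qed

lemma copies_shift_disjoint: "copies c \<inter> shift c ` copies c' = {}"
  by (auto simp: copies_def shift_def)

lemma fam_equiv_shift: "fam_equiv (copies c') vfam (shift c ` copies c') vfam"
  by (rule fam_equiv_reindex[of "shift c"])
    (auto simp: idem_on_copies shift_def bij_betw_def inj_on_def)

lemma idem_on_shift: "idem_on (shift c ` copies c') vfam"
  using fin_V by (auto simp: idem_on_def copies_def shift_def vtx_in idem_vtx)

lemma mult_equiv_add:
  assumes "mult_equiv c d" "mult_equiv c' d'"
  shows "mult_equiv (\<lambda>w. c w + c' w) (\<lambda>w. d w + d' w)"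
proof -
  have "fam_equiv (shift c ` copies c') vfam (copies d') vfam"
    using fam_equiv_sym[OF fam_equiv_shift] assms(2)[unfolded mult_equiv_def] idem_on_shift
      finite_copies idem_on_copies by (rule fam_equiv_trans)
  then have "fam_equiv (shift c ` copies c') vfam (shift d ` copies d') vfam"
    using fam_equiv_shift idem_on_shift finite_copies idem_on_shift by (rule fam_equiv_trans)
  then show ?thesis
    using assms(1) copies_shift_disjoint unfolding mult_equiv_def copies_add
    by (intro fam_equiv_union) (auto intro: finite_copies)
qed

lemma mult_equiv_refl: "mult_equiv c c"
  by (rule mult_equiv_cong) simp

lemma mult_equiv_times: "mult_equiv c d \<Longrightarrow> mult_equiv (\<lambda>w. n * c w) (\<lambda>w. n * d w)"
  by (induction n) (auto simp: mult_equiv_refl dest: mult_equiv_add)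

lemma mult_equiv_sum:
  "(\<And>x. x \<in> X \<Longrightarrow> mult_equiv (c x) (d x)) \<Longrightarrow> mult_equiv (\<lambda>w. \<Sum>x\<in>X. c x w) (\<lambda>w. \<Sum>x\<in>X. d x w)"
  by (induction X rule: infinite_finite_induct) (auto simp: mult_equiv_refl mult_equiv_add)

text \<open>The identity is the sum of the orthogonal vertex idempotents: the row and the column
  with entries \<open>vtx w\<close> multiply to \<open>u\<close> in one order and to the diagonal of
  the \<open>vtx w\<close> in the other. The second component of an index tells which of the
  \<open>n\<close> summands it serves.\<close>

lemma fam_equiv_free: "fam_equiv {..<n} (\<lambda>_. u) (copies (\<lambda>_. n)) vfam"
proof -
  have "inverse_matrices {..<n} (\<lambda>_. u) (copies (\<lambda>_. n)) vfam
    (\<lambda>i x. if i = snd x then vfam x else 0) (\<lambda>x i. if i = snd x then vfam x else 0)"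
    unfolding inverse_matrices_def
  proof (intro conjI ballI)
    fix i i' assume i: "i \<in> {..<n}" "i' \<in> {..<n}"
    have "(\<Sum>x\<in>copies (\<lambda>_. n). (if i = snd x then vfam x else 0) * (if i' = snd x then vfam x else 0))
        = (\<Sum>w\<in>V. \<Sum>j<n. (if i = j then vtx w else 0) * (if i' = j then vtx w else 0))"
      unfolding copies_def using fin_V by (subst sum.Sigma) (auto intro: sum.cong)
    also have "\<dots> = (if i = i' then \<Sum>w\<in>V. vtx w * vtx w else 0)"
      using i by (auto simp: if_distrib[of "\<lambda>x. x * _"] cong: if_cong)
    also have "\<dots> \<doteq> (if i = i' then u else 0)"
      by (auto simp: u_eq idem_vtx intro!: eqv_sum)
    finally show "(\<Sum>x\<in>copies (\<lambda>_. n). (if i = snd x then vfam x else 0) * (if i' = snd x then vfam x else 0))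
        \<doteq> (if i = i' then u else 0)" .
  next
    fix x y assume "x \<in> copies (\<lambda>_. n)" "y \<in> copies (\<lambda>_. n)"
    then show "(\<Sum>i<n. (if i = snd x then vfam x else 0) * (if i = snd y then vfam y else 0))
        \<doteq> (if x = y then vfam x else 0)"
      using vtx_mult[of "fst x" "fst y"]
      by (cases x; cases y) (auto simp: copies_def if_distrib[of "\<lambda>x. x * _"] cong: if_cong)
  qed (auto simp: copies_def vtx_in A_zero)
  then show ?thesis
    unfolding fam_equiv_def by blast
qed

lemma free_rmodule_iso_if_mult_equiv:
  assumes "mult_equiv (\<lambda>_. n) (\<lambda>_. m)"
  shows "free_rmodule_iso quot m n"
proof -
  have idem: "idem_on {..<k} (\<lambda>_. u)" for k :: nat
    using u_in eqv_u_left[OF u_in] by (auto simp: idem_on_def)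
  have "fam_equiv {..<n} (\<lambda>_. u) (copies (\<lambda>_. m)) vfam"
    using fam_equiv_free assms[unfolded mult_equiv_def] idem finite_copies idem_on_copies by (rule fam_equiv_trans)
  then have "fam_equiv {..<n} (\<lambda>_. u) {..<m} (\<lambda>_. u)"
    using fam_equiv_sym[OF fam_equiv_free] idem finite_copies idem by (rule fam_equiv_trans)
  then show ?thesis
    unfolding fam_equiv_def using free_rmodule_iso_quotI by blast
qed

end

section \<open>Relative dimension of function spaces\<close>

definition fscale :: "'k::field \<Rightarrow> ('x \<Rightarrow> 'k) \<Rightarrow> 'x \<Rightarrow> 'k" where
  "fscale c f = (\<lambda>x. c * f x)"

text \<open>Full function spaces, without finiteness of support. Extension by zero places the spaces
  over different sets inside one ambient space, where intersections and agreement of maps make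
  sense. The dimensions that matter are those of images inside the functions on a finite
  set.\<close>

definition supp_on :: "'x set \<Rightarrow> ('x \<Rightarrow> 'k::field) set" where
  "supp_on Y = {f. \<forall>x. x \<notin> Y \<longrightarrow> f x = 0}"

definition unit_fun :: "'x \<Rightarrow> 'x \<Rightarrow> 'k::field" where
  "unit_fun x = (\<lambda>y. if y = x then 1 else 0)"

definition restr :: "'x set \<Rightarrow> ('x \<Rightarrow> 'k::field) \<Rightarrow> 'x \<Rightarrow> 'k" where
  "restr D f = (\<lambda>x. if x \<in> D then f x else 0)"

interpretation fs: vector_space fscale
  by unfold_locales (auto simp: fscale_def fun_eq_iff algebra_simps)

interpretation fsp: vector_space_pair fscale fscale
  by unfold_locales

abbreviation flinear :: "(('x \<Rightarrow> 'k::field) \<Rightarrow> ('y \<Rightarrow> 'k)) \<Rightarrow> bool" where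
  "flinear \<equiv> Vector_Spaces.linear fscale fscale"

lemma flinearI:
  assumes "\<And>f g. T (f + g) = T f + T g" "\<And>c f. T (fscale c f) = fscale c (T f)"
  shows "flinear T"
  by unfold_locales (auto simp: assms)

lemma subspace_supp_on: "fs.subspace (supp_on Y)"
  by (rule fs.subspaceI) (auto simp: supp_on_def fscale_def)

text \<open>Both images are the quotient of \<open>V\<close> by the common kernel. As
  \<open>V\<close> may be infinite-dimensional, a linear section \<open>s\<close> of
  \<open>L\<close> replaces rank and nullity: \<open>L'\<close> after \<open>s\<close> maps the
  image under \<open>L\<close> bijectively to the image under \<open>L'\<close>.\<close>

lemma dim_image_same_kernel:
  fixes L :: "('x \<Rightarrow> 'k::field) \<Rightarrow> ('y \<Rightarrow> 'k)" and L' :: "('x \<Rightarrow> 'k) \<Rightarrow> ('z \<Rightarrow> 'k)"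
  assumes L: "flinear L" and L': "flinear L'" and V: "fs.subspace V"
    and ker: "\<And>v. v \<in> V \<Longrightarrow> L v = 0 \<longleftrightarrow> L' v = 0"
  shows "fs.dim (L ` V) = fs.dim (L' ` V)"
proof -
  obtain s where s: "range s \<subseteq> V" "flinear s" "\<forall>v\<in>L ` V. L (s v) = v"
    using fsp.linear_exists_right_inverse_on[OF L V] by blast
  define M where "M = L' \<circ> s"
  have M: "flinear M"
    unfolding M_def by (rule Vector_Spaces.linear_compose[OF s(2) L'])
  have M_L: "M (L v) = L' v" if v: "v \<in> V" for v
  proof -
    have sv: "s (L v) \<in> V"
      using s(1) by auto
    then have "s (L v) - v \<in> V"
      using v V by (intro fs.subspace_diff)
    moreover have "L (s (L v) - v) = 0"
      using s(3) v by (simp add: fsp.linear_diff[OF L])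
    ultimately have "L' (s (L v) - v) = 0"
      using ker by blast
    then show ?thesis
      by (simp add: M_def fsp.linear_diff[OF L'])
  qed
  have LV: "fs.subspace (L ` V)"
    by (rule fsp.linear_subspace_image[OF L V])
  have inj: "inj_on M (L ` V)"
  proof (rule inj_onI)
    fix x y assume "x \<in> L ` V" "y \<in> L ` V" and eq: "M x = M y"
    then obtain v where v: "v \<in> V" "x - y = L v"
      using fs.subspace_diff[OF LV] by (metis imageE)
    have "M (x - y) = 0"
      using eq by (simp add: fsp.linear_diff[OF M])
    then show "x = y"
      using v M_L ker by force
  qed
  obtain B where B: "B \<subseteq> L ` V" "fs.independent B" "L ` V \<subseteq> fs.span B" "card B = fs.dim (L ` V)"
    using fs.basis_exists by blast
  have span: "fs.span B = L ` V"
    using B LV by (meson fs.span_minimal subset_antisym)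
  have "fs.independent (M ` B)"
    using fsp.linear_independent_injective_image[OF M B(2)] inj span by auto
  moreover have "M ` B \<subseteq> L' ` V"
    using B(1) M_L by force
  moreover have "L' ` V \<subseteq> fs.span (M ` B)"
    using M_L by (force simp: fsp.linear_span_image[OF M] span)
  ultimately have "card (M ` B) = fs.dim (L' ` V)"
    by (intro fs.basis_card_eq_dim)
  moreover have "card (M ` B) = card B"
    using inj B(1) by (meson card_image inj_on_subset)
  ultimately show ?thesis
    using B(4) by simp
qed

text \<open>No kernel element involves the point \<open>z\<close>, so the image of
  \<open>unit_fun z\<close> is independent of the image of \<open>supp_on Z\<close>. The finite set
  \<open>G\<close> makes the bases finite, so that their cardinalities really grow.\<close>

lemma dim_image_supp_on_insert:
  fixes L :: "('x \<Rightarrow> 'k::field) \<Rightarrow> ('y \<Rightarrow> 'k)"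
  assumes L: "flinear L" and z: "z \<notin> Z"
    and ker: "\<And>f. f \<in> supp_on (insert z Z) \<Longrightarrow> L f = 0 \<Longrightarrow> f \<in> supp_on Z"
    and G: "finite G" "L ` supp_on Z \<subseteq> fs.span G"
  shows "fs.dim (L ` supp_on (insert z Z)) = Suc (fs.dim (L ` supp_on Z))"
proof -
  obtain B where B: "B \<subseteq> L ` supp_on Z" "fs.independent B" "L ` supp_on Z \<subseteq> fs.span B"
      "card B = fs.dim (L ` supp_on Z)"
    using fs.basis_exists by blast
  have finB: "finite B"
    using fs.independent_span_bound[OF G(1) B(2)] B(1) G(2) by auto
  have span: "fs.span B = L ` supp_on Z"
    using B fsp.linear_subspace_image[OF L subspace_supp_on] by (meson fs.span_minimal subset_antisym)
  have notin: "L (unit_fun z) \<notin> fs.span B"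
  proof
    assume "L (unit_fun z) \<in> fs.span B"
    then obtain g where g: "g \<in> supp_on Z" "L (unit_fun z) = L g"
      unfolding span by auto
    then have "unit_fun z - g \<in> supp_on Z"
      by (intro ker) (auto simp: fsp.linear_diff[OF L] supp_on_def unit_fun_def)
    then have "(unit_fun z - g) z = 0" "g z = 0"
      using g z unfolding supp_on_def by auto
    then show False
      by (simp add: unit_fun_def)
  qed
  have ind: "fs.independent (insert (L (unit_fun z)) B)"
    using notin B(2) by (rule fs.independent_insertI)
  have "L ` supp_on (insert z Z) \<subseteq> fs.span (insert (L (unit_fun z)) B)"
  proof safe
    fix f :: "'x \<Rightarrow> 'k" assume f: "f \<in> supp_on (insert z Z)"
    have "f - fscale (f z) (unit_fun z) \<in> supp_on Z"
      using f by (auto simp: supp_on_def fscale_def unit_fun_def)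
    then have "L f - fscale (f z) (L (unit_fun z)) \<in> fs.span B"
      unfolding span by (auto simp: fsp.linear_diff[OF L, symmetric] fsp.linear_scale[OF L, symmetric])
    then show "L f \<in> fs.span (insert (L (unit_fun z)) B)"
      unfolding fs.span_insert by blast
  qed
  moreover have "insert (L (unit_fun z)) B \<subseteq> L ` supp_on (insert z Z)"
    using B(1) by (auto simp: supp_on_def unit_fun_def)
  ultimately have "card (insert (L (unit_fun z)) B) = fs.dim (L ` supp_on (insert z Z))"
    using ind by (intro fs.basis_card_eq_dim)
  moreover have "L (unit_fun z) \<notin> B"
    using notin fs.span_base by blast
  ultimately show ?thesis
    using B(4) finB by simp
qed

lemma dim_image_supp_on_union:
  fixes L :: "('x \<Rightarrow> 'k::field) \<Rightarrow> ('y \<Rightarrow> 'k)"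
  assumes L: "flinear L" and S: "finite S" "S \<inter> Z = {}"
    and ker: "\<And>f. f \<in> supp_on (S \<union> Z) \<Longrightarrow> L f = 0 \<Longrightarrow> f \<in> supp_on Z"
    and G: "finite G" "L ` supp_on (S \<union> Z) \<subseteq> fs.span G"
  shows "fs.dim (L ` supp_on (S \<union> Z)) = card S + fs.dim (L ` supp_on Z)"
  using S ker G(2)
proof (induction S rule: finite_induct)
  case (insert z S)
  have mono: "supp_on (S \<union> Z) \<subseteq> (supp_on (insert z (S \<union> Z)) :: ('x \<Rightarrow> 'k) set)"
    and mono': "supp_on Z \<subseteq> (supp_on (S \<union> Z) :: ('x \<Rightarrow> 'k) set)"
    by (auto simp: supp_on_def)
  have "fs.dim (L ` supp_on (insert z (S \<union> Z))) = Suc (fs.dim (L ` supp_on (S \<union> Z)))"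
  proof (rule dim_image_supp_on_insert[OF L _ _ G(1)])
    show "f \<in> supp_on (S \<union> Z)" if "f \<in> supp_on (insert z (S \<union> Z))" "L f = 0" for f
      using insert.prems(2)[of f] that mono' by auto
  qed (use insert mono in auto)
  moreover have "fs.dim (L ` supp_on (S \<union> Z)) = card S + fs.dim (L ` supp_on Z)"
  proof (rule insert.IH)
    show "f \<in> supp_on Z" if "f \<in> supp_on (S \<union> Z)" "L f = 0" for f
      using insert.prems(2)[of f] that mono by auto
    show "L ` supp_on (S \<union> Z) \<subseteq> fs.span G"
      using insert.prems(3) mono by auto
  qed (use insert in auto)
  ultimately show ?case
    using insert.hyps by simp
qed auto

lemma supp_on_subset_span:
  assumes "finite D"
  shows "supp_on D \<subseteq> fs.span (unit_fun ` D)"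
proof
  fix f :: "'a \<Rightarrow> 'b" assume f: "f \<in> supp_on D"
  have "f = (\<Sum>d\<in>D. fscale (f d) (unit_fun d))"
  proof
    fix x
    have "(\<Sum>d\<in>D. fscale (f d) (unit_fun d)) x = (\<Sum>d\<in>D. fscale (f d) (unit_fun d) x)"
      by (induction D rule: infinite_finite_induct) auto
    also have "\<dots> = (\<Sum>d\<in>D. if d = x then f x else 0)"
      by (intro sum.cong) (auto simp: fscale_def unit_fun_def)
    also have "\<dots> = f x"
      using assms f by (auto simp: supp_on_def)
    finally show "f x = (\<Sum>d\<in>D. fscale (f d) (unit_fun d)) x"
      by simp
  qed
  also have "\<dots> \<in> fs.span (unit_fun ` D)"
    by (intro fs.span_sum fs.span_scale fs.span_base) auto
  finally show "f \<in> fs.span (unit_fun ` D)" .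
qed

lemma dim_supp_on:
  assumes "finite D"
  shows "fs.dim (supp_on D :: ('x \<Rightarrow> 'k::field) set) = card D"
proof -
  have empty: "(supp_on {} :: ('x \<Rightarrow> 'k) set) = {0}"
    by (auto simp: supp_on_def fun_eq_iff)
  have "fs.dim (id ` supp_on (D \<union> {}) :: ('x \<Rightarrow> 'k) set) = card D + fs.dim (id ` supp_on {} :: ('x \<Rightarrow> 'k) set)"
    by (rule dim_image_supp_on_union[where G = "unit_fun ` D"])
      (use assms supp_on_subset_span[OF assms] in \<open>auto simp: supp_on_def intro!: flinearI\<close>)
  moreover have "fs.dim ({0} :: ('x \<Rightarrow> 'k) set) = 0"
    using fs.dim_eq_card[of "{}" "{0} :: ('x \<Rightarrow> 'k) set"] fs.independent_empty
    by (simp add: fs.span_insert_0)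
  ultimately show ?thesis
    by (simp add: empty)
qed

lemma flinear_restr_comp:
  assumes "flinear S"
  shows "flinear (\<lambda>g. restr D (S g))"
  by (rule flinearI)
    (auto simp: restr_def fun_eq_iff fsp.linear_add[OF assms] fsp.linear_scale[OF assms], simp_all add: fscale_def)

text \<open>Restriction to \<open>D\<close> after \<open>S\<close> maps \<open>supp_on Z\<close>
  onto the functions on \<open>D\<close>, with a kernel \<open>W\<close> inside
  \<open>supp_on Z'\<close>. So \<open>card D\<close> is the codimension of \<open>W\<close> in
  \<open>supp_on Z\<close>; it splits into the points of \<open>Z - Z'\<close> and the codimension
  of \<open>W\<close> in \<open>supp_on Z'\<close>.\<close>

lemma codim_via_inverse:
  fixes T :: "('y \<Rightarrow> 'k::field) \<Rightarrow> ('z \<Rightarrow> 'k)" and S :: "('z \<Rightarrow> 'k) \<Rightarrow> ('y \<Rightarrow> 'k)"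
  assumes S: "flinear S"
    and T_in: "\<And>f. f \<in> supp_on Y \<Longrightarrow> T f \<in> supp_on Z"
    and ST: "\<And>f. f \<in> supp_on Y \<Longrightarrow> S (T f) = f"
    and D: "finite D" "D \<subseteq> Y" and Z: "Z' \<subseteq> Z" "finite (Z - Z')"
    and ker: "\<And>g. g \<in> supp_on Z \<Longrightarrow> restr D (S g) = 0 \<Longrightarrow> g \<in> supp_on Z'"
  shows "card D = card (Z - Z') + fs.dim ((\<lambda>g. restr D (S g)) ` supp_on Z')"
proof -
  let ?L = "\<lambda>g. restr D (S g)"
  have img: "?L ` supp_on Z = supp_on D"
  proof (intro subset_antisym subsetI)
    fix f :: "'y \<Rightarrow> 'k" assume f: "f \<in> supp_on D"
    then have "f \<in> supp_on Y"
      using D by (auto simp: supp_on_def)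
    then have "T f \<in> supp_on Z" "?L (T f) = restr D f"
      using T_in ST by auto
    moreover have "restr D f = f"
      using f by (auto simp: supp_on_def restr_def)
    ultimately show "f \<in> ?L ` supp_on Z"
      by (metis image_eqI)
  qed (auto simp: supp_on_def restr_def)
  have Z_eq: "Z = (Z - Z') \<union> Z'"
    using Z by auto
  have "fs.dim (?L ` supp_on ((Z - Z') \<union> Z')) = card (Z - Z') + fs.dim (?L ` supp_on Z')"
    by (rule dim_image_supp_on_union[OF flinear_restr_comp[OF S], where G = "unit_fun ` D"])
      (use Z Z_eq D ker img supp_on_subset_span[of D] in auto)
  then show ?thesis
    using Z_eq img D(1) by (simp add: dim_supp_on)
qed

text \<open>
  \<open>T1\<close> and \<open>T2\<close> have the same image \<open>W\<close> on the finite-codimensional space where they agree, and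
  codimensions over \<open>W\<close> are compared on both sides.  Counting dimensions, where a trace argument
  would determine the cardinalities only modulo the characteristic, works over every field.
\<close>

lemma relative_card_invariant:
  fixes T1 T2 :: "('y \<Rightarrow> 'k::field) \<Rightarrow> ('z \<Rightarrow> 'k)" and S1 S2 :: "('z \<Rightarrow> 'k) \<Rightarrow> ('y \<Rightarrow> 'k)"
  assumes S1: "flinear S1" and S2: "flinear S2"
    and T1_in: "\<And>f. f \<in> supp_on Y1 \<Longrightarrow> T1 f \<in> supp_on Z1"
    and T2_in: "\<And>f. f \<in> supp_on Y2 \<Longrightarrow> T2 f \<in> supp_on Z2"
    and S1_in: "\<And>g. g \<in> supp_on Z1 \<Longrightarrow> S1 g \<in> supp_on Y1"
    and S2_in: "\<And>g. g \<in> supp_on Z2 \<Longrightarrow> S2 g \<in> supp_on Y2"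
    and ST1: "\<And>f. f \<in> supp_on Y1 \<Longrightarrow> S1 (T1 f) = f"
    and ST2: "\<And>f. f \<in> supp_on Y2 \<Longrightarrow> S2 (T2 f) = f"
    and TS1: "\<And>g. g \<in> supp_on Z1 \<Longrightarrow> T1 (S1 g) = g"
    and TS2: "\<And>g. g \<in> supp_on Z2 \<Longrightarrow> T2 (S2 g) = g"
    and F: "finite F"
    and agree: "\<And>f. f \<in> supp_on (Y1 \<inter> Y2) \<Longrightarrow> (\<forall>y\<in>F. f y = 0) \<Longrightarrow> T1 f = T2 f"
    and fin: "finite (Y1 - Y2)" "finite (Y2 - Y1)" "finite (Z1 - Z2)" "finite (Z2 - Z1)"
  shows "card (Y1 - Y2) + card (Z2 - Z1) = card (Y2 - Y1) + card (Z1 - Z2)"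
proof -
  \<comment> \<open>A function on \<open>Y1\<close> that vanishes on \<open>D1\<close> lives on
    \<open>Y1 \<inter> Y2\<close> and vanishes on \<open>F\<close>, so \<open>T1\<close> and
    \<open>T2\<close> agree on it; \<open>D2\<close> does the same for \<open>Y2\<close>. The common
    part \<open>D0\<close> cancels in the end.\<close>
  define D0 where "D0 = F \<inter> Y1 \<inter> Y2"
  define D1 where "D1 = D0 \<union> (Y1 - Y2)"
  define D2 where "D2 = D0 \<union> (Y2 - Y1)"
  have D: "finite D1" "D1 \<subseteq> Y1" "finite D2" "D2 \<subseteq> Y2"
    using F fin by (auto simp: D0_def D1_def D2_def)
  \<comment> \<open>If the restriction is zero then \<open>g = T1 (S1 g) = T2 (S1 g)\<close>, hence
    \<open>g\<close> lies on the second side too and \<open>S2\<close> takes it to the same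
    function. With the mirrored \<open>ker2\<close>, the two restricted maps have the same kernel on
    \<open>supp_on (Z1 \<inter> Z2)\<close>.\<close>
  have ker1: "S1 g \<in> supp_on (Y1 \<inter> Y2)" "\<forall>y\<in>F. S1 g y = 0" "g \<in> supp_on Z2" "S2 g = S1 g"
    if g: "g \<in> supp_on Z1" "restr D1 (S1 g) = 0" for g
  proof -
    have van: "S1 g y = 0" if "y \<in> D1 \<or> y \<notin> Y1" for y
      using that g(2) S1_in[OF g(1)] by (auto simp: restr_def supp_on_def fun_eq_iff split: if_splits)
    show *: "S1 g \<in> supp_on (Y1 \<inter> Y2)"
      using van by (auto simp: supp_on_def D1_def)
    show **: "\<forall>y\<in>F. S1 g y = 0"
      using van * by (auto simp: supp_on_def D1_def D0_def)
    have "T2 (S1 g) = g"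
      using agree[OF * **] TS1[OF g(1)] by simp
    moreover have "S1 g \<in> supp_on Y2"
      using * by (auto simp: supp_on_def)
    ultimately show "g \<in> supp_on Z2" "S2 g = S1 g"
      using T2_in ST2 by metis+
  qed
  have ker2: "S2 g \<in> supp_on (Y1 \<inter> Y2)" "\<forall>y\<in>F. S2 g y = 0" "g \<in> supp_on Z1" "S1 g = S2 g"
    if g: "g \<in> supp_on Z2" "restr D2 (S2 g) = 0" for g
  proof -
    have van: "S2 g y = 0" if "y \<in> D2 \<or> y \<notin> Y2" for y
      using that g(2) S2_in[OF g(1)] by (auto simp: restr_def supp_on_def fun_eq_iff split: if_splits)
    show *: "S2 g \<in> supp_on (Y1 \<inter> Y2)"
      using van by (auto simp: supp_on_def D2_def)
    show **: "\<forall>y\<in>F. S2 g y = 0"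
      using van * by (auto simp: supp_on_def D2_def D0_def)
    have "T1 (S2 g) = g"
      using agree[OF * **] TS2[OF g(1)] by simp
    moreover have "S2 g \<in> supp_on Y1"
      using * by (auto simp: supp_on_def)
    ultimately show "g \<in> supp_on Z1" "S1 g = S2 g"
      using T1_in ST1 by metis+
  qed
  have "card D1 = card (Z1 - Z1 \<inter> Z2) + fs.dim ((\<lambda>g. restr D1 (S1 g)) ` supp_on (Z1 \<inter> Z2))"
    by (rule codim_via_inverse[OF S1 T1_in ST1 D(1,2)])
      (use fin ker1(3) in \<open>auto simp: Diff_Int supp_on_def\<close>)
  moreover have "card D2 = card (Z2 - Z1 \<inter> Z2) + fs.dim ((\<lambda>g. restr D2 (S2 g)) ` supp_on (Z1 \<inter> Z2))"
    by (rule codim_via_inverse[OF S2 T2_in ST2 D(3,4)])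
      (use fin ker2(3) in \<open>auto simp: Diff_Int supp_on_def\<close>)
  moreover have "fs.dim ((\<lambda>g. restr D1 (S1 g)) ` supp_on (Z1 \<inter> Z2))
      = fs.dim ((\<lambda>g. restr D2 (S2 g)) ` supp_on (Z1 \<inter> Z2))"
  proof (rule dim_image_same_kernel[OF flinear_restr_comp[OF S1] flinear_restr_comp[OF S2] subspace_supp_on])
    fix g :: "'z \<Rightarrow> 'k" assume "g \<in> supp_on (Z1 \<inter> Z2)"
    then have g: "g \<in> supp_on Z1" "g \<in> supp_on Z2"
      by (auto simp: supp_on_def)
    show "restr D1 (S1 g) = 0 \<longleftrightarrow> restr D2 (S2 g) = 0"
    proof
      assume "restr D1 (S1 g) = 0"
      from ker1[OF g(1) this] show "restr D2 (S2 g) = 0"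
        by (auto simp: restr_def D2_def D0_def supp_on_def fun_eq_iff)
    next
      assume "restr D2 (S2 g) = 0"
      from ker2[OF g(2) this] show "restr D1 (S1 g) = 0"
        by (auto simp: restr_def D1_def D0_def supp_on_def fun_eq_iff)
    qed
  qed
  \<comment> \<open>Comparing the two codimension formulas eliminates both the common dimension and
    \<open>card D0\<close>.\<close>
  moreover have "card D1 = card D0 + card (Y1 - Y2)" "card D2 = card D0 + card (Y2 - Y1)"
    unfolding D1_def D2_def using F fin by (auto intro!: card_Un_disjoint simp: D0_def)
  moreover have "Z1 - Z1 \<inter> Z2 = Z1 - Z2" "Z2 - Z1 \<inter> Z2 = Z2 - Z1"
    by auto
  ultimately show ?thesis
    by simp
qed

section \<open>Leavitt path algebras as quotients\<close>

lemma poly_mapping_sum_single: "p = (\<Sum>w\<in>Poly_Mapping.keys p. Poly_Mapping.single w (Poly_Mapping.lookup p w))"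
proof (rule poly_mapping_eqI)
  fix w
  have "Poly_Mapping.lookup (\<Sum>w\<in>Poly_Mapping.keys p. Poly_Mapping.single w (Poly_Mapping.lookup p w)) w
      = (\<Sum>x\<in>Poly_Mapping.keys p. if x = w then Poly_Mapping.lookup p w else 0)"
    unfolding lookup_sum by (intro sum.cong) (auto simp: lookup_single when_def)
  also have "\<dots> = Poly_Mapping.lookup p w"
    by (simp add: in_keys_iff)
  finally show "Poly_Mapping.lookup p w
      = Poly_Mapping.lookup (\<Sum>w\<in>Poly_Mapping.keys p. Poly_Mapping.single w (Poly_Mapping.lookup p w)) w"
    by simp
qed

lemma single_0_mult_commute:
  fixes p :: "'g fword \<Rightarrow>\<^sub>0 'k::field"
  shows "Poly_Mapping.single 0 c * p = p * Poly_Mapping.single 0 c"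
  by (subst (1 2) poly_mapping_sum_single[of p])
    (simp add: sum_distrib_left sum_distrib_right mult_single mult.commute)

lemma single_0_mult_left:
  fixes p :: "'g fword \<Rightarrow>\<^sub>0 'k::field"
  shows "Poly_Mapping.single 0 (-1) * p = - p"
  by (simp add: single_uminus)

lemma single_Cons: "Poly_Mapping.single (FWord (g # l)) c = gen g * Poly_Mapping.single (FWord l) c"
  by (simp add: gen_def mult_single plus_fword_def)

lemma single_snoc: "Poly_Mapping.single (FWord (l @ [g])) c = Poly_Mapping.single (FWord l) c * gen g"
  by (simp add: gen_def mult_single plus_fword_def)

lemma free_algebra_zero: "0 \<in> free_algebra X"
  by (simp add: free_algebra_def)

lemma free_algebra_add: "p \<in> free_algebra X \<Longrightarrow> q \<in> free_algebra X \<Longrightarrow> p + q \<in> free_algebra X"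
  unfolding free_algebra_def using keys_add[of p q] by blast

lemma free_algebra_mult: "p \<in> free_algebra X \<Longrightarrow> q \<in> free_algebra X \<Longrightarrow> p * q \<in> free_algebra X"
  unfolding free_algebra_def using keys_mult[of p q] by (fastforce simp: plus_fword_def)

lemma free_algebra_scale: "p \<in> free_algebra X \<Longrightarrow> Poly_Mapping.single 0 c * p \<in> free_algebra X"
proof -
  assume p: "p \<in> free_algebra X"
  have "Poly_Mapping.keys (Poly_Mapping.single 0 c * p) \<subseteq> Poly_Mapping.keys p"
    using keys_mult[of "Poly_Mapping.single 0 c" p] by (auto split: if_splits)
  then show ?thesis
    using p by (auto simp: free_algebra_def)
qed

lemma free_algebra_uminus: "p \<in> free_algebra X \<Longrightarrow> - p \<in> free_algebra X"
  using free_algebra_scale[of p X "-1"] by (simp only: single_0_mult_left)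

lemma free_algebra_diff: "p \<in> free_algebra X \<Longrightarrow> q \<in> free_algebra X \<Longrightarrow> p - q \<in> free_algebra X"
  using free_algebra_add[OF _ free_algebra_uminus, of p X q] by simp

lemma free_algebra_gen: "g \<in> X \<Longrightarrow> gen g \<in> free_algebra X"
  by (simp add: free_algebra_def gen_def)

lemma free_algebra_single: "l \<noteq> [] \<Longrightarrow> set l \<subseteq> X \<Longrightarrow> Poly_Mapping.single (FWord l) c \<in> free_algebra X"
  by (simp add: free_algebra_def)

lemma free_algebra_sum: "(\<And>x. x \<in> S \<Longrightarrow> f x \<in> free_algebra X) \<Longrightarrow> sum f S \<in> free_algebra X"
  by (induction S rule: infinite_finite_induct) (auto simp: free_algebra_zero free_algebra_add)

lemma algebra_ideal_uminus: "p \<in> algebra_ideal A S \<Longrightarrow> - p \<in> algebra_ideal A S"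
  using algebra_ideal.scale[of p A S "-1"] by (simp only: single_0_mult_left)

lemma algebra_ideal_diff:
  "p \<in> algebra_ideal A S \<Longrightarrow> q \<in> algebra_ideal A S \<Longrightarrow> p - q \<in> algebra_ideal A S"
  using algebra_ideal.add[OF _ algebra_ideal_uminus, of p A S q] by simp

lemma algebra_ideal_sum:
  "(\<And>x. x \<in> X \<Longrightarrow> f x \<in> algebra_ideal A S) \<Longrightarrow> sum f X \<in> algebra_ideal A S"
  by (induction X rule: infinite_finite_induct) (auto intro: algebra_ideal.intros)

lemma algebra_ideal_subset:
  assumes "S \<subseteq> free_algebra X"
  shows "algebra_ideal (free_algebra X) S \<subseteq> free_algebra X"
proof
  fix p assume "p \<in> algebra_ideal (free_algebra X) S"
  then show "p \<in> free_algebra X"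
    using assms by induction
      (auto intro: free_algebra_zero free_algebra_add free_algebra_mult free_algebra_scale)
qed

text \<open>The empty word lies outside the free algebra without identity; there closure of the
  ideal under scalars takes over. The case arises because splitting a letter off a one-letter word
  leaves the empty word.\<close>

lemma algebra_ideal_mult_word:
  assumes "p \<in> algebra_ideal (free_algebra X) S" "set l \<subseteq> X"
  shows "p * Poly_Mapping.single (FWord l) c \<in> algebra_ideal (free_algebra X) S"
    and "Poly_Mapping.single (FWord l) c * p \<in> algebra_ideal (free_algebra X) S"
proof -
  have "p * Poly_Mapping.single (FWord l) c \<in> algebra_ideal (free_algebra X) S
    \<and> Poly_Mapping.single (FWord l) c * p \<in> algebra_ideal (free_algebra X) S"
  proof (cases "l = []")
    case True
    then show ?thesis
      using algebra_ideal.scale[OF assms(1), of c] by (simp add: zero_fword_def[symmetric] single_0_mult_commute)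
  next
    case False
    then show ?thesis
      using assms by (auto intro: algebra_ideal.left algebra_ideal.right free_algebra_single)
  qed
  then show "p * Poly_Mapping.single (FWord l) c \<in> algebra_ideal (free_algebra X) S"
    "Poly_Mapping.single (FWord l) c * p \<in> algebra_ideal (free_algebra X) S"
    by auto
qed

text \<open>Words are nonempty, so the first letter absorbs \<open>u\<close> on the left and the
  last letter absorbs it on the right; checking the generators is enough.\<close>

lemma algebra_ideal_unit:
  assumes gens: "\<And>g. g \<in> X \<Longrightarrow> u * gen g - gen g \<in> algebra_ideal (free_algebra X) S"
      "\<And>g. g \<in> X \<Longrightarrow> gen g * u - gen g \<in> algebra_ideal (free_algebra X) S"
    and a: "a \<in> free_algebra X"
  shows "u * a - a \<in> algebra_ideal (free_algebra X) S"
    and "a * u - a \<in> algebra_ideal (free_algebra X) S"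
proof -
  let ?m = "\<lambda>w. Poly_Mapping.single w (Poly_Mapping.lookup a w)"
  have keys: "letters w \<noteq> []" "set (letters w) \<subseteq> X" if "w \<in> Poly_Mapping.keys a" for w
    using a that by (auto simp: free_algebra_def)
  have "u * a - a = (\<Sum>w\<in>Poly_Mapping.keys a. u * ?m w - ?m w)"
    by (subst (1 2) poly_mapping_sum_single[of a]) (simp add: sum_distrib_left sum_subtractf)
  also have "\<dots> \<in> algebra_ideal (free_algebra X) S"
  proof (rule algebra_ideal_sum)
    fix w assume w: "w \<in> Poly_Mapping.keys a"
    obtain g l where gl: "letters w = g # l"
      using keys[OF w] by (cases "letters w") auto
    then have m: "?m w = gen g * Poly_Mapping.single (FWord l) (Poly_Mapping.lookup a w)"
      by (metis fword.collapse single_Cons)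
    have "u * ?m w - ?m w = (u * gen g - gen g) * Poly_Mapping.single (FWord l) (Poly_Mapping.lookup a w)"
      unfolding m by (simp add: algebra_simps)
    then show "u * ?m w - ?m w \<in> algebra_ideal (free_algebra X) S"
      using keys[OF w] gl gens(1)[of g] by (simp add: algebra_ideal_mult_word)
  qed
  finally show "u * a - a \<in> algebra_ideal (free_algebra X) S" .
  have "a * u - a = (\<Sum>w\<in>Poly_Mapping.keys a. ?m w * u - ?m w)"
    by (subst (1 2) poly_mapping_sum_single[of a]) (simp add: sum_distrib_right sum_subtractf)
  also have "\<dots> \<in> algebra_ideal (free_algebra X) S"
  proof (rule algebra_ideal_sum)
    fix w assume w: "w \<in> Poly_Mapping.keys a"
    obtain g l where gl: "letters w = l @ [g]"
      using keys[OF w] by (cases "letters w" rule: rev_cases) auto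
    then have m: "?m w = Poly_Mapping.single (FWord l) (Poly_Mapping.lookup a w) * gen g"
      by (metis fword.collapse single_snoc)
    have "?m w * u - ?m w = Poly_Mapping.single (FWord l) (Poly_Mapping.lookup a w) * (gen g * u - gen g)"
      unfolding m by (simp add: algebra_simps)
    then show "?m w * u - ?m w \<in> algebra_ideal (free_algebra X) S"
      using keys[OF w] gl gens(2)[of g] by (simp add: algebra_ideal_mult_word)
  qed
  finally show "a * u - a \<in> algebra_ideal (free_algebra X) S" .
qed

text \<open>Numbers the elements of every fibre of \<open>f\<close> separately. With
  \<open>f\<close> the head map on the edges leaving a vertex, edges become copies of their
  heads.\<close>

lemma ex_bij_fibres:
  assumes D: "finite D" and f: "f ` D \<subseteq> V"
  shows "\<exists>h. bij_betw h D (Sigma V (\<lambda>x. {..<card {e \<in> D. f e = x}})) \<and> (\<forall>e\<in>D. fst (h e) = f e)"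
proof -
  have "\<forall>x. \<exists>b. bij_betw b {e \<in> D. f e = x} {..<card {e \<in> D. f e = x}}"
  proof
    fix x
    have "finite {e \<in> D. f e = x}"
      using D by simp
    from ex_bij_betw_finite_nat[OF this] show "\<exists>b. bij_betw b {e \<in> D. f e = x} {..<card {e \<in> D. f e = x}}"
      unfolding atLeast0LessThan .
  qed
  from choice[OF this] obtain b
    where b: "\<And>x. bij_betw (b x) {e \<in> D. f e = x} {..<card {e \<in> D. f e = x}}"
    by blast
  have "bij_betw (\<lambda>e. (f e, b (f e) e)) D (Sigma V (\<lambda>x. {..<card {e \<in> D. f e = x}}))"
    unfolding bij_betw_def
  proof (intro conjI inj_onI subset_antisym subsetI)
    fix e e' assume e: "e \<in> D" "e' \<in> D" "(f e, b (f e) e) = (f e', b (f e') e')"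
    then show "e = e'"
      using inj_onD[OF bij_betw_imp_inj_on[OF b[of "f e"]], of e e'] by auto
  next
    fix y assume "y \<in> (\<lambda>e. (f e, b (f e) e)) ` D"
    then show "y \<in> Sigma V (\<lambda>x. {..<card {e \<in> D. f e = x}})"
      using bij_betw_apply[OF b] f by auto
  next
    fix y assume "y \<in> Sigma V (\<lambda>x. {..<card {e \<in> D. f e = x}})"
    then obtain x i where y: "y = (x, i)" "i \<in> {..<card {e \<in> D. f e = x}}"
      by auto
    have "i \<in> b x ` {e \<in> D. f e = x}"
      using y(2) unfolding bij_betw_imp_surj_on[OF b[of x]] .
    then obtain e where "i = b x e" "e \<in> {e \<in> D. f e = x}"
      by (rule imageE)
    then show "y \<in> (\<lambda>e. (f e, b (f e) e)) ` D"
      using y by auto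
  qed
  then show ?thesis
    by (intro exI[of _ "\<lambda>e. (f e, b (f e) e)"]) simp
qed

section \<open>The Leavitt path algebra as a quotient with orthogonal vertex idempotents\<close>

locale lpa = fin_digraph E for E :: "('v, 'e) pre_digraph" +
  fixes K :: "'k::field itself"
begin

abbreviation A :: "(('v, 'e) lpa_gen fword \<Rightarrow>\<^sub>0 'k) set" where
  "A \<equiv> free_algebra (lpa_gens E)"

abbreviation I :: "(('v, 'e) lpa_gen fword \<Rightarrow>\<^sub>0 'k) set" where
  "I \<equiv> algebra_ideal A (lpa_rels E)"

abbreviation gv :: "'v \<Rightarrow> (('v, 'e) lpa_gen fword \<Rightarrow>\<^sub>0 'k)" where
  "gv w \<equiv> gen (Vertex w)"

abbreviation ge :: "'e \<Rightarrow> (('v, 'e) lpa_gen fword \<Rightarrow>\<^sub>0 'k)" where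
  "ge e \<equiv> gen (Edge e)"

abbreviation gg :: "'e \<Rightarrow> (('v, 'e) lpa_gen fword \<Rightarrow>\<^sub>0 'k)" where
  "gg e \<equiv> gen (Ghost e)"

abbreviation u :: "(('v, 'e) lpa_gen fword \<Rightarrow>\<^sub>0 'k)" where
  "u \<equiv> \<Sum>w\<in>verts E. gv w"

lemma gv_in: "w \<in> verts E \<Longrightarrow> gv w \<in> A"
  by (intro free_algebra_gen) (simp add: lpa_gens_def)

lemma ge_in: "e \<in> arcs E \<Longrightarrow> ge e \<in> A"
  by (intro free_algebra_gen) (simp add: lpa_gens_def)

lemma gg_in: "e \<in> arcs E \<Longrightarrow> gg e \<in> A"
  by (intro free_algebra_gen) (simp add: lpa_gens_def)

lemmas A_intros = gv_in ge_in gg_in free_algebra_mult free_algebra_diff free_algebra_zero free_algebra_sum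

lemma rels_subset: "lpa_rels E \<subseteq> A"
  unfolding lpa_rels_def regular_verts_def by (auto intro!: A_intros split: if_splits)

lemma rel_vertex:
  "v \<in> verts E \<Longrightarrow> w \<in> verts E \<Longrightarrow> gv v * gv w - (if v = w then gv w else 0) \<in> I"
  by (rule algebra_ideal.base) (auto simp: lpa_rels_def)

lemma rel_edge_tail: "e \<in> arcs E \<Longrightarrow> gv (tail E e) * ge e - ge e \<in> I"
  by (rule algebra_ideal.base) (auto simp: lpa_rels_def)

lemma rel_edge_head: "e \<in> arcs E \<Longrightarrow> ge e * gv (head E e) - ge e \<in> I"
  by (rule algebra_ideal.base) (auto simp: lpa_rels_def)

lemma rel_ghost_head: "e \<in> arcs E \<Longrightarrow> gv (head E e) * gg e - gg e \<in> I"
  by (rule algebra_ideal.base) (auto simp: lpa_rels_def)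

lemma rel_ghost_tail: "e \<in> arcs E \<Longrightarrow> gg e * gv (tail E e) - gg e \<in> I"
  by (rule algebra_ideal.base) (auto simp: lpa_rels_def)

lemma rel_ghost_edge:
  "e \<in> arcs E \<Longrightarrow> f \<in> arcs E \<Longrightarrow> gg e * ge f - (if e = f then gv (head E e) else 0) \<in> I"
  by (rule algebra_ideal.base) (auto simp: lpa_rels_def)

lemma rel_regular: "w \<in> regular_verts E \<Longrightarrow> gv w - (\<Sum>e\<in>out_arcs E w. ge e * gg e) \<in> I"
  unfolding lpa_rels_def
  by (intro algebra_ideal.base UnI2 CollectI exI[of _ w] conjI) (rule refl, assumption)

lemma u_in: "u \<in> A"
  by (intro A_intros)

lemma unit_vertex:
  assumes w: "w \<in> verts E"
  shows "u * gv w - gv w \<in> I" "gv w * u - gv w \<in> I"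
proof -
  have "u * gv w - gv w = (\<Sum>v\<in>verts E. gv v * gv w - (if v = w then gv w else 0))"
    using w by (simp add: sum_subtractf sum_distrib_right)
  also have "\<dots> \<in> I"
    using w by (intro algebra_ideal_sum rel_vertex)
  finally show "u * gv w - gv w \<in> I" .
  have "gv w * u - gv w = (\<Sum>v\<in>verts E. gv w * gv v - (if w = v then gv v else 0))"
    using w by (simp add: sum_subtractf sum_distrib_left)
  also have "\<dots> \<in> I"
    using w by (intro algebra_ideal_sum rel_vertex)
  finally show "gv w * u - gv w \<in> I" .
qed

lemma unit_left:
  assumes "w \<in> verts E" "x \<in> A" "gv w * x - x \<in> I"
  shows "u * x - x \<in> I"
proof -
  \<comment> \<open>The chain \<open>u x = u gv w x = gv w x = x\<close> modulo \<open>I\<close>,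
    with its error terms made explicit.\<close>
  have "u * x - x = (u * gv w - gv w) * x - u * (gv w * x - x) + (gv w * x - x)"
    by (simp add: algebra_simps)
  also have "\<dots> \<in> I"
    by (rule algebra_ideal.add[OF algebra_ideal_diff[OF
          algebra_ideal.right[OF unit_vertex(1)[OF assms(1)] assms(2)] algebra_ideal.left[OF assms(3) u_in]] assms(3)])
  finally show ?thesis .
qed

lemma unit_right:
  assumes "w \<in> verts E" "x \<in> A" "x * gv w - x \<in> I"
  shows "x * u - x \<in> I"
proof -
  have "x * u - x = x * (gv w * u - gv w) - (x * gv w - x) * u + (x * gv w - x)"
    by (simp add: algebra_simps)
  also have "\<dots> \<in> I"
    by (rule algebra_ideal.add[OF algebra_ideal_diff[OF
          algebra_ideal.left[OF unit_vertex(2)[OF assms(1)] assms(2)] algebra_ideal.right[OF assms(3) u_in]] assms(3)])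
  finally show ?thesis .
qed

lemma unit_gen:
  assumes "g \<in> lpa_gens E"
  shows "u * gen g - gen g \<in> I" "gen g * u - gen g \<in> I"
proof -
  consider w where "g = Vertex w" "w \<in> verts E" | e where "g = Edge e" "e \<in> arcs E"
    | e where "g = Ghost e" "e \<in> arcs E"
    using assms by (auto simp: lpa_gens_def)
  then have "u * gen g - gen g \<in> I \<and> gen g * u - gen g \<in> I"
  proof cases
    case 1
    then show ?thesis
      using unit_vertex by simp
  next
    case 2
    then show ?thesis
      using unit_left[OF tail_in_verts ge_in rel_edge_tail] unit_right[OF head_in_verts ge_in rel_edge_head]
      by simp
  next
    case 3
    then show ?thesis
      using unit_left[OF head_in_verts gg_in rel_ghost_head] unit_right[OF tail_in_verts gg_in rel_ghost_tail]
      by simp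
  qed
  then show "u * gen g - gen g \<in> I" "gen g * u - gen g \<in> I"
    by auto
qed

sublocale ideal_quotient A I u
proof (unfold_locales, goal_cases)
  case (5)
  then show ?case
    by (rule algebra_ideal_subset[OF rels_subset])
next
  case (12 a)
  show ?case
    by (rule algebra_ideal_unit(1)[OF unit_gen(1) unit_gen(2) 12])
next
  case (13 a)
  show ?case
    by (rule algebra_ideal_unit(2)[OF unit_gen(1) unit_gen(2) 13])
qed (simp_all add: u_in free_algebra_mult free_algebra_zero free_algebra_add free_algebra_uminus
    algebra_ideal.zero algebra_ideal.add algebra_ideal.left algebra_ideal.right algebra_ideal_uminus)

sublocale orthogonal_quotient A I u "verts E" gv
proof unfold_locales
  show "eqv (gv w * gv w') (if w = w' then gv w else 0)" if "w \<in> verts E" "w' \<in> verts E" for w w'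
    using rel_vertex[OF that] by (auto simp: eqv_def split: if_splits)
qed (auto intro: gv_in)

lemma leavitt_path_algebra_eq: "leavitt_path_algebra K E = quot"
  by (simp add: leavitt_path_algebra_def lpa_free_def base_ring_def)

text \<open>The row of the edges leaving \<open>w\<close> and the column of their ghosts are inverse
  to each other: row times column is the sum in the relation at a regular vertex, and column times
  row is diagonal by the relation between ghosts and edges.\<close>

lemma mult_equiv_expand:
  assumes w: "w \<in> regular_verts E"
  shows "mult_equiv (\<lambda>x. if x = w then 1 else 0) (\<lambda>x. card {e \<in> arcs E. tail E e = w \<and> head E e = x})"
proof -
  let ?r = "\<lambda>x. card {e \<in> arcs E. tail E e = w \<and> head E e = x}"
  have wV: "w \<in> verts E" and fin: "finite (out_arcs E w)"
    using w by (auto simp: regular_verts_def)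
  have copies_w: "copies (\<lambda>x. if x = w then 1 else 0) = {(w, 0)}"
    using wV by (auto simp: copies_def split: if_splits)
  have idem: "idem_on (out_arcs E w) (\<lambda>e. gv (head E e))"
    using fin idem_vtx by (auto simp: idem_on_def intro: gv_in)
  have sum_eqv: "eqv (\<Sum>e\<in>out_arcs E w. ge e * gg e) (gv w)"
    by (rule eqv_sym) (unfold eqv_def, rule rel_regular[OF w])
  have ghost_edge_eqv: "eqv (gg e * ge f) (if e = f then gv (head E e) else 0)"
    if "e \<in> out_arcs E w" "f \<in> out_arcs E w" for e f
    unfolding eqv_def using that by (intro rel_ghost_edge) simp_all
  have "inverse_matrices {(w, 0::nat)} (\<lambda>x. gv (fst x)) (out_arcs E w) (\<lambda>e. gv (head E e))
      (\<lambda>_ e. ge e) (\<lambda>e _. gg e)"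
    unfolding inverse_matrices_def
  proof (intro conjI ballI)
    fix i i' assume "i \<in> {(w, 0::nat)}" "i' \<in> {(w, 0::nat)}"
    then have "i = (w, 0)" "i' = (w, 0)"
      by blast+
    then show "eqv (\<Sum>e\<in>out_arcs E w. ge e * gg e) (if i = i' then gv (fst i) else 0)"
      using sum_eqv by (simp only: if_True fst_conv refl)
  next
    fix e f assume "e \<in> out_arcs E w" "f \<in> out_arcs E w"
    then have "eqv (gg e * ge f) (if e = f then gv (head E e) else 0)"
      by (rule ghost_edge_eqv)
    moreover have "(\<Sum>i\<in>{(w, 0::nat)}. gg e * ge f) = gg e * ge f"
      by simp
    ultimately show "eqv (\<Sum>i\<in>{(w, 0::nat)}. gg e * ge f) (if e = f then gv (head E e) else 0)"
      by (simp only:)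
  next
    fix e assume "e \<in> out_arcs E w"
    then have e: "e \<in> arcs E"
      by simp
    show "ge e \<in> A"
      by (rule ge_in[OF e])
    show "gg e \<in> A"
      by (rule gg_in[OF e])
  qed
  then have step1: "fam_equiv {(w, 0::nat)} (\<lambda>x. gv (fst x)) (out_arcs E w) (\<lambda>e. gv (head E e))"
    unfolding fam_equiv_def by blast
  have fibre: "{e \<in> out_arcs E w. head E e = x} = {e \<in> arcs E. tail E e = w \<and> head E e = x}" for x
    by auto
  have head_sub: "head E ` out_arcs E w \<subseteq> verts E"
    by auto
  obtain h where h: "bij_betw h (out_arcs E w) (copies ?r)" "\<forall>e\<in>out_arcs E w. fst (h e) = head E e"
    using ex_bij_fibres[OF fin head_sub] unfolding fibre copies_def by (elim exE conjE)
  then have "fam_equiv (out_arcs E w) (\<lambda>e. gv (head E e)) (copies ?r) (\<lambda>x. gv (fst x))"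
    using idem by (intro fam_equiv_reindex[OF h(1)]) simp_all
  from fam_equiv_trans[OF step1 this idem_on_copies[of "\<lambda>x. if x = w then 1 else 0", unfolded copies_w]
      fin idem_on_copies]
  show ?thesis
    unfolding mult_equiv_def copies_w .
qed

text \<open>Replacing each regular \<open>w\<close> by the heads of its edges \<open>c w\<close>
  times adds \<open>N\<close> to the multiplicity of every vertex; a negative coefficient means the
  replacement in reverse.\<close>

lemma not_invariant_basis_number:
  assumes N: "N > 0"
    and eq: "\<And>x. x \<in> verts E \<Longrightarrow>
      int N = (\<Sum>w\<in>regular_verts E. c w * (int (card {e \<in> arcs E. tail E e = w \<and> head E e = x})
        - (if x = w then 1 else 0)))"
  shows "\<not> invariant_basis_number (leavitt_path_algebra K E)"
proof -
  let ?R = "regular_verts E"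
  let ?r = "\<lambda>w x. card {e \<in> arcs E. tail E e = w \<and> head E e = x}"
  let ?d = "\<lambda>w x. if x = w then 1 else (0::nat)"
  define p where "p = (\<lambda>w. nat (c w))"
  define q where "q = (\<lambda>w. nat (- c w))"
  have c: "c w = int (p w) - int (q w)" for w
    by (simp add: p_def q_def)
  have expand: "mult_equiv (\<lambda>x. \<Sum>w\<in>?R. a w * ?d w x) (\<lambda>x. \<Sum>w\<in>?R. a w * ?r w x)" for a
    by (intro mult_equiv_sum mult_equiv_times mult_equiv_expand)
  have bal: "(\<Sum>w\<in>?R. p w * ?d w x) + (\<Sum>w\<in>?R. q w * ?r w x) + N
      = (\<Sum>w\<in>?R. p w * ?r w x) + (\<Sum>w\<in>?R. q w * ?d w x)" if "x \<in> verts E" for x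
  proof -
    have "int N = (\<Sum>w\<in>?R. int (p w * ?r w x)) + (\<Sum>w\<in>?R. int (q w * ?d w x))
        - (\<Sum>w\<in>?R. int (p w * ?d w x)) - (\<Sum>w\<in>?R. int (q w * ?r w x))"
      unfolding eq[OF that] sum.distrib[symmetric] sum_subtractf[symmetric]
      by (intro sum.cong refl) (simp add: c algebra_simps)
    then show ?thesis
      unfolding of_nat_sum[symmetric] by linarith
  qed
  \<comment> \<open>Enough copies to carry out all replacements: \<open>p w + q w\<close> of each
    regular \<open>w\<close>. Expanding the \<open>q\<close> part and collapsing the expanded
    \<open>p\<close> part leads from \<open>xx + N\<close> back to \<open>xx\<close>.\<close>
  define xx where "xx = (\<lambda>x. (\<Sum>w\<in>?R. p w * ?d w x) + (\<Sum>w\<in>?R. q w * ?d w x))"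
  have "mult_equiv (\<lambda>x. xx x + N) (\<lambda>x. (\<Sum>w\<in>?R. p w * ?d w x) + (\<Sum>w\<in>?R. q w * ?r w x) + N)"
    unfolding xx_def by (intro mult_equiv_add mult_equiv_refl expand)
  also have "mult_equiv \<dots> (\<lambda>x. (\<Sum>w\<in>?R. p w * ?r w x) + (\<Sum>w\<in>?R. q w * ?d w x))"
    by (rule mult_equiv_cong) (rule bal)
  also have "mult_equiv \<dots> xx"
    unfolding xx_def by (intro mult_equiv_add mult_equiv_refl mult_equiv_sym[OF expand])
  finally have xN: "mult_equiv (\<lambda>x. xx x + N) xx" .
  \<comment> \<open>Padding by \<open>k - xx x\<close> makes both multiplicity functions constant,
    which is what free modules have; \<open>Suc\<close> keeps the rank \<open>k\<close>
    positive.\<close>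
  define k where "k = Suc (\<Sum>x\<in>verts E. xx x)"
  have le: "xx x \<le> k" if "x \<in> verts E" for x
    using member_le_sum[of x "verts E" xx] that by (simp add: k_def)
  have "mult_equiv (\<lambda>_. k + N) (\<lambda>x. (k - xx x) + (xx x + N))"
    by (rule mult_equiv_cong) (simp add: le)
  also have "mult_equiv \<dots> (\<lambda>x. (k - xx x) + xx x)"
    by (intro mult_equiv_add mult_equiv_refl xN)
  also have "mult_equiv \<dots> (\<lambda>_. k)"
    by (rule mult_equiv_cong) (simp add: le)
  finally have iso: "free_rmodule_iso quot k (k + N)"
    by (rule free_rmodule_iso_if_mult_equiv)
  show ?thesis
  proof
    assume "invariant_basis_number (leavitt_path_algebra K E)"
    then have "0 < k \<longrightarrow> 0 < k + N \<longrightarrow> free_rmodule_iso quot k (k + N) \<longrightarrow> k = k + N"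
      unfolding invariant_basis_number_def leavitt_path_algebra_eq by (elim allE)
    then show False
      using iso N by (simp add: k_def)
  qed
qed

end

section \<open>Representations by partial injections\<close>

primrec walk :: "('g \<Rightarrow> 'x \<Rightarrow> 'x option) \<Rightarrow> 'g list \<Rightarrow> 'x \<Rightarrow> 'x option" where
  "walk \<tau> [] x = Some x"
| "walk \<tau> (g # l) x = Option.bind (\<tau> g x) (walk \<tau> l)"

primrec val :: "('x \<Rightarrow> 'k::field) \<Rightarrow> 'x option \<Rightarrow> 'k" where
  "val f None = 0"
| "val f (Some x) = f x"

text \<open>Generators move points and functions are pulled back: \<open>gen g\<close> turns
  \<open>f\<close> into the function whose value at \<open>x\<close> is that of \<open>f\<close> at
  \<open>\<tau> g x\<close>, or zero where the partial map is undefined. Walking through a word from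
  the left makes this a left action, as \<open>act_mult\<close> confirms.\<close>

definition act ::
  "('g \<Rightarrow> 'x \<Rightarrow> 'x option) \<Rightarrow> ('g fword \<Rightarrow>\<^sub>0 'k::field) \<Rightarrow> ('x \<Rightarrow> 'k) \<Rightarrow> 'x \<Rightarrow> 'k" where
  "act \<tau> p f x = (\<Sum>w\<in>Poly_Mapping.keys p. Poly_Mapping.lookup p w * val f (walk \<tau> (letters w) x))"

lemma walk_append: "walk \<tau> (l @ l') x = Option.bind (walk \<tau> l x) (walk \<tau> l')"
  by (induction l arbitrary: x) (auto split: bind_split)

lemma act_superset:
  assumes "finite S" "Poly_Mapping.keys p \<subseteq> S"
  shows "act \<tau> p f x = (\<Sum>w\<in>S. Poly_Mapping.lookup p w * val f (walk \<tau> (letters w) x))"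
  unfolding act_def using assms
  by (intro sum.mono_neutral_left) (auto simp: in_keys_iff)

lemma act_add: "act \<tau> (p + q) f = act \<tau> p f + act \<tau> q f"
proof
  fix x
  let ?S = "Poly_Mapping.keys p \<union> Poly_Mapping.keys q"
  have "act \<tau> (p + q) f x = (\<Sum>w\<in>?S. Poly_Mapping.lookup (p + q) w * val f (walk \<tau> (letters w) x))"
    using keys_add[of p q] by (intro act_superset) auto
  also have "\<dots> = act \<tau> p f x + act \<tau> q f x"
    by (simp add: act_superset[of ?S] lookup_add distrib_right sum.distrib)
  finally show "act \<tau> (p + q) f x = (act \<tau> p f + act \<tau> q f) x"
    by simp
qed

lemma act_zero [simp]: "act \<tau> 0 f = 0"
  by (simp add: act_def fun_eq_iff)

lemma act_single: "act \<tau> (Poly_Mapping.single w c) f x = c * val f (walk \<tau> (letters w) x)"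
  by (simp add: act_superset[of "{w}"])

lemma act_gen: "act \<tau> (gen g) f x = val f (\<tau> g x)"
  by (cases "\<tau> g x") (simp_all add: gen_def act_single)

lemma act_sum: "act \<tau> (\<Sum>i\<in>S. p i) f = (\<Sum>i\<in>S. act \<tau> (p i) f)"
  by (induction S rule: infinite_finite_induct) (auto simp: act_add)

lemma sum_fun_apply: "(\<Sum>i\<in>S. (F i :: 'x \<Rightarrow> 'k::field)) x = (\<Sum>i\<in>S. F i x)"
  by (induction S rule: infinite_finite_induct) auto

lemma val_sum: "val (\<Sum>i\<in>S. c i) y = (\<Sum>i\<in>S. val (c i) y)"
  by (cases y) (simp_all add: sum_fun_apply)

lemma act_fun_sum: "act \<tau> p (\<Sum>i\<in>S. f i) = (\<Sum>i\<in>S. act \<tau> p (f i))"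
  by (rule ext) (simp add: act_def sum_fun_apply val_sum sum_distrib_left sum.swap[of _ S])

lemma act_fun_add: "act \<tau> p (f + g) = act \<tau> p f + act \<tau> p g"
proof -
  have "val (f + g) y = val f y + val g y" for y
    by (cases y) simp_all
  then show ?thesis
    by (simp add: act_def fun_eq_iff distrib_left sum.distrib)
qed

lemma act_fun_scale: "act \<tau> p (fscale c f) = fscale c (act \<tau> p f)"
proof -
  have "val (fscale c f) y = c * val f y" for y
    by (cases y) (simp_all add: fscale_def)
  then show ?thesis
    by (simp add: act_def fun_eq_iff fscale_def sum_distrib_left mult.left_commute)
qed

lemma val_zero [simp]: "val 0 y = 0"
  by (cases y) simp_all

lemma act_fun_zero [simp]: "act \<tau> p 0 = 0"
  by (simp add: act_def fun_eq_iff)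

lemma act_mult: "act \<tau> (p * q) f = act \<tau> p (act \<tau> q f)"
proof -
  have single: "act \<tau> (Poly_Mapping.single w c * Poly_Mapping.single w' c') f
      = act \<tau> (Poly_Mapping.single w c) (act \<tau> (Poly_Mapping.single w' c') f)" for w w' c c'
  proof
    fix x
    show "act \<tau> (Poly_Mapping.single w c * Poly_Mapping.single w' c') f x
      = act \<tau> (Poly_Mapping.single w c) (act \<tau> (Poly_Mapping.single w' c') f) x"
      by (cases "walk \<tau> (letters w) x")
        (simp_all add: mult_single act_single plus_fword_def walk_append)
  qed
  let ?p = "\<lambda>w. Poly_Mapping.single w (Poly_Mapping.lookup p w)"
  let ?q = "\<lambda>w. Poly_Mapping.single w (Poly_Mapping.lookup q w)"
  have "act \<tau> ((\<Sum>w\<in>Poly_Mapping.keys p. ?p w) * (\<Sum>w\<in>Poly_Mapping.keys q. ?q w)) f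
      = act \<tau> (\<Sum>w\<in>Poly_Mapping.keys p. ?p w) (act \<tau> (\<Sum>w\<in>Poly_Mapping.keys q. ?q w) f)"
    by (simp only: sum_product act_sum act_fun_sum single) (rule sum.swap)
  then show ?thesis
    by (simp only: poly_mapping_sum_single[symmetric])
qed

lemma act_uminus: "act \<tau> (- p) f = - act \<tau> p f"
  using act_add[of \<tau> p "- p" f] by (simp add: eq_neg_iff_add_eq_0 add.commute)

lemma act_diff: "act \<tau> (p - q) f = act \<tau> p f - act \<tau> q f"
  using act_add[of \<tau> p "- q" f] by (simp add: act_uminus)

text \<open>The function is generalised in the induction because a factor on the right changes it
  before the ideal element acts.\<close>

lemma act_algebra_ideal:
  assumes "\<And>p f. p \<in> S \<Longrightarrow> act \<tau> p f = 0" and p: "p \<in> algebra_ideal A S"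
  shows "act \<tau> p f = 0"
  using p
proof (induction arbitrary: f rule: algebra_ideal.induct)
qed (simp_all add: assms act_add act_mult)

text \<open>Two walks differ only if their first steps differ or a common first step leads to a
  point where the remaining walks differ; injectivity of that step leaves finitely many starting
  points.\<close>

lemma finite_walk_diff:
  assumes inj: "\<And>g x x' y. g \<in> X \<Longrightarrow> \<tau>1 g x = Some y \<Longrightarrow> \<tau>1 g x' = Some y \<Longrightarrow> x = x'"
    and fin: "\<And>g. g \<in> X \<Longrightarrow> finite {x. \<tau>1 g x \<noteq> \<tau>2 g x}"
    and l: "set l \<subseteq> X"
  shows "finite {x. walk \<tau>1 l x \<noteq> walk \<tau>2 l x}"
  using l
proof (induction l)
  case (Cons g l)
  let ?D = "{x. walk \<tau>1 l x \<noteq> walk \<tau>2 l x}"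
  let ?B = "{x. \<exists>y\<in>?D. \<tau>1 g x = Some y}"
  have g: "g \<in> X"
    using Cons.prems by simp
  have "inj_on (\<lambda>x. the (\<tau>1 g x)) ?B"
    using inj[OF g] by (intro inj_onI) auto
  moreover have "(\<lambda>x. the (\<tau>1 g x)) ` ?B \<subseteq> ?D"
    by auto
  moreover have "finite ?D"
    using Cons by simp
  ultimately have "finite ?B"
    by (meson finite_imageD finite_subset)
  moreover have "{x. walk \<tau>1 (g # l) x \<noteq> walk \<tau>2 (g # l) x} \<subseteq> {x. \<tau>1 g x \<noteq> \<tau>2 g x} \<union> ?B"
  proof
    fix x assume x: "x \<in> {x. walk \<tau>1 (g # l) x \<noteq> walk \<tau>2 (g # l) x}"
    show "x \<in> {x. \<tau>1 g x \<noteq> \<tau>2 g x} \<union> ?B"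
    proof (cases "\<tau>1 g x = \<tau>2 g x")
      case True
      with x obtain y where y: "\<tau>2 g x = Some y"
        by (cases "\<tau>2 g x") auto
      with x True have "y \<in> ?D"
        by simp
      with y True show ?thesis
        by auto
    qed simp
  qed
  ultimately show ?case
    using fin[OF g] by (meson finite_UnI finite_subset)
qed simp

text \<open>For each word of \<open>p\<close> only finitely many starting points see a difference.
  The set consists of the end points of both walks from there: if \<open>f\<close> vanishes on them,
  both walks contribute zero.\<close>

lemma act_eq_cofinite:
  fixes p :: "'g fword \<Rightarrow>\<^sub>0 'k::field" and \<tau>1 :: "'g \<Rightarrow> 'x \<Rightarrow> 'x option"
  assumes inj: "\<And>g x x' y. g \<in> X \<Longrightarrow> \<tau>1 g x = Some y \<Longrightarrow> \<tau>1 g x' = Some y \<Longrightarrow> x = x'"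
    and fin: "\<And>g. g \<in> X \<Longrightarrow> finite {x. \<tau>1 g x \<noteq> \<tau>2 g x}"
    and p: "p \<in> free_algebra X"
  shows "\<exists>F. finite F \<and> (\<forall>f. (\<forall>x\<in>F. f x = 0) \<longrightarrow> act \<tau>1 p f = act \<tau>2 p f)"
proof (intro exI conjI allI impI)
  let ?D = "\<lambda>w. {x. walk \<tau>1 (letters w) x \<noteq> walk \<tau>2 (letters w) x}"
  let ?F = "\<Union>w\<in>Poly_Mapping.keys p. \<Union>x\<in>?D w.
    set_option (walk \<tau>1 (letters w) x) \<union> set_option (walk \<tau>2 (letters w) x)"
  have "finite (?D w)" if "w \<in> Poly_Mapping.keys p" for w
    using p that by (intro finite_walk_diff[OF inj fin]) (auto simp: free_algebra_def)
  then show "finite ?F"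
    by (intro finite_UN_I finite_UnI finite_keys) auto
  fix f :: "'x \<Rightarrow> 'k" assume f: "\<forall>x\<in>?F. f x = 0"
  have "val f (walk \<tau>1 (letters w) x) = val f (walk \<tau>2 (letters w) x)"
    if w: "w \<in> Poly_Mapping.keys p" for w x
  proof (cases "x \<in> ?D w")
    case True
    have "f y = 0" if "y \<in> set_option (walk \<tau>1 (letters w) x) \<union> set_option (walk \<tau>2 (letters w) x)" for y
      using f w True that by blast
    then have "val f (walk \<tau>1 (letters w) x) = 0 \<and> val f (walk \<tau>2 (letters w) x) = 0"
      by (cases "walk \<tau>1 (letters w) x"; cases "walk \<tau>2 (letters w) x") simp_all
    then show ?thesis
      by simp
  qed simp
  then show "act \<tau>1 p f = act \<tau>2 p f"
    by (simp add: act_def fun_eq_iff)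
qed

text \<open>The action of an \<open>n\<close> by \<open>m\<close> matrix on \<open>m\<close>-tuples
  of functions. A tuple is stored as one function on pairs, so that the relative dimension count,
  which is about single functions, applies to it; components from \<open>n\<close> on are set to
  zero.\<close>

definition mact ::
  "('g \<Rightarrow> 'x \<Rightarrow> 'x option) \<Rightarrow> nat \<Rightarrow> nat \<Rightarrow> (nat \<Rightarrow> nat \<Rightarrow> ('g fword \<Rightarrow>\<^sub>0 'k::field))
    \<Rightarrow> (nat \<times> 'x \<Rightarrow> 'k) \<Rightarrow> nat \<times> 'x \<Rightarrow> 'k" where
  "mact \<tau> n m P f = (\<lambda>(i, x). if i < n then \<Sum>j<m. act \<tau> (P i j) (\<lambda>y. f (j, y)) x else 0)"

lemma flinear_mact:
  fixes P :: "nat \<Rightarrow> nat \<Rightarrow> ('g fword \<Rightarrow>\<^sub>0 'k::field)" and \<tau> :: "'g \<Rightarrow> 'x \<Rightarrow> 'x option"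
  shows "flinear (mact \<tau> n m P)"
proof (rule flinearI)
  fix f g :: "nat \<times> 'x \<Rightarrow> 'k"
  have "(\<lambda>y. (f + g) (j, y)) = (\<lambda>y. f (j, y)) + (\<lambda>y. g (j, y))" for j
    by (simp add: fun_eq_iff)
  then show "mact \<tau> n m P (f + g) = mact \<tau> n m P f + mact \<tau> n m P g"
    by (intro ext) (simp add: mact_def act_fun_add sum.distrib split: prod.split)
next
  fix c and f :: "nat \<times> 'x \<Rightarrow> 'k"
  have "(\<lambda>y. fscale c f (j, y)) = fscale c (\<lambda>y. f (j, y))" for j
    by (simp add: fscale_def fun_eq_iff)
  then have "mact \<tau> n m P (fscale c f) (i, x) = fscale c (mact \<tau> n m P f) (i, x)" for i x
    by (simp add: mact_def act_fun_scale) (simp add: fscale_def sum_distrib_left)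
  then show "mact \<tau> n m P (fscale c f) = fscale c (mact \<tau> n m P f)"
    by auto
qed

text \<open>The diagonal acts as \<open>restr Y\<close> because the identity of the algebra acts as
  restriction to the points in use, not as the identity map; on functions supported there the
  difference disappears.\<close>

lemma mact_mact:
  assumes PQ: "\<And>i i' f. i < n \<Longrightarrow> i' < n \<Longrightarrow>
      act \<tau> (\<Sum>j<m. P i j * Q j i') f = (if i = i' then restr Y f else 0)"
    and f: "f \<in> supp_on ({..<n} \<times> Y)"
  shows "mact \<tau> n m P (mact \<tau> m n Q f) = f"
proof
  fix ix :: "nat \<times> 'a"
  obtain i x where ix: "ix = (i, x)"
    by fastforce
  show "mact \<tau> n m P (mact \<tau> m n Q f) ix = f ix"
  proof (cases "i < n")
    case True
    let ?f = "\<lambda>i y. f (i, y)"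
    have "(\<lambda>y. mact \<tau> m n Q f (j, y)) = (\<Sum>i'<n. act \<tau> (Q j i') (?f i'))" if "j < m" for j
      using that by (simp add: mact_def fun_eq_iff sum_fun_apply)
    then have "mact \<tau> n m P (mact \<tau> m n Q f) (i, x)
        = (\<Sum>j<m. act \<tau> (P i j) (\<Sum>i'<n. act \<tau> (Q j i') (?f i')) x)"
      using True unfolding mact_def[of \<tau> n m P] by simp
    also have "\<dots> = (\<Sum>j<m. \<Sum>i'<n. act \<tau> (P i j * Q j i') (?f i') x)"
      by (simp only: act_fun_sum act_mult sum_fun_apply)
    also have "\<dots> = (\<Sum>i'<n. \<Sum>j<m. act \<tau> (P i j * Q j i') (?f i') x)"
      by (rule sum.swap)
    also have "\<dots> = (\<Sum>i'<n. act \<tau> (\<Sum>j<m. P i j * Q j i') (?f i') x)"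
      by (simp only: act_sum sum_fun_apply)
    also have "\<dots> = (\<Sum>i'<n. if i = i' then restr Y (?f i) x else 0)"
      using True by (intro sum.cong refl) (simp add: PQ)
    also have "\<dots> = restr Y (?f i) x"
      using True by simp
    also have "\<dots> = f (i, x)"
      using f by (auto simp: restr_def supp_on_def)
    finally show ?thesis
      by (simp add: ix)
  next
    case False
    then show ?thesis
      using f by (simp add: ix mact_def supp_on_def)
  qed
qed

lemma mact_in_supp_on:
  assumes "\<And>i j f x. i < n \<Longrightarrow> j < m \<Longrightarrow> x \<notin> Y \<Longrightarrow> act \<tau> (P i j) f x = 0"
  shows "mact \<tau> n m P f \<in> supp_on ({..<n} \<times> Y)"
  using assms by (auto simp: supp_on_def mact_def)

text \<open>\<open>T\<close> is chosen to make the remainders match: below \<open>M\<close> there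
  are \<open>M - \<alpha> e\<close> pairs for each \<open>e\<close>, and from \<open>c\<close> up to
  \<open>T\<close> equally many numbers. Any bijection between these finite sets completes
  \<open>g\<close>.\<close>

lemma ex_bij_extend:
  fixes \<alpha> :: "'e \<Rightarrow> nat"
  assumes D: "finite D" and \<alpha>: "\<And>e. e \<in> D \<Longrightarrow> \<alpha> e \<le> M"
    and T: "T = c + (\<Sum>e\<in>D. M - \<alpha> e)" and g: "bij_betw g (D \<times> {M..}) {T..}"
  shows "\<exists>G. bij_betw G (Sigma D (\<lambda>e. {\<alpha> e..})) {c..} \<and> (\<forall>e\<in>D. \<forall>k\<ge>M. G (e, k) = g (e, k))"
proof -
  let ?B = "Sigma D (\<lambda>e. {\<alpha> e..<M})"
  have "finite ?B" "card ?B = card {c..<T}"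
    using D by (simp_all add: T)
  then obtain b where b: "bij_betw b ?B {c..<T}"
    using finite_same_card_bij by blast
  define G where "G = (\<lambda>x. if M \<le> snd x then g x else b x)"
  have "bij_betw G (D \<times> {M..}) {T..}"
    using g by (subst bij_betw_cong[of _ _ g]) (auto simp: G_def)
  moreover have "bij_betw G ?B {c..<T}"
    using b by (subst bij_betw_cong[of _ _ b]) (auto simp: G_def)
  ultimately have "bij_betw G (D \<times> {M..} \<union> ?B) ({T..} \<union> {c..<T})"
    by (rule bij_betw_combine) auto
  moreover have "D \<times> {M..} \<union> ?B = Sigma D (\<lambda>e. {\<alpha> e..})"
  proof (intro subset_antisym subsetI)
    fix x assume "x \<in> D \<times> {M..} \<union> ?B"
    then show "x \<in> Sigma D (\<lambda>e. {\<alpha> e..})"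
      using \<alpha> by (cases x) (auto intro: order_trans)
  qed (auto simp: not_le)
  moreover have "{T..} \<union> {c..<T} = {c..}"
    by (auto simp: T)
  ultimately show ?thesis
    by (intro exI[of _ G]) (auto simp: G_def)
qed

lemma ex_bij_infinite_nat:
  fixes D :: "'e set" and M T :: nat
  assumes "finite D" "D \<noteq> {}"
  shows "\<exists>g. bij_betw g (D \<times> {M..}) {T..}"
proof -
  have fin: "countable (D \<times> {M..})" "infinite (D \<times> {M..})" "countable {T..}" "infinite {T..}"
    using assms by (auto simp: finite_cartesian_product_iff countable_finite infinite_Ici)
  have "bij_betw (from_nat_into {T..} \<circ> to_nat_on (D \<times> {M..})) (D \<times> {M..}) {T..}"
    using fin by (intro bij_betw_trans[of _ _ UNIV] to_nat_on_infinite bij_betw_from_nat_into)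
  then show ?thesis
    by blast
qed

section \<open>Branching systems: partial injections that satisfy the defining relations\<close>

context lpa
begin

text \<open>An algebraic branching system: the set over a regular \<open>w\<close> is the disjoint
  union of copies of the sets over the heads of its edges, the set-level form of the relation at
  \<open>w\<close>. The set over a vertex is a final segment of the naturals, coded by its least
  element \<open>a w\<close>.\<close>

definition branching :: "('v \<Rightarrow> nat) \<Rightarrow> ('e \<Rightarrow> nat \<Rightarrow> nat) \<Rightarrow> bool" where
  "branching a G \<longleftrightarrow> (\<forall>w\<in>regular_verts E.
     bij_betw (\<lambda>(e, k). G e k) (Sigma (out_arcs E w) (\<lambda>e. {a (head E e)..})) {a w..})"

text \<open>Points move opposite to functions: an edge has to turn functions over its head into
  functions over its tail, so on points it goes from tail to head and inverts \<open>G e\<close>,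
  while its ghost applies \<open>G e\<close>.\<close>

primrec br_map :: "('v \<Rightarrow> nat) \<Rightarrow> ('e \<Rightarrow> nat \<Rightarrow> nat) \<Rightarrow> ('v, 'e) lpa_gen \<Rightarrow> 'v \<times> nat \<Rightarrow> ('v \<times> nat) option" where
  "br_map a G (Vertex w) x = (if fst x = w \<and> a w \<le> snd x then Some x else None)"
| "br_map a G (Edge e) x = (if fst x = tail E e \<and> (\<exists>j\<ge>a (head E e). G e j = snd x)
     then Some (head E e, THE j. a (head E e) \<le> j \<and> G e j = snd x) else None)"
| "br_map a G (Ghost e) x = (if fst x = head E e \<and> a (head E e) \<le> snd x
     then Some (tail E e, G e (snd x)) else None)"

definition br_set :: "('v \<Rightarrow> nat) \<Rightarrow> ('v \<times> nat) set" where
  "br_set a = Sigma (verts E) (\<lambda>w. {a w..})"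

lemma tail_regular: "e \<in> arcs E \<Longrightarrow> tail E e \<in> regular_verts E"
  by (auto simp: regular_verts_def)

lemma branching_ge:
  assumes "branching a G" "e \<in> arcs E" "a (head E e) \<le> j"
  shows "a (tail E e) \<le> G e j"
proof -
  have "bij_betw (\<lambda>(e, k). G e k) (Sigma (out_arcs E (tail E e)) (\<lambda>e. {a (head E e)..})) {a (tail E e)..}"
    using assms(1) tail_regular[OF assms(2)] by (simp add: branching_def)
  from bij_betw_apply[OF this, of "(e, j)"] show ?thesis
    using assms by simp
qed

lemma branching_inj:
  assumes "branching a G" "e \<in> arcs E" "f \<in> arcs E" "tail E e = tail E f"
    "a (head E e) \<le> j" "a (head E f) \<le> k" "G e j = G f k"
  shows "e = f \<and> j = k"
proof -
  have "inj_on (\<lambda>(e, k). G e k) (Sigma (out_arcs E (tail E e)) (\<lambda>e. {a (head E e)..}))"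
    using assms(1) tail_regular[OF assms(2)] by (simp add: branching_def bij_betw_def)
  from inj_onD[OF this, of "(e, j)" "(f, k)"] show ?thesis
    using assms by simp
qed

lemma branching_surj:
  assumes "branching a G" "w \<in> regular_verts E" "a w \<le> k"
  obtains e j where "e \<in> out_arcs E w" "a (head E e) \<le> j" "G e j = k"
proof -
  have "bij_betw (\<lambda>(e, k). G e k) (Sigma (out_arcs E w) (\<lambda>e. {a (head E e)..})) {a w..}"
    using assms by (simp add: branching_def)
  then have "k \<in> (\<lambda>(e, k). G e k) ` (Sigma (out_arcs E w) (\<lambda>e. {a (head E e)..}))"
    using assms(3) by (simp add: bij_betw_def)
  then show ?thesis
    using that by auto
qed

text \<open>Injectivity of the branching makes the level picked by \<open>THE\<close> unique; this
  description lets the later arguments leave \<open>br_map\<close> folded.\<close>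

lemma br_map_Edge_iff:
  assumes "branching a G" "e \<in> arcs E"
  shows "br_map a G (Edge e) x = Some y \<longleftrightarrow>
    (\<exists>j\<ge>a (head E e). x = (tail E e, G e j) \<and> y = (head E e, j))"
proof -
  have the: "(THE k. a (head E e) \<le> k \<and> G e k = G e j) = j" if "a (head E e) \<le> j" for j
    using that branching_inj[OF assms assms(2) refl] by (intro the_equality) blast+
  show ?thesis
    by (cases x) (auto simp: the)
qed

lemma br_map_Ghost_iff:
  "br_map a G (Ghost e) x = Some y \<longleftrightarrow>
    (\<exists>j\<ge>a (head E e). x = (head E e, j) \<and> y = (tail E e, G e j))"
  by (cases x) auto

lemma br_map_inj:
  assumes "branching a G" "g \<in> lpa_gens E"
    and x: "br_map a G g x = Some y" and x': "br_map a G g x' = Some y"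
  shows "x = x'"
proof -
  consider w where "g = Vertex w" | e where "g = Edge e" "e \<in> arcs E" | e where "g = Ghost e" "e \<in> arcs E"
    using assms(2) by (auto simp: lpa_gens_def)
  then show ?thesis
  proof cases
    case 1
    then show ?thesis
      using x x' by (simp split: if_splits)
  next
    case 2
    then show ?thesis
      using x x' by (auto simp del: br_map.simps simp: br_map_Edge_iff[OF assms(1)])
  next
    case 3
    then show ?thesis
      using x x' branching_inj[OF assms(1) 3(2) 3(2) refl]
      by (auto simp del: br_map.simps simp: br_map_Ghost_iff)
  qed
qed

lemma act_gen_gen: "act \<tau> (gen g * gen h) f x = val f (Option.bind (\<tau> g x) \<tau>h)"
  if "\<tau>h = \<tau> h" for \<tau>h
  using that by (cases "\<tau> g x") (simp_all add: act_mult act_gen)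

text \<open>All relations but the last reduce to identities between partial maps. Images of
  different edges with the same tail are disjoint, which gives the relation between ghosts and
  edges; that they also cover the set over a regular vertex gives the last one.\<close>

lemma br_map_rels:
  assumes br: "branching a G" and p: "p \<in> lpa_rels E"
  shows "act (br_map a G) p f = 0"
proof -
  let ?\<tau> = "br_map a G"
  have bind_eq: "act ?\<tau> (gen g * gen h) f = act ?\<tau> (gen g') f"
    if "\<And>x. Option.bind (?\<tau> g x) (?\<tau> h) = ?\<tau> g' x" for g h g'
    by (rule ext) (simp only: act_gen_gen[OF refl] act_gen that)
  have bind_None: "act ?\<tau> (gen g * gen h) f = 0"
    if "\<And>x. Option.bind (?\<tau> g x) (?\<tau> h) = None" for g h
    by (rule ext) (simp only: act_gen_gen[OF refl] that val.simps zero_fun_apply)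
  consider
    (vv) v w where "p = gen (Vertex v) * gen (Vertex w) - (if v = w then gen (Vertex w) else 0)"
  | (te) e where "e \<in> arcs E" "p = gen (Vertex (tail E e)) * gen (Edge e) - gen (Edge e)"
  | (eh) e where "e \<in> arcs E" "p = gen (Edge e) * gen (Vertex (head E e)) - gen (Edge e)"
  | (hg) e where "e \<in> arcs E" "p = gen (Vertex (head E e)) * gen (Ghost e) - gen (Ghost e)"
  | (gt) e where "e \<in> arcs E" "p = gen (Ghost e) * gen (Vertex (tail E e)) - gen (Ghost e)"
  | (gf) e f where "e \<in> arcs E" "f \<in> arcs E"
      "p = gen (Ghost e) * gen (Edge f) - (if e = f then gen (Vertex (head E e)) else 0)"
  | (reg) w where "w \<in> regular_verts E"
      "p = gen (Vertex w) - (\<Sum>e\<in>out_arcs E w. gen (Edge e) * gen (Ghost e))"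
    using p unfolding lpa_rels_def by blast
  then show ?thesis
  proof cases
    case vv
    show ?thesis
    proof (cases "v = w")
      case True
      have "act ?\<tau> (gen (Vertex w) * gen (Vertex w)) f = act ?\<tau> (gen (Vertex w)) f"
        by (rule bind_eq) simp
      then show ?thesis
        using vv True by (simp add: act_diff)
    next
      case False
      have "act ?\<tau> (gen (Vertex v) * gen (Vertex w)) f = 0"
        using False by (intro bind_None) simp
      then show ?thesis
        using vv False by simp
    qed
  next
    case te
    have "Option.bind (?\<tau> (Vertex (tail E e)) x) (?\<tau> (Edge e)) = ?\<tau> (Edge e) x" for x
    proof (cases "?\<tau> (Edge e) x")
      case (Some y)
      then have "?\<tau> (Vertex (tail E e)) x = Some x"
        using branching_ge[OF br te(1)] unfolding br_map_Edge_iff[OF br te(1)] by auto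
      then show ?thesis
        by (simp del: br_map.simps)
    qed (simp add: bind_eq_None_conv split: if_splits)
    then show ?thesis
      using te bind_eq by (simp add: act_diff del: br_map.simps)
  next
    case eh
    have "Option.bind (?\<tau> (Edge e) x) (?\<tau> (Vertex (head E e))) = ?\<tau> (Edge e) x" for x
    proof (cases "?\<tau> (Edge e) x")
      case (Some y)
      then have "?\<tau> (Vertex (head E e)) y = Some y"
        unfolding br_map_Edge_iff[OF br eh(1)] by auto
      then show ?thesis
        using Some by (simp del: br_map.simps)
    qed simp
    then show ?thesis
      using eh bind_eq by (simp add: act_diff del: br_map.simps)
  next
    case hg
    have "Option.bind (?\<tau> (Vertex (head E e)) x) (?\<tau> (Ghost e)) = ?\<tau> (Ghost e) x" for x
      by simp
    then show ?thesis
      using hg bind_eq by (simp add: act_diff del: br_map.simps)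
  next
    case gt
    have "Option.bind (?\<tau> (Ghost e) x) (?\<tau> (Vertex (tail E e))) = ?\<tau> (Ghost e) x" for x
      using branching_ge[OF br gt(1)] by simp
    then show ?thesis
      using gt bind_eq by (simp add: act_diff del: br_map.simps)
  next
    case gf
    show ?thesis
    proof (cases "e = f")
      case True
      have "Option.bind (?\<tau> (Ghost e) x) (?\<tau> (Edge e)) = ?\<tau> (Vertex (head E e)) x" for x
      proof (cases "?\<tau> (Ghost e) x")
        case None
        then show ?thesis
          by (simp split: if_splits)
      next
        case (Some y)
        then obtain j where j: "a (head E e) \<le> j" "x = (head E e, j)" "y = (tail E e, G e j)"
          unfolding br_map_Ghost_iff by blast
        then have "?\<tau> (Edge e) y = Some x"
          unfolding br_map_Edge_iff[OF br gf(1)] by blast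
        then show ?thesis
          using Some j by (simp del: br_map.simps(2,3))
      qed
      then show ?thesis
        using gf True bind_eq by (simp add: act_diff del: br_map.simps)
    next
      case False
      have "Option.bind (?\<tau> (Ghost e) x) (?\<tau> (Edge f)) = None" for x
      proof (rule ccontr)
        assume "Option.bind (?\<tau> (Ghost e) x) (?\<tau> (Edge f)) \<noteq> None"
        then obtain y z where y: "?\<tau> (Ghost e) x = Some y" and z: "?\<tau> (Edge f) y = Some z"
          by (auto simp: bind_eq_None_conv simp del: br_map.simps)
        from y obtain j where j: "a (head E e) \<le> j" "y = (tail E e, G e j)"
          unfolding br_map_Ghost_iff by blast
        from z obtain k where k: "a (head E f) \<le> k" "y = (tail E f, G f k)"
          unfolding br_map_Edge_iff[OF br gf(2)] by blast
        show False
          using branching_inj[OF br gf(1,2) _ j(1) k(1)] j k False by simp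
      qed
      then show ?thesis
        using gf False bind_None by (simp del: br_map.simps)
    qed
  next
    case reg
    have "act ?\<tau> (gen (Vertex w)) f x = (\<Sum>e\<in>out_arcs E w. act ?\<tau> (gen (Edge e) * gen (Ghost e)) f x)" for x
    proof (cases "fst x = w \<and> a w \<le> snd x")
      \<comment> \<open>Exactly one edge \<open>e\<close> and level \<open>j\<close> reach
        \<open>x\<close>, so a single summand survives, and it returns \<open>f x\<close>.\<close>
      case True
      then obtain e j where e: "e \<in> out_arcs E w" "a (head E e) \<le> j" "G e j = snd x"
        using branching_surj[OF br reg(1)] by metis
      then have x: "x = (tail E e, G e j)"
        using True by (cases x) auto
      have bind: "Option.bind (?\<tau> (Edge e') x) (?\<tau> (Ghost e')) = (if e' = e then Some x else None)"
        if e': "e' \<in> out_arcs E w" for e'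
      proof (cases "?\<tau> (Edge e') x")
        case None
        have "?\<tau> (Edge e) x = Some (head E e, j)"
          using e x by (subst br_map_Edge_iff[OF br]) auto
        then have "e' \<noteq> e"
          using None by auto
        then show ?thesis
          using None by (simp del: br_map.simps)
      next
        case (Some y)
        then obtain k where k: "a (head E e') \<le> k" "x = (tail E e', G e' k)" "y = (head E e', k)"
          using e' by (subst (asm) br_map_Edge_iff[OF br]) auto
        have "e' = e \<and> k = j"
          using branching_inj[OF br _ _ _ k(1) e(2)] e' e(1) k(2) x by simp
        then show ?thesis
          using Some k by (simp del: br_map.simps(2))
      qed
      have "(\<Sum>e'\<in>out_arcs E w. act ?\<tau> (gen (Edge e') * gen (Ghost e')) f x)
          = (\<Sum>e'\<in>out_arcs E w. if e' = e then f x else 0)"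
        by (intro sum.cong refl) (simp add: act_gen_gen[OF refl] bind del: br_map.simps)
      also have "\<dots> = f x"
        using sum.delta[of "out_arcs E w" e "\<lambda>_. f x"] e(1) reg(1) by (simp add: regular_verts_def)
      finally show ?thesis
        using True by (simp add: act_gen)
    next
      case False
      have "act ?\<tau> (gen (Edge e) * gen (Ghost e)) f x = 0" if e: "e \<in> out_arcs E w" for e
      proof -
        have "?\<tau> (Edge e) x = None"
        proof (rule ccontr)
          assume "?\<tau> (Edge e) x \<noteq> None"
          then obtain y where "?\<tau> (Edge e) x = Some y"
            by blast
          then obtain j where "a (head E e) \<le> j" "x = (tail E e, G e j)"
            using e by (subst (asm) br_map_Edge_iff[OF br]) auto
          then show False
            using branching_ge[OF br, of e j] e False by simp
        qed
        then show ?thesis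
          by (simp add: act_gen_gen[OF refl] del: br_map.simps)
      qed
      then show ?thesis
        using False by (auto simp: act_gen)
    qed
    then show ?thesis
      using reg(2) by (simp add: act_diff act_sum fun_eq_iff sum_fun_apply)
  qed
qed

lemma act_cong_eqv:
  assumes "branching a G" "eqv p q"
  shows "act (br_map a G) p f = act (br_map a G) q f"
proof -
  have "act (br_map a G) (p - q) f = 0"
    using br_map_rels[OF assms(1)] assms(2)[unfolded eqv_def] by (rule act_algebra_ideal)
  then show ?thesis
    by (simp add: act_diff)
qed

lemma act_u: "act (br_map a G) u f = restr (br_set a) f"
proof
  fix x
  have "act (br_map a G) u f x = (\<Sum>w\<in>verts E. if fst x = w then (if a w \<le> snd x then f x else 0) else 0)"
    unfolding act_sum sum_fun_apply act_gen by (intro sum.cong refl) simp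
  also have "\<dots> = restr (br_set a) f x"
    by (cases x) (auto simp: restr_def br_set_def)
  finally show "act (br_map a G) u f x = restr (br_set a) f x" .
qed

text \<open>Modulo the ideal \<open>p\<close> equals \<open>u * p\<close>, and \<open>u\<close> acts
  as restriction to the set of points.\<close>

lemma act_outside:
  assumes "branching a G" "p \<in> A" "x \<notin> br_set a"
  shows "act (br_map a G) p f x = 0"
proof -
  have "act (br_map a G) p f x = act (br_map a G) (u * p) f x"
    by (rule fun_cong[OF act_cong_eqv[OF assms(1) eqv_sym[OF eqv_u_left[OF assms(2)]]]])
  then show ?thesis
    using assms(3) unfolding act_mult act_u by (simp add: restr_def)
qed

lemma br_map_eq_some:
  assumes br: "branching a G" "branching b H" and e: "e \<in> arcs E"
    and M: "b (head E e) \<le> M" and GH: "\<And>k. M \<le> k \<Longrightarrow> G e k = H e k"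
    and x: "br_map a G (Edge e) x = Some y" and notin: "x \<notin> {tail E e} \<times> G e ` {..<M}"
  shows "br_map b H (Edge e) x = Some y"
proof -
  obtain j where j: "a (head E e) \<le> j" "x = (tail E e, G e j)" "y = (head E e, j)"
    using x unfolding br_map_Edge_iff[OF br(1) e] by blast
  then have "M \<le> j"
    using notin by (auto simp: not_less[symmetric])
  then have "b (head E e) \<le> j \<and> x = (tail E e, H e j) \<and> y = (head E e, j)"
    using M GH j by auto
  then show ?thesis
    unfolding br_map_Edge_iff[OF br(2) e] by blast
qed

text \<open>From level \<open>M\<close> on both systems contain every level and use the same maps,
  so a difference involves a level below \<open>M\<close> or, for an edge, the image of such a level
  under \<open>G e\<close> or \<open>H e\<close>.\<close>

lemma finite_br_map_diff:
  assumes br: "branching a G" "branching b H" and g: "g \<in> lpa_gens E"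
    and M: "\<And>w. w \<in> verts E \<Longrightarrow> a w \<le> M" "\<And>w. w \<in> verts E \<Longrightarrow> b w \<le> M"
    and GH: "\<And>e k. e \<in> arcs E \<Longrightarrow> M \<le> k \<Longrightarrow> G e k = H e k"
  shows "finite {x. br_map a G g x \<noteq> br_map b H g x}"
proof -
  consider w where "g = Vertex w" "w \<in> verts E" | e where "g = Edge e" "e \<in> arcs E"
    | e where "g = Ghost e" "e \<in> arcs E"
    using g by (auto simp: lpa_gens_def)
  then show ?thesis
  proof cases
    case 1
    have "{x. br_map a G g x \<noteq> br_map b H g x} \<subseteq> {w} \<times> {..<M}"
    proof
      fix x assume x: "x \<in> {x. br_map a G g x \<noteq> br_map b H g x}"
      then have "fst x = w" "\<not> (M \<le> snd x)"
        using 1 M[of w] by (auto split: if_splits)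
      then show "x \<in> {w} \<times> {..<M}"
        by (cases x) auto
    qed
    then show ?thesis
      by (rule finite_subset) simp
  next
    case 2
    have hd: "a (head E e) \<le> M" "b (head E e) \<le> M"
      using M 2 by simp_all
    have "{x. br_map a G g x \<noteq> br_map b H g x}
        \<subseteq> {tail E e} \<times> G e ` {..<M} \<union> {tail E e} \<times> H e ` {..<M}"
    proof (rule subsetI, rule ccontr)
      fix x assume x: "x \<in> {x. br_map a G g x \<noteq> br_map b H g x}"
        and notin: "x \<notin> {tail E e} \<times> G e ` {..<M} \<union> {tail E e} \<times> H e ` {..<M}"
      have "br_map a G (Edge e) x = Some y \<longleftrightarrow> br_map b H (Edge e) x = Some y" for y
      proof
        assume "br_map a G (Edge e) x = Some y"
        from br_map_eq_some[OF br 2(2) hd(2) GH[OF 2(2)] this] notin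
        show "br_map b H (Edge e) x = Some y"
          by blast
      next
        assume "br_map b H (Edge e) x = Some y"
        from br_map_eq_some[OF br(2,1) 2(2) hd(1) GH[OF 2(2), symmetric] this] notin
        show "br_map a G (Edge e) x = Some y"
          by blast
      qed
      then have "br_map a G (Edge e) x = br_map b H (Edge e) x"
        by (metis not_None_eq)
      then show False
        using x 2 by simp
    qed
    then show ?thesis
      by (rule finite_subset) simp
  next
    case 3
    have hd: "a (head E e) \<le> M" "b (head E e) \<le> M"
      using M 3 by simp_all
    have "{x. br_map a G g x \<noteq> br_map b H g x} \<subseteq> {head E e} \<times> {..<M}"
    proof
      fix x assume x: "x \<in> {x. br_map a G g x \<noteq> br_map b H g x}"
      have "fst x = head E e"
        using x 3 by (auto split: if_splits)
      moreover have "\<not> M \<le> snd x"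
      proof
        assume "M \<le> snd x"
        then show False
          using x 3 hd GH[OF 3(2), of "snd x"] by (auto split: if_splits)
      qed
      ultimately show "x \<in> {head E e} \<times> {..<M}"
        by (cases x) auto
    qed
    then show ?thesis
      by (rule finite_subset) simp
  qed
qed

lemma br_set_diff: "br_set a - br_set b = Sigma (verts E) (\<lambda>w. {a w..<b w})"
  by (auto simp: br_set_def)

lemma card_br_set_diff: "card (br_set a - br_set b) = (\<Sum>w\<in>verts E. b w - a w)"
  by (simp add: br_set_diff)

lemma branching_pair_imp_eq:
  assumes br: "branching a G" "branching b H"
    and M: "\<And>w. w \<in> verts E \<Longrightarrow> a w \<le> M" "\<And>w. w \<in> verts E \<Longrightarrow> b w \<le> M"
    and GH: "\<And>e k. e \<in> arcs E \<Longrightarrow> M \<le> k \<Longrightarrow> G e k = H e k"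
    and ne: "(\<Sum>w\<in>verts E. int (a w) - int (b w)) \<noteq> 0"
    and iso: "free_rmodule_iso quot m n"
  shows "m = n"
proof -
  obtain P Q where inv: "inverse_matrices {..<n} (\<lambda>_. u) {..<m} (\<lambda>_. u) P Q"
    using free_rmodule_iso_quotE[OF iso] .
  note D = inverse_matricesD[OF inv]
  let ?\<tau>1 = "br_map a G" and ?\<tau>2 = "br_map b H"
  let ?X1 = "br_set a" and ?X2 = "br_set b"
  have PA: "i < n \<Longrightarrow> j < m \<Longrightarrow> P i j \<in> A" and QA: "j < m \<Longrightarrow> i < n \<Longrightarrow> Q j i \<in> A" for i j
    using D(1)[of i j] D(2)[of j i] by simp_all
  have PQ: "act (br_map c L) (\<Sum>j<m. P i j * Q j i') f = (if i = i' then restr (br_set c) f else 0)"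
    if "branching c L" "i < n" "i' < n" for c L i i' f
    using act_cong_eqv[OF that(1) D(3)[of i i'], of f] that by (simp add: act_u)
  have QP: "act (br_map c L) (\<Sum>i<n. Q j i * P i j') f = (if j = j' then restr (br_set c) f else 0)"
    if "branching c L" "j < m" "j' < m" for c L j j' f
    using act_cong_eqv[OF that(1) D(4)[of j j'], of f] that by (simp add: act_u)
  have exF: "\<exists>F. finite F \<and> (\<forall>f. (\<forall>x\<in>F. f x = 0) \<longrightarrow> act ?\<tau>1 p f = act ?\<tau>2 p f)"
    if "p \<in> A" for p
  proof (rule act_eq_cofinite[OF _ _ that])
    show "x = x'" if "g \<in> lpa_gens E" "?\<tau>1 g x = Some y" "?\<tau>1 g x' = Some y" for g x x' y
      using br(1) that by (rule br_map_inj)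
    show "finite {x. ?\<tau>1 g x \<noteq> ?\<tau>2 g x}" if "g \<in> lpa_gens E" for g
      using br that M GH by (rule finite_br_map_diff)
  qed
  define F where "F = (\<lambda>p :: ('v, 'e) lpa_gen fword \<Rightarrow>\<^sub>0 'k. SOME F. finite F \<and> (\<forall>f. (\<forall>x\<in>F. f x = 0) \<longrightarrow> act ?\<tau>1 p f = act ?\<tau>2 p f))"
  have F_all: "finite (F p) \<and> (\<forall>f. (\<forall>x\<in>F p. f x = 0) \<longrightarrow> act ?\<tau>1 p f = act ?\<tau>2 p f)" if "p \<in> A" for p
    unfolding F_def by (rule someI_ex[OF exF[OF that]])
  \<comment> \<open>Each of the finitely many matrix entries contributes a finite exceptional set,
    repeated in all \<open>m\<close> input components.\<close>
  define F' where "F' = {..<m} \<times> (\<Union>i<n. \<Union>j<m. F (P i j))"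
  have finF': "finite F'"
    unfolding F'_def using F_all[OF PA]
    by (intro finite_cartesian_product finite_UN_I finite_lessThan) simp_all
  have agree: "mact ?\<tau>1 n m P f = mact ?\<tau>2 n m P f" if f: "\<forall>y\<in>F'. f y = 0" for f
  proof (rule ext, clarify)
    fix i x
    have "act ?\<tau>1 (P i j) (\<lambda>y. f (j, y)) = act ?\<tau>2 (P i j) (\<lambda>y. f (j, y))" if "i < n" "j < m" for j
    proof -
      have "\<forall>x\<in>F (P i j). f (j, x) = 0"
        using that f by (force simp: F'_def)
      then show ?thesis
        using F_all[OF PA[OF that]] by simp
    qed
    then show "mact ?\<tau>1 n m P f (i, x) = mact ?\<tau>2 n m P f (i, x)"
      by (simp add: mact_def)
  qed
  have diff: "{..<k::nat} \<times> br_set c - {..<k} \<times> br_set d = {..<k} \<times> (br_set c - br_set d)" for k c d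
    by auto
  have findiff: "finite ({..<k::nat} \<times> br_set c - {..<k} \<times> br_set d)" for k c d
    unfolding diff br_set_diff by simp
  \<comment> \<open>On either side \<open>P\<close> and \<open>Q\<close> act as inverse maps between
    \<open>m\<close> and \<open>n\<close> copies of the point set. The agreement of the two actions
    of \<open>P\<close> on functions vanishing on \<open>F'\<close> is what ties the sides
    together.\<close>
  have "card ({..<m} \<times> ?X1 - {..<m} \<times> ?X2) + card ({..<n} \<times> ?X2 - {..<n} \<times> ?X1)
      = card ({..<m} \<times> ?X2 - {..<m} \<times> ?X1) + card ({..<n} \<times> ?X1 - {..<n} \<times> ?X2)"
  proof (rule relative_card_invariant)
    show "flinear (mact ?\<tau>1 m n Q)" "flinear (mact ?\<tau>2 m n Q)"
      by (rule flinear_mact)+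
    show "mact ?\<tau>1 n m P f \<in> supp_on ({..<n} \<times> ?X1)" "mact ?\<tau>2 n m P f \<in> supp_on ({..<n} \<times> ?X2)" for f
      by (rule mact_in_supp_on, erule (2) act_outside[OF _ PA, rotated], rule br)+
    show "mact ?\<tau>1 m n Q f \<in> supp_on ({..<m} \<times> ?X1)" "mact ?\<tau>2 m n Q f \<in> supp_on ({..<m} \<times> ?X2)" for f
      by (rule mact_in_supp_on, erule (2) act_outside[OF _ QA, rotated], rule br)+
    show "f \<in> supp_on ({..<m} \<times> ?X1) \<Longrightarrow> mact ?\<tau>1 m n Q (mact ?\<tau>1 n m P f) = f"
      "f \<in> supp_on ({..<m} \<times> ?X2) \<Longrightarrow> mact ?\<tau>2 m n Q (mact ?\<tau>2 n m P f) = f" for f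
      by (rule mact_mact[OF QP], (rule br | assumption)+)+
    show "g \<in> supp_on ({..<n} \<times> ?X1) \<Longrightarrow> mact ?\<tau>1 n m P (mact ?\<tau>1 m n Q g) = g"
      "g \<in> supp_on ({..<n} \<times> ?X2) \<Longrightarrow> mact ?\<tau>2 n m P (mact ?\<tau>2 m n Q g) = g" for g
      by (rule mact_mact[OF PQ], (rule br | assumption)+)+
  qed (rule finF' findiff agree | assumption)+
  then have "m * card (?X1 - ?X2) + n * card (?X2 - ?X1) = m * card (?X2 - ?X1) + n * card (?X1 - ?X2)"
    unfolding diff card_cartesian_product card_lessThan .
  from arg_cong[OF this, of int]
  have eq: "int m * int (card (?X1 - ?X2)) + int n * int (card (?X2 - ?X1))
      = int m * int (card (?X2 - ?X1)) + int n * int (card (?X1 - ?X2))"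
    unfolding of_nat_add of_nat_mult .
  \<comment> \<open>The sets are final segments, so a larger start \<open>a w\<close> means fewer
    points; hence the signs. The difference of the two truncated subtractions is the integer
    difference.\<close>
  have "int (card (?X2 - ?X1)) - int (card (?X1 - ?X2)) = (\<Sum>w\<in>verts E. int (a w) - int (b w))"
    unfolding card_br_set_diff of_nat_sum sum_subtractf[symmetric] by (intro sum.cong refl) simp
  then have "int (card (?X2 - ?X1)) \<noteq> int (card (?X1 - ?X2))"
    using ne by linarith
  moreover have "(int m - int n) * (int (card (?X1 - ?X2)) - int (card (?X2 - ?X1))) = 0"
    using eq by (simp add: algebra_simps)
  ultimately show ?thesis
    by simp
qed

text \<open>Harmonicity makes the threshold \<open>T\<close> the same for \<open>a\<close> and
  \<open>b\<close>, so a single bijection \<open>g\<close> from level \<open>M\<close> on extends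
  downwards for both; on that common part \<open>G\<close> and \<open>H\<close> agree.\<close>

lemma ex_branching_pair:
  assumes M: "\<And>w. w \<in> verts E \<Longrightarrow> a w \<le> M" "\<And>w. w \<in> verts E \<Longrightarrow> b w \<le> M"
    and harm: "\<And>w. w \<in> regular_verts E \<Longrightarrow>
      int (a w) - int (b w) = (\<Sum>e\<in>out_arcs E w. int (a (head E e)) - int (b (head E e)))"
  obtains G H where "branching a G" "branching b H" "\<And>e k. e \<in> arcs E \<Longrightarrow> M \<le> k \<Longrightarrow> G e k = H e k"
proof -
  let ?O = "out_arcs E"
  let ?\<Phi> = "\<lambda>w GH. w \<in> regular_verts E \<longrightarrow>
      bij_betw (fst GH) (Sigma (?O w) (\<lambda>e. {a (head E e)..})) {a w..}
    \<and> bij_betw (snd GH) (Sigma (?O w) (\<lambda>e. {b (head E e)..})) {b w..}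
    \<and> (\<forall>e\<in>?O w. \<forall>k\<ge>M. fst GH (e, k) = snd GH (e, k))"
  have ex: "\<exists>GH :: ('e \<times> nat \<Rightarrow> nat) \<times> ('e \<times> nat \<Rightarrow> nat). ?\<Phi> w GH" for w
  proof (cases "w \<in> regular_verts E")
    case True
    then have O: "finite (?O w)" "?O w \<noteq> {}"
      by (auto simp: regular_verts_def)
    have le: "a (head E e) \<le> M" "b (head E e) \<le> M" if "e \<in> ?O w" for e
      using that M by simp_all
    define T where "T = a w + (\<Sum>e\<in>?O w. M - a (head E e))"
    have diffs: "int (\<Sum>e\<in>?O w. M - c (head E e)) = (\<Sum>e\<in>?O w. int M - int (c (head E e)))"
      if "\<And>e. e \<in> ?O w \<Longrightarrow> c (head E e) \<le> M" for c
      unfolding of_nat_sum using that by (intro sum.cong refl) (simp add: of_nat_diff)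
    have "int (\<Sum>e\<in>?O w. M - a (head E e)) = (\<Sum>e\<in>?O w. int M - int (a (head E e)))"
      "int (\<Sum>e\<in>?O w. M - b (head E e)) = (\<Sum>e\<in>?O w. int M - int (b (head E e)))"
      by (rule diffs, erule le)+
    then have "int (a w + (\<Sum>e\<in>?O w. M - a (head E e))) = int (b w + (\<Sum>e\<in>?O w. M - b (head E e)))"
      using harm[OF True] by (simp only: of_nat_add sum_subtractf)
    then have T_eq: "T = b w + (\<Sum>e\<in>?O w. M - b (head E e))"
      unfolding T_def by (simp only: of_nat_eq_iff)
    obtain g where g: "bij_betw g (?O w \<times> {M..}) {T..}"
      using ex_bij_infinite_nat[OF O] by blast
    obtain G where G: "bij_betw G (Sigma (?O w) (\<lambda>e. {a (head E e)..})) {a w..}"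
        "\<forall>e\<in>?O w. \<forall>k\<ge>M. G (e, k) = g (e, k)"
      using ex_bij_extend[OF O(1) le(1) T_def g] by blast
    obtain H where H: "bij_betw H (Sigma (?O w) (\<lambda>e. {b (head E e)..})) {b w..}"
        "\<forall>e\<in>?O w. \<forall>k\<ge>M. H (e, k) = g (e, k)"
      using ex_bij_extend[OF O(1) le(2) T_eq g] by blast
    show ?thesis
      using G H by (intro exI[of _ "(G, H)"]) simp
  qed simp
  have "\<exists>GH. \<forall>w. ?\<Phi> w (GH w)"
    by (rule choice, rule allI, rule ex)
  then obtain GH where GH_all: "\<forall>w. ?\<Phi> w (GH w)"
    by (elim exE)
  note GH = GH_all[THEN spec, THEN mp]
  \<comment> \<open>The bijections are chosen per vertex; the tail of an edge selects the one that
    applies to it.\<close>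
  have "branching a (\<lambda>e k. fst (GH (tail E e)) (e, k))"
    unfolding branching_def
  proof
    fix w assume w: "w \<in> regular_verts E"
    show "bij_betw (\<lambda>(e, k). fst (GH (tail E e)) (e, k)) (Sigma (?O w) (\<lambda>e. {a (head E e)..})) {a w..}"
      by (subst bij_betw_cong[of _ _ "fst (GH w)"]) (use GH[OF w] in auto)
  qed
  moreover have "branching b (\<lambda>e k. snd (GH (tail E e)) (e, k))"
    unfolding branching_def
  proof
    fix w assume w: "w \<in> regular_verts E"
    show "bij_betw (\<lambda>(e, k). snd (GH (tail E e)) (e, k)) (Sigma (?O w) (\<lambda>e. {b (head E e)..})) {b w..}"
      by (subst bij_betw_cong[of _ _ "snd (GH w)"]) (use GH[OF w] in auto)
  qed
  moreover have "fst (GH (tail E e)) (e, k) = snd (GH (tail E e)) (e, k)" if "e \<in> arcs E" "M \<le> k" for e k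
    using GH[OF tail_regular[OF that(1)]] that by simp
  ultimately show ?thesis
    by (rule that)
qed

lemma invariant_basis_number_if_harmonic:
  fixes \<phi> :: "'v \<Rightarrow> int"
  assumes harm: "\<And>w. w \<in> regular_verts E \<Longrightarrow> \<phi> w = (\<Sum>e\<in>out_arcs E w. \<phi> (head E e))"
    and ne: "(\<Sum>w\<in>verts E. \<phi> w) \<noteq> 0"
  shows "invariant_basis_number (leavitt_path_algebra K E)"
proof -
  define a where "a = (\<lambda>w. nat (\<phi> w))"
  define b where "b = (\<lambda>w. nat (- \<phi> w))"
  have \<phi>: "int (a w) - int (b w) = \<phi> w" for w
    by (simp add: a_def b_def)
  define M where "M = (\<Sum>w\<in>verts E. a w + b w)"
  have "a w + b w \<le> M" if "w \<in> verts E" for w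
    unfolding M_def using that by (intro member_le_sum) simp_all
  then have M: "a w \<le> M" "b w \<le> M" if "w \<in> verts E" for w
    using that add_leE by blast+
  obtain G H where GH: "branching a G" "branching b H" "\<And>e k. e \<in> arcs E \<Longrightarrow> M \<le> k \<Longrightarrow> G e k = H e k"
    using ex_branching_pair[of a M b] M harm unfolding \<phi> by blast
  have "m = n" if "free_rmodule_iso quot m n" for m n
    by (rule branching_pair_imp_eq[OF GH(1,2) M GH(3) _ that]) (simp_all add: \<phi> ne)
  then show ?thesis
    unfolding invariant_basis_number_def leavitt_path_algebra_eq by blast
qed

end

section \<open>The rank criterion\<close>

text \<open>The Fredholm alternative: if \<open>b\<close> is outside the span of the columns, some
  linear functional vanishes on the columns and takes the value one at \<open>b\<close>; its values
  on the unit vectors are the coefficients \<open>y\<close>.\<close>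

lemma linear_system_alternative:
  fixes m :: "nat \<Rightarrow> nat \<Rightarrow> 'k::field" and b :: "nat \<Rightarrow> 'k"
  shows "(\<exists>x. \<forall>i<h. (\<Sum>j<k. m i j * x j) = b i) \<or>
    (\<exists>y. (\<forall>j<k. (\<Sum>i<h. y i * m i j) = 0) \<and> (\<Sum>i<h. y i * b i) = 1)"
proof -
  \<comment> \<open>Vectors of length \<open>h\<close> are represented by functions on all naturals
    that vanish from \<open>h\<close> on.\<close>
  define col_fun where "col_fun = (\<lambda>j i. if i < h then m i j else 0)"
  define b_fun where "b_fun = (\<lambda>i. if i < h then b i else 0)"
  let ?C = "col_fun ` {..<k}"
  show ?thesis
  proof (cases "b_fun \<in> fs.span ?C")
    case True
    define W where "W = {f. \<exists>x. f = (\<lambda>i. \<Sum>j<k. col_fun j i * x j)}"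
    have "fs.subspace W"
    proof (rule fs.subspaceI)
      show "0 \<in> W"
        unfolding W_def by (intro CollectI exI[of _ "\<lambda>_. 0"]) (simp add: fun_eq_iff)
      fix f g assume "f \<in> W" "g \<in> W"
      then obtain x y where "f = (\<lambda>i. \<Sum>j<k. col_fun j i * x j)" "g = (\<lambda>i. \<Sum>j<k. col_fun j i * y j)"
        unfolding W_def by blast
      then show "f + g \<in> W"
        unfolding W_def
        by (intro CollectI exI[of _ "\<lambda>j. x j + y j"]) (simp add: fun_eq_iff distrib_left sum.distrib)
    next
      fix c f assume "f \<in> W"
      then obtain x where "f = (\<lambda>i. \<Sum>j<k. col_fun j i * x j)"
        unfolding W_def by blast
      then show "fscale c f \<in> W"
        unfolding W_def
        by (intro CollectI exI[of _ "\<lambda>j. c * x j"])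
          (simp add: fun_eq_iff fscale_def sum_distrib_left mult.left_commute)
    qed
    moreover have "?C \<subseteq> W"
    proof
      fix f assume "f \<in> ?C"
      then obtain j where j: "j < k" "f = col_fun j"
        by blast
      have "col_fun j i = (\<Sum>j'<k. col_fun j' i * (if j' = j then 1 else 0))" for i
        using j(1) by (simp add: if_distrib[of "\<lambda>x. _ * x"] cong: if_cong)
      then show "f \<in> W"
        unfolding W_def j(2) by (intro CollectI exI[of _ "\<lambda>j'. if j' = j then 1 else 0"]) (rule ext)
    qed
    ultimately have "b_fun \<in> W"
      using True fs.span_minimal by blast
    then obtain x where x: "b_fun = (\<lambda>i. \<Sum>j<k. col_fun j i * x j)"
      unfolding W_def by blast
    have "(\<Sum>j<k. m i j * x j) = b i" if "i < h" for i
      using fun_cong[OF x, of i] that by (simp add: b_fun_def col_fun_def)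
    then show ?thesis
      by blast
  next
    case False
    obtain B where B: "B \<subseteq> ?C" "fs.independent B" "?C \<subseteq> fs.span B"
      using fs.maximal_independent_subset by blast
    have "b_fun \<notin> fs.span B"
      using False fs.span_mono[OF B(1)] by blast
    then have ind: "fs.independent (insert b_fun B)" and "b_fun \<notin> B"
      using B(2) fs.independent_insertI fs.span_base by blast+
    \<comment> \<open>The functional takes values in functions on the one-point type because the
      interpreted pair of vector spaces has function spaces on both sides.\<close>
    obtain g :: "(nat \<Rightarrow> 'k) \<Rightarrow> unit \<Rightarrow> 'k" where g: "flinear g"
      "\<forall>f\<in>insert b_fun B. g f = (if f = b_fun then (\<lambda>_. 1) else 0)"
      using fsp.linear_independent_extend[OF ind, of "\<lambda>f. if f = b_fun then (\<lambda>_. 1) else 0"] by blast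
    have "g f = 0" if "f \<in> B" for f
      using g(2) that \<open>b_fun \<notin> B\<close> by auto
    then have g_span: "g f = 0" if "f \<in> fs.span B" for f
      using fsp.linear_eq_0_on_span[OF g(1) _ that] by blast
    define y where "y = (\<lambda>i. g (unit_fun i) ())"
    have g_eq: "g (\<lambda>i. if i < h then f i else 0) () = (\<Sum>i<h. y i * f i)" for f
    proof -
      have "(\<lambda>i. if i < h then f i else 0) = (\<Sum>i<h. fscale (f i) (unit_fun i))"
        by (auto simp: fun_eq_iff sum_fun_apply fscale_def unit_fun_def if_distrib[of "\<lambda>x. _ * x"] cong: if_cong)
      then show ?thesis
        by (simp add: fsp.linear_sum[OF g(1)] fsp.linear_scale[OF g(1)] sum_fun_apply y_def)
          (simp add: fscale_def mult.commute)
    qed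
    have "(\<Sum>i<h. y i * m i j) = 0" if "j < k" for j
    proof -
      have "col_fun j \<in> fs.span B"
        using B(3) that by blast
      from g_span[OF this] show ?thesis
        using g_eq[of "\<lambda>i. m i j"] by (simp add: col_fun_def)
    qed
    moreover have "(\<Sum>i<h. y i * b i) = 1"
      using g_eq[of b] g(2) by (simp add: b_fun_def)
    ultimately show ?thesis
      by blast
  qed
qed

lemma ex_common_denominator:
  fixes x :: "nat \<Rightarrow> rat"
  shows "\<exists>N>0. \<exists>c. \<forall>i<h. of_nat N * x i = of_int (c i)"
proof (induction h)
  case 0
  then show ?case
    by (intro exI[of _ 1]) simp
next
  case (Suc h)
  then obtain N c where N: "N > 0" and c: "\<And>i. i < h \<Longrightarrow> of_nat N * x i = of_int (c i)"
    by blast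
  obtain p q where pq: "quotient_of (x h) = (p, q)"
    by fastforce
  then have q: "q > 0" "x h = of_int p / of_int q"
    by (auto dest: quotient_of_denom_pos quotient_of_div)
  define c' where "c' = (\<lambda>i. if i = h then int N * p else q * c i)"
  have "of_nat (N * nat q) * x i = of_int (c' i)" if "i < Suc h" for i
  proof (cases "i = h")
    case True
    then show ?thesis
      using q by (simp add: c'_def of_nat_nat)
  next
    case False
    then have "i < h"
      using that by simp
    from c[OF this] show ?thesis
      using q False by (simp add: c'_def of_nat_nat mult.commute mult.left_commute)
  qed
  then show ?case
    using N q by (intro exI[of _ "N * nat q"]) auto
qed

text \<open>A maximal independent set \<open>U\<close> of columns computes the rank and stays
  independent together with a \<open>b\<close> outside the column span. For a \<open>b\<close>
  inside, both matrices have the same column span.\<close>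

lemma (in vec_space) rank_adjoin_col_less_iff:
  assumes M: "M \<in> carrier_mat n nc" and b: "b \<in> carrier_vec n"
  shows "rank M < rank (adjoin_col M b) \<longleftrightarrow> b \<notin> span (set (cols M))"
proof -
  have S: "set (cols M) \<subseteq> carrier_vec n"
    using M cols_dim by blast
  have cols: "cols (adjoin_col M b) = cols M @ [b]"
    unfolding adjoin_col_def using M S b by (intro cols_mat_of_cols) auto
  then have set_cols: "set (cols (adjoin_col M b)) = insert b (set (cols M))"
    by auto
  have dim: "adjoin_col M b \<in> carrier_mat n (Suc nc)"
    using M by (auto simp: adjoin_col_def)
  show ?thesis
  proof
    assume less: "rank M < rank (adjoin_col M b)"
    show "b \<notin> span (set (cols M))"
    proof
      assume b_span: "b \<in> span (set (cols M))"
      have "span (insert b (set (cols M))) = span (set (cols M))"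
        using already_in_span[OF S b_span] by simp
      then show False
        using less unfolding rank_def set_cols by simp
    qed
  next
    assume notin: "b \<notin> span (set (cols M))"
    obtain U where U: "maximal U (\<lambda>T. T \<subseteq> set (cols M) \<and> lin_indpt T)"
      using maximal_exists[of "(\<lambda>T. T \<subseteq> set (cols M) \<and> lin_indpt T)" "card (set (cols M))" "{}"]
      by (meson List.finite_set card_mono empty_iff empty_subsetI finite_lin_indpt2 rev_finite_subset)
    then have U': "U \<subseteq> set (cols M)" "lin_indpt U"
      by (auto simp: maximal_def)
    have "finite U"
      using U'(1) finite_subset by blast
    have U_carrier: "U \<subseteq> carrier_vec n"
      using U'(1) S by (rule subset_trans)
    have notin_U: "b \<notin> span U"
      using notin span_is_monotone[OF U'(1)] by (rule contra_subsetD[rotated])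
    have "b \<notin> U"
    proof
      assume "b \<in> U"
      from span_mem[OF U_carrier this] notin_U show False
        by (rule notE[rotated])
    qed
    have "lin_indpt (U \<union> {b})"
      using lin_dep_iff_in_span[of U b] U_carrier U'(2) b \<open>b \<notin> U\<close> notin_U by simp
    then have "card (U \<union> {b}) \<le> rank (adjoin_col M b)"
      using U'(1) by (intro rank_ge_card_indpt[OF dim]) (auto simp: set_cols)
    moreover have "rank M = card U"
      by (rule rank_card_indpt[OF M U])
    ultimately show "rank M < rank (adjoin_col M b)"
      using \<open>finite U\<close> \<open>b \<notin> U\<close> by simp
  qed
qed

lemma rank_over_rat_less_iff:
  assumes M: "M \<in> carrier_mat h k" and b: "b \<in> carrier_vec h"
  shows "rank_over_rat M < rank_over_rat (adjoin_col M b) \<longleftrightarrow>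
    \<not> (\<exists>x. \<forall>i<h. (\<Sum>j<k. rat_of_int (M $$ (i, j)) * x j) = rat_of_int (b $ i))"
proof -
  let ?M = "map_mat rat_of_int M" and ?b = "map_vec rat_of_int b"
  interpret vec_space "TYPE(rat)" h .
  have M': "?M \<in> carrier_mat h k" and b': "?b \<in> carrier_vec h"
    using M b by auto
  have dims: "dim_row M = h" "dim_col M = k" "dim_vec b = h"
    using M b by auto
  have "map_mat rat_of_int (adjoin_col M b) = adjoin_col ?M ?b"
  proof (rule eq_matI)
    fix i j assume "i < dim_row (adjoin_col ?M ?b)" "j < dim_col (adjoin_col ?M ?b)"
    then have ij: "i < h" "j < Suc k"
      using dims by (simp_all add: adjoin_col_def)
    show "map_mat rat_of_int (adjoin_col M b) $$ (i, j) = adjoin_col ?M ?b $$ (i, j)"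
      using ij dims by (cases "j < k") (simp_all add: adjoin_col_def mat_of_cols_index nth_append)
  qed (simp_all add: adjoin_col_def)
  moreover have "dim_row (adjoin_col M b) = h"
    using dims by (simp add: adjoin_col_def)
  ultimately have "rank_over_rat M < rank_over_rat (adjoin_col M b) \<longleftrightarrow> ?b \<notin> col_space ?M"
    using rank_adjoin_col_less_iff[OF M' b'] dims by (simp add: rank_over_rat_def col_space_def)
  also have "?b \<in> col_space ?M \<longleftrightarrow> (\<exists>x\<in>carrier_vec k. ?M *\<^sub>v x = ?b)"
    unfolding col_space_eq[OF M'] using b' dims by simp
  also have "\<dots> \<longleftrightarrow> (\<exists>x. \<forall>i<h. (\<Sum>j<k. rat_of_int (M $$ (i, j)) * x j) = rat_of_int (b $ i))"
  proof
    assume "\<exists>x\<in>carrier_vec k. ?M *\<^sub>v x = ?b"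
    then obtain x where x: "x \<in> carrier_vec k" "?M *\<^sub>v x = ?b"
      by blast
    have "(\<Sum>j<k. rat_of_int (M $$ (i, j)) * x $ j) = rat_of_int (b $ i)" if "i < h" for i
    proof -
      have "(?M *\<^sub>v x) $ i = ?b $ i"
        by (simp only: x(2))
      then show ?thesis
        using that x(1) dims by (simp add: scalar_prod_def atLeast0LessThan)
    qed
    then show "\<exists>x. \<forall>i<h. (\<Sum>j<k. rat_of_int (M $$ (i, j)) * x j) = rat_of_int (b $ i)"
      by (intro exI[of _ "\<lambda>j. x $ j"]) simp
  next
    assume "\<exists>x. \<forall>i<h. (\<Sum>j<k. rat_of_int (M $$ (i, j)) * x j) = rat_of_int (b $ i)"
    then obtain x where x: "\<forall>i<h. (\<Sum>j<k. rat_of_int (M $$ (i, j)) * x j) = rat_of_int (b $ i)"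
      by blast
    have "?M *\<^sub>v vec k x = ?b"
      by (rule eq_vecI) (use x dims in \<open>simp_all add: scalar_prod_def atLeast0LessThan\<close>)
    then show "\<exists>x\<in>carrier_vec k. ?M *\<^sub>v x = ?b"
      by (intro bexI[of _ "vec k x"]) simp_all
  qed
  finally show ?thesis
    by simp
qed

section \<open>The criterion for a numbered vertex set\<close>

context lpa
begin

context
  fixes v :: "nat \<Rightarrow> 'v" and h z :: nat
  assumes bij: "bij_betw v {..<h} (verts E)" and z: "z \<le> h" and reg: "v ` {..<z} = regular_verts E"
begin

lemma numbering_inj: "i < h \<Longrightarrow> j < h \<Longrightarrow> v i = v j \<longleftrightarrow> i = j"
  using bij by (auto simp: bij_betw_def inj_on_def)

lemma sum_verts: "(\<Sum>w\<in>verts E. f w) = (\<Sum>i<h. f (v i))"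
  using sum.reindex_bij_betw[OF bij, of f] by simp

lemma sum_regular: "(\<Sum>w\<in>regular_verts E. f w) = (\<Sum>i<z. f (v i))"
proof -
  have "bij_betw v {..<z} (regular_verts E)"
    using bij z reg by (intro bij_betw_subset[OF bij]) auto
  from sum.reindex_bij_betw[OF this, of f] show ?thesis
    by simp
qed

lemma irregular_no_arcs:
  assumes "i < h" "\<not> i < z"
  shows "{e \<in> arcs E. tail E e = v i \<and> head E e = w} = {}"
proof (rule ccontr)
  assume "{e \<in> arcs E. tail E e = v i \<and> head E e = w} \<noteq> {}"
  then obtain e where "e \<in> arcs E" "tail E e = v i"
    by blast
  then have "v i \<in> v ` {..<z}"
    using tail_regular[of e] reg by simp
  then obtain j where "j < z" "v i = v j"
    by blast
  then show False
    using numbering_inj[of i j] assms z by simp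
qed

text \<open>The transpose puts the source into the column: column \<open>j\<close> records how
  replacing a regular \<open>v j\<close> by the heads of its edges changes the multiplicity of each
  \<open>v i\<close>. For a vertex that is not regular the column is zero.\<close>

definition entry :: "nat \<Rightarrow> nat \<Rightarrow> int" where
  "entry i j = int (card {e \<in> arcs E. tail E e = v j \<and> head E e = v i}) - (if i = j \<and> i < z then 1 else 0)"

lemma entry_irregular: "j < h \<Longrightarrow> \<not> j < z \<Longrightarrow> entry i j = 0"
  by (simp add: entry_def irregular_no_arcs)

lemma sum_entry_regular: "(\<Sum>j<h. f j * entry i j) = (\<Sum>j<z. f j * entry i j)"
  using z by (intro sum.mono_neutral_right) (auto simp: entry_irregular)

lemma not_ibn_if_solvable:
  assumes x: "\<And>i. i < h \<Longrightarrow> (\<Sum>j<h. rat_of_int (entry i j) * x j) = 1"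
  shows "\<not> invariant_basis_number (leavitt_path_algebra K E)"
proof -
  obtain N c where N: "N > 0" and c: "\<forall>j<h. rat_of_nat N * x j = rat_of_int (c j)"
    using ex_common_denominator[of h x] by blast
  \<comment> \<open>Coefficients are carried over from indices to vertices by inverting the
    numbering.\<close>
  define c' where "c' = (\<lambda>w. c (the_inv_into {..<h} v w))"
  have c': "c' (v j) = c j" if "j < h" for j
    using that bij by (simp add: c'_def bij_betw_def the_inv_into_f_f)
  have "int N = (\<Sum>j<h. c j * entry i j)" if i: "i < h" for i
  proof -
    have "rat_of_int (\<Sum>j<h. c j * entry i j) = (\<Sum>j<h. rat_of_nat N * x j * rat_of_int (entry i j))"
      unfolding of_int_sum of_int_mult using c by (intro sum.cong refl) simp
    also have "\<dots> = rat_of_nat N * (\<Sum>j<h. rat_of_int (entry i j) * x j)"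
      by (simp add: sum_distrib_left mult_ac)
    also have "\<dots> = rat_of_int (int N)"
      using x[OF i] by simp
    finally show ?thesis
      by (simp only: of_int_eq_iff)
  qed
  then have eq: "int N = (\<Sum>j<z. c j * entry i j)" if "i < h" for i
    using that sum_entry_regular[of c i] by simp
  show ?thesis
  proof (rule not_invariant_basis_number[OF N])
    fix w assume "w \<in> verts E"
    then obtain i where i: "i < h" "w = v i"
      using bij by (auto simp: bij_betw_def)
    show "int N = (\<Sum>y\<in>regular_verts E. c' y * (int (card {e \<in> arcs E. tail E e = y \<and> head E e = w})
        - (if w = y then 1 else 0)))"
      unfolding eq[OF i(1)] sum_regular
    proof (rule sum.cong[OF refl])
      fix j assume "j \<in> {..<z}"
      then have j: "j < z" "j < h"
        using z by simp_all
      show "c j * entry i j = c' (v j) * (int (card {e \<in> arcs E. tail E e = v j \<and> head E e = w})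
          - (if w = v j then 1 else 0))"
        using j i numbering_inj[OF i(1) j(2)] by (auto simp: c' entry_def)
    qed
  qed
qed

text \<open>Orthogonality of \<open>y\<close> to column \<open>j\<close> is harmonicity at a regular
  \<open>v j\<close>, and the total one becomes the non-zero total \<open>N\<close> after clearing
  denominators.\<close>

lemma ibn_if_left_kernel:
  assumes y: "\<And>j. j < h \<Longrightarrow> (\<Sum>i<h. y i * rat_of_int (entry i j)) = 0" and y1: "(\<Sum>i<h. y i) = 1"
  shows "invariant_basis_number (leavitt_path_algebra K E)"
proof -
  obtain N c where N: "N > 0" and c: "\<forall>i<h. rat_of_nat N * y i = rat_of_int (c i)"
    using ex_common_denominator[of h y] by blast
  define \<phi> where "\<phi> = (\<lambda>w. c (the_inv_into {..<h} v w))"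
  have \<phi>: "\<phi> (v j) = c j" if "j < h" for j
    using that bij by (simp add: \<phi>_def bij_betw_def the_inv_into_f_f)
  have "rat_of_int (\<Sum>i<h. c i) = rat_of_nat N * (\<Sum>i<h. y i)"
    unfolding of_int_sum sum_distrib_left using c by (intro sum.cong refl) simp
  then have "rat_of_int (\<Sum>i<h. c i) = rat_of_int (int N)"
    using y1 by simp
  then have sum_c: "(\<Sum>i<h. c i) = int N"
    by (simp only: of_int_eq_iff)
  have kern: "(\<Sum>i<h. c i * entry i j) = 0" if j: "j < h" for j
  proof -
    have "rat_of_int (\<Sum>i<h. c i * entry i j) = (\<Sum>i<h. rat_of_nat N * y i * rat_of_int (entry i j))"
      unfolding of_int_sum of_int_mult using c by (intro sum.cong refl) simp
    also have "\<dots> = rat_of_nat N * (\<Sum>i<h. y i * rat_of_int (entry i j))"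
      by (simp add: sum_distrib_left mult.assoc)
    also have "\<dots> = rat_of_int 0"
      using y[OF j] by simp
    finally show ?thesis
      by (simp only: of_int_eq_iff)
  qed
  show ?thesis
  proof (rule invariant_basis_number_if_harmonic[where \<phi> = \<phi>])
    have "(\<Sum>w\<in>verts E. \<phi> w) = (\<Sum>i<h. c i)"
      unfolding sum_verts by (intro sum.cong refl) (simp add: \<phi>)
    then show "(\<Sum>w\<in>verts E. \<phi> w) \<noteq> 0"
      using N sum_c by simp
  next
    fix w assume "w \<in> regular_verts E"
    then obtain j where j: "j < z" "w = v j"
      using reg by blast
    then have jh: "j < h"
      using z by simp
    have "(\<Sum>e\<in>out_arcs E w. \<phi> (head E e))
        = (\<Sum>y\<in>verts E. \<Sum>e\<in>{e \<in> out_arcs E w. head E e = y}. \<phi> (head E e))"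
      by (rule sum.group[symmetric]) auto
    also have "\<dots> = (\<Sum>y\<in>verts E. \<phi> y * int (card {e \<in> arcs E. tail E e = w \<and> head E e = y}))"
    proof (rule sum.cong[OF refl])
      fix y
      have "{e \<in> out_arcs E w. head E e = y} = {e \<in> arcs E. tail E e = w \<and> head E e = y}"
        by auto
      then show "(\<Sum>e\<in>{e \<in> out_arcs E w. head E e = y}. \<phi> (head E e))
          = \<phi> y * int (card {e \<in> arcs E. tail E e = w \<and> head E e = y})"
        by simp
    qed
    \<comment> \<open>\<open>entry\<close> subtracts one on the diagonal at the regular vertex
      \<open>w\<close>; adding back \<open>c j\<close> there restores the plain edge count.\<close>
    also have "\<dots> = (\<Sum>i<h. c i * entry i j + (if i = j then c j else 0))"
      unfolding sum_verts
    proof (rule sum.cong[OF refl])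
      fix i assume "i \<in> {..<h}"
      then show "\<phi> (v i) * int (card {e \<in> arcs E. tail E e = w \<and> head E e = v i})
          = c i * entry i j + (if i = j then c j else 0)"
        using j by (simp add: \<phi> entry_def algebra_simps)
    qed
    also have "\<dots> = \<phi> w"
      using kern[OF jh] jh j \<phi>[OF jh] by (simp add: sum.distrib)
    finally show "\<phi> w = (\<Sum>e\<in>out_arcs E w. \<phi> (head E e))"
      by (rule sym)
  qed
qed

lemma ibn_iff_unsolvable:
  "invariant_basis_number (leavitt_path_algebra K E) \<longleftrightarrow>
    \<not> (\<exists>x. \<forall>i<h. (\<Sum>j<h. rat_of_int (entry i j) * x j) = 1)"
proof (cases "\<exists>x. \<forall>i<h. (\<Sum>j<h. rat_of_int (entry i j) * x j) = 1")
  case True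
  then obtain x where "\<forall>i<h. (\<Sum>j<h. rat_of_int (entry i j) * x j) = 1"
    by blast
  then have "\<not> invariant_basis_number (leavitt_path_algebra K E)"
    by (intro not_ibn_if_solvable[of x]) simp
  then show ?thesis
    using True by simp
next
  case False
  then obtain y where "\<forall>j<h. (\<Sum>i<h. y i * rat_of_int (entry i j)) = 0" "(\<Sum>i<h. y i * 1) = 1"
    using linear_system_alternative[where m = "\<lambda>i j. rat_of_int (entry i j)" and b = "\<lambda>_. 1" and h = h and k = h]
    by blast
  then have "invariant_basis_number (leavitt_path_algebra K E)"
    by (intro ibn_if_left_kernel[of y]) simp_all
  then show ?thesis
    using False by simp
qed

lemma matrix_entry:
  assumes "i < h" "j < h"
  shows "(transpose_mat (incidence_mat E v h) - J_mat h z) $$ (i, j) = entry i j"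
  using assms z by (auto simp: incidence_mat_def J_mat_def entry_def)

end

end

theorem theorem2p5:
  fixes E :: "('v, 'e) pre_digraph"
    and v :: "nat \<Rightarrow> 'v"
    and h z :: nat
  assumes "fin_digraph E"
    and "verts E \<noteq> {}"
    and "bij_betw v {..<h} (verts E)"
    and "z \<le> h"
    and "v ` {..<z} = regular_verts E"
  shows "invariant_basis_number (leavitt_path_algebra TYPE('k::field) E) \<longleftrightarrow>
         rank_over_rat (transpose_mat (incidence_mat E v h) - J_mat h z)
         < rank_over_rat (adjoin_col (transpose_mat (incidence_mat E v h) - J_mat h z)
             (vec h (\<lambda>_. 1)))"
proof -
  interpret lpa E "TYPE('k)"
    using assms(1) by (rule lpa.intro)
  have M: "transpose_mat (incidence_mat E v h) - J_mat h z \<in> carrier_mat h h"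
    using assms(4) by (auto simp: incidence_mat_def J_mat_def)
  show ?thesis
    unfolding ibn_iff_unsolvable[OF assms(3-5)] rank_over_rat_less_iff[OF M vec_carrier]
    by (simp add: matrix_entry[OF assms(3-5)])
qed

end
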